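(* Let $E$ be the total space of a smooth real vector bundle over the sphere $S^n$ with its round metric, endowed with a Euclidean structure and a compatible connection $\nabla$. Let $p_0\in S^n$, let $\mathcal{U}=S^n-\{p_0,-p_0\}$, and let $\hat\alpha$ denote the gradient of the distance function to $p_0$, regarded as a unit vector field on $\mathcal{U}$. If $(D_{\hat\alpha}R^\nabla)(\hat\alpha,X)V=0$ for all $p\in\mathcal{U}$, all $X\in T_pS^n$ and all $V\in E_p$, then $\nabla$ is parallel, i.e. $(D_ZR^\nabla)(X,Y)V=0$ for all $p\in S^n$, all $X,Y,Z\in T_pS^n$ and all $V\in E_p$.
   Context: A Euclidean structure on a vector bundle is a smoothly varying inner product on the fibers; a connection $\nabla$ is compatible if it preserves this inner product (metric connection). $E_p$ is the fiber over $p$. $R^\nabla$ is the curvature tensor of $\nabla$, $R^\nabla(X,Y)V=\nabla_X\nabla_YV-\nabla_Y\nabla_XV-\nabla_{[X,Y]}V$. $D$ denotes the covariant derivative of tensors induced by $\nabla$ on $E$ and the Levi-Civita connection $\overline\nabla$ of the round metric on $S^n$, so that $(D_ZR^\nabla)(X,Y)V=\nabla_Z(R^\nabla(X,Y)V)-R^\nabla(\overline\nabla_ZX,Y)V-R^\nabla(X,\overline\nabla_ZY)V-R^\nabla(X,Y)\nabla_ZV$. *)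

theory Defs
  imports "HOL-Analysis.Analysis"
begin

text \<open>The sphere of dimension n is the unit sphere of a Euclidean space of dimension n + 1
  (n = DIM('a) - 1), with the round metric induced by the inner product. Functions, vector fields
  and sections on the sphere are total functions on the ambient space of which only the values
  on the sphere matter.\<close>

abbreviation usphere :: "'a::euclidean_space set"
  where "usphere \<equiv> sphere 0 1"

definition tangent :: "'a::euclidean_space \<Rightarrow> 'a set"
  where "tangent p = {x. x \<bullet> p = 0}"

section \<open>Smooth functions and vector fields on the sphere\<close>

text \<open>\<open>Ck_on k W f\<close>: f is k times continuously differentiable on the open set W.\<close>

primrec Ck_on :: "nat \<Rightarrow> 'a::euclidean_space set \<Rightarrow> ('a \<Rightarrow> 'b::real_normed_vector) \<Rightarrow> bool"
  where
    "Ck_on 0 W f \<longleftrightarrow> continuous_on W f"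
  | "Ck_on (Suc k) W f \<longleftrightarrow>
       (\<forall>x\<in>W. f differentiable (at x)) \<and> (\<forall>v. Ck_on k W (\<lambda>x. frechet_derivative f (at x) v))"

text \<open>Smoothness on a relatively open subset A of the sphere: local smooth extendability to the
  ambient space, as usual for embedded submanifolds.\<close>

definition smooth_fun :: "'a::euclidean_space set \<Rightarrow> ('a \<Rightarrow> 'b::real_normed_vector) \<Rightarrow> bool"
  where "smooth_fun A f \<longleftrightarrow>
    (\<forall>p\<in>A. \<exists>W h. open W \<and> p \<in> W \<and> (\<forall>k. Ck_on k W h) \<and> (\<forall>q\<in>W \<inter> A. h q = f q))"

text \<open>The derivative of f at p in the direction x. Frechet derivatives within the sphere are
  only determined on tangent vectors; this is used for x in \<open>tangent p\<close> only.\<close>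

definition sderiv :: "('a::euclidean_space \<Rightarrow> 'b::real_normed_vector) \<Rightarrow> 'a \<Rightarrow> 'a \<Rightarrow> 'b"
  where "sderiv f p x = frechet_derivative f (at p within usphere) x"

definition vfield :: "('a::euclidean_space \<Rightarrow> 'a) \<Rightarrow> bool"
  where "vfield X \<longleftrightarrow> (\<forall>p\<in>usphere. X p \<in> tangent p) \<and> smooth_fun usphere X"

text \<open>The Lie bracket is the vector field acting on functions as \<open>f \<mapsto> X (Y f) - Y (X f)\<close>.\<close>

definition lie_bracket :: "('a::euclidean_space \<Rightarrow> 'a) \<Rightarrow> ('a \<Rightarrow> 'a) \<Rightarrow> 'a \<Rightarrow> 'a"
  where "lie_bracket X Y p = (THE w. w \<in> tangent p \<and>
    (\<forall>f :: 'a \<Rightarrow> real. smooth_fun usphere f \<longrightarrow>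
       sderiv f p w = sderiv (\<lambda>q. sderiv f q (Y q)) p (X p) - sderiv (\<lambda>q. sderiv f q (X q)) p (Y p)))"

definition levi_civita :: "(('a::euclidean_space \<Rightarrow> 'a) \<Rightarrow> ('a \<Rightarrow> 'a) \<Rightarrow> 'a \<Rightarrow> 'a) \<Rightarrow> bool"
  where "levi_civita nb \<longleftrightarrow>
    (\<forall>X Y. vfield X \<longrightarrow> vfield Y \<longrightarrow> vfield (nb X Y)) \<and>
    (\<forall>X X' Y Y'. vfield X \<longrightarrow> vfield X' \<longrightarrow> vfield Y \<longrightarrow> vfield Y' \<longrightarrow>
       (\<forall>p\<in>usphere. X p = X' p \<and> Y p = Y' p) \<longrightarrow> (\<forall>p\<in>usphere. nb X Y p = nb X' Y' p)) \<and>
    (\<forall>f h X X' Y. smooth_fun usphere f \<longrightarrow> smooth_fun usphere h \<longrightarrow>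
       vfield X \<longrightarrow> vfield X' \<longrightarrow> vfield Y \<longrightarrow>
       (\<forall>p\<in>usphere. nb (\<lambda>q. f q *\<^sub>R X q + h q *\<^sub>R X' q) Y p = f p *\<^sub>R nb X Y p + h p *\<^sub>R nb X' Y p)) \<and>
    (\<forall>X Y Y'. vfield X \<longrightarrow> vfield Y \<longrightarrow> vfield Y' \<longrightarrow>
       (\<forall>p\<in>usphere. nb X (\<lambda>q. Y q + Y' q) p = nb X Y p + nb X Y' p)) \<and>
    (\<forall>f X Y. smooth_fun usphere f \<longrightarrow> vfield X \<longrightarrow> vfield Y \<longrightarrow>
       (\<forall>p\<in>usphere. nb X (\<lambda>q. f q *\<^sub>R Y q) p = sderiv f p (X p) *\<^sub>R Y p + f p *\<^sub>R nb X Y p)) \<and>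
    (\<forall>X Y Z. vfield X \<longrightarrow> vfield Y \<longrightarrow> vfield Z \<longrightarrow>
       (\<forall>p\<in>usphere. sderiv (\<lambda>q. Y q \<bullet> Z q) p (X p) = nb X Y p \<bullet> Z p + Y p \<bullet> nb X Z p)) \<and>
    (\<forall>X Y. vfield X \<longrightarrow> vfield Y \<longrightarrow>
       (\<forall>p\<in>usphere. nb X Y p - nb Y X p = lie_bracket X Y p))"

section \<open>The distance function and its gradient\<close>

text \<open>The Riemannian distance: the infimum of the lengths of C1 curves on the sphere. (Piecewise C1
  in the sense of \<open>valid_path\<close> would not do: its derivative may be non-integrable near the
  exceptional points.)\<close>

definition sphere_dist :: "'a::euclidean_space \<Rightarrow> 'a \<Rightarrow> real"
  where "sphere_dist p q =
    Inf {integral {0..1} (\<lambda>t. norm (vector_derivative c (at t))) | c.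
           c C1_differentiable_on {0..1} \<and> path_image c \<subseteq> usphere \<and> pathstart c = p \<and> pathfinish c = q}"

definition gradient :: "('a::euclidean_space \<Rightarrow> real) \<Rightarrow> 'a \<Rightarrow> 'a"
  where "gradient f p = (THE w. w \<in> tangent p \<and> (\<forall>x\<in>tangent p. w \<bullet> x = sderiv f p x))"

section \<open>Vector bundles over the sphere\<close>

text \<open>The model fibre is a linear subspace of a Euclidean space \<open>'f\<close>, so that every rank,
  including 0, occurs. A local trivialization \<open>(U, \<phi>)\<close> stands for the bundle chart
  \<open>e \<mapsto> (proj e, \<phi> e)\<close> from the part of the total space over U to U times the model fibre;
  topology and smooth structure of the total space are those induced by the bundle atlas.\<close>

record ('a, 'e, 'f) vbundle =
  total :: "'e set"
  proj :: "'e \<Rightarrow> 'a"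
  fplus :: "'e \<Rightarrow> 'e \<Rightarrow> 'e"
  fscale :: "real \<Rightarrow> 'e \<Rightarrow> 'e"
  fzero :: "'a \<Rightarrow> 'e"
  model :: "'f set"
  trivs :: "('a set \<times> ('e \<Rightarrow> 'f)) set"

definition fibre :: "('a, 'e, 'f) vbundle \<Rightarrow> 'a \<Rightarrow> 'e set"
  where "fibre E p = {e \<in> total E. proj E e = p}"

definition fminus :: "('a, 'e, 'f) vbundle \<Rightarrow> 'e \<Rightarrow> 'e \<Rightarrow> 'e"
  where "fminus E a b = fplus E a (fscale E (- 1) b)"

text \<open>The vector space axioms in the fibres need not be listed: they follow from the existence of
  bijections onto the model fibre that respect the operations.\<close>

definition vector_bundle :: "('a::euclidean_space, 'e, 'f::euclidean_space) vbundle \<Rightarrow> bool"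
  where "vector_bundle E \<longleftrightarrow>
    proj E ` total E \<subseteq> usphere \<and>
    subspace (model E) \<and>
    (\<forall>p\<in>usphere. fzero E p \<in> fibre E p \<and>
       (\<forall>a\<in>fibre E p. \<forall>b\<in>fibre E p. fplus E a b \<in> fibre E p) \<and>
       (\<forall>r. \<forall>a\<in>fibre E p. fscale E r a \<in> fibre E p)) \<and>
    (\<Union>(U, \<phi>)\<in>trivs E. U) = usphere \<and>
    (\<forall>(U, \<phi>)\<in>trivs E. openin (top_of_set usphere) U \<and>
       (\<forall>p\<in>U. bij_betw \<phi> (fibre E p) (model E) \<and> \<phi> (fzero E p) = 0 \<and>
          (\<forall>a\<in>fibre E p. \<forall>b\<in>fibre E p. \<phi> (fplus E a b) = \<phi> a + \<phi> b) \<and>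
          (\<forall>r. \<forall>a\<in>fibre E p. \<phi> (fscale E r a) = r *\<^sub>R \<phi> a))) \<and>
    (\<forall>(U, \<phi>)\<in>trivs E. \<forall>(W, \<psi>)\<in>trivs E. \<forall>v\<in>model E.
       smooth_fun (U \<inter> W) (\<lambda>p. \<psi> (inv_into (fibre E p) \<phi> v)))"

definition smooth_section ::
  "('a::euclidean_space, 'e, 'f::euclidean_space) vbundle \<Rightarrow> ('a \<Rightarrow> 'e) \<Rightarrow> bool"
  where "smooth_section E V \<longleftrightarrow>
    (\<forall>p\<in>usphere. V p \<in> fibre E p) \<and> (\<forall>(U, \<phi>)\<in>trivs E. smooth_fun U (\<lambda>p. \<phi> (V p)))"

definition euclidean_structure ::
  "('a::euclidean_space, 'e, 'f::euclidean_space) vbundle \<Rightarrow> ('e \<Rightarrow> 'e \<Rightarrow> real) \<Rightarrow> bool"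
  where "euclidean_structure E g \<longleftrightarrow>
    (\<forall>p\<in>usphere. \<forall>a\<in>fibre E p.
       (\<forall>b\<in>fibre E p. g a b = g b a \<and>
          (\<forall>r. g (fscale E r a) b = r * g a b) \<and>
          (\<forall>c\<in>fibre E p. g (fplus E a b) c = g a c + g b c)) \<and>
       (a \<noteq> fzero E p \<longrightarrow> g a a > 0)) \<and>
    (\<forall>(U, \<phi>)\<in>trivs E. \<forall>v\<in>model E. \<forall>w\<in>model E.
       smooth_fun U (\<lambda>p. g (inv_into (fibre E p) \<phi> v) (inv_into (fibre E p) \<phi> w)))"

definition connection ::
  "('a::euclidean_space, 'e, 'f::euclidean_space) vbundle
     \<Rightarrow> (('a \<Rightarrow> 'a) \<Rightarrow> ('a \<Rightarrow> 'e) \<Rightarrow> 'a \<Rightarrow> 'e) \<Rightarrow> bool"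
  where "connection E nabla \<longleftrightarrow>
    (\<forall>X V. vfield X \<longrightarrow> smooth_section E V \<longrightarrow> smooth_section E (nabla X V)) \<and>
    (\<forall>X X' V V'. vfield X \<longrightarrow> vfield X' \<longrightarrow> smooth_section E V \<longrightarrow> smooth_section E V' \<longrightarrow>
       (\<forall>p\<in>usphere. X p = X' p \<and> V p = V' p) \<longrightarrow> (\<forall>p\<in>usphere. nabla X V p = nabla X' V' p)) \<and>
    (\<forall>f h X X' V. smooth_fun usphere f \<longrightarrow> smooth_fun usphere h \<longrightarrow>
       vfield X \<longrightarrow> vfield X' \<longrightarrow> smooth_section E V \<longrightarrow>
       (\<forall>p\<in>usphere. nabla (\<lambda>q. f q *\<^sub>R X q + h q *\<^sub>R X' q) V p
          = fplus E (fscale E (f p) (nabla X V p)) (fscale E (h p) (nabla X' V p)))) \<and>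
    (\<forall>X V V'. vfield X \<longrightarrow> smooth_section E V \<longrightarrow> smooth_section E V' \<longrightarrow>
       (\<forall>p\<in>usphere. nabla X (\<lambda>q. fplus E (V q) (V' q)) p = fplus E (nabla X V p) (nabla X V' p))) \<and>
    (\<forall>f X V. smooth_fun usphere f \<longrightarrow> vfield X \<longrightarrow> smooth_section E V \<longrightarrow>
       (\<forall>p\<in>usphere. nabla X (\<lambda>q. fscale E (f q) (V q)) p
          = fplus E (fscale E (sderiv f p (X p)) (V p)) (fscale E (f p) (nabla X V p))))"

definition compatible ::
  "('a::euclidean_space, 'e, 'f::euclidean_space) vbundle \<Rightarrow> ('e \<Rightarrow> 'e \<Rightarrow> real)
     \<Rightarrow> (('a \<Rightarrow> 'a) \<Rightarrow> ('a \<Rightarrow> 'e) \<Rightarrow> 'a \<Rightarrow> 'e) \<Rightarrow> bool"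
  where "compatible E g nabla \<longleftrightarrow>
    (\<forall>X V W. vfield X \<longrightarrow> smooth_section E V \<longrightarrow> smooth_section E W \<longrightarrow>
       (\<forall>p\<in>usphere. sderiv (\<lambda>q. g (V q) (W q)) p (X p)
          = g (nabla X V p) (W p) + g (V p) (nabla X W p)))"

section \<open>Curvature and its covariant derivative\<close>

definition curv ::
  "('a::euclidean_space, 'e, 'f::euclidean_space) vbundle
     \<Rightarrow> (('a \<Rightarrow> 'a) \<Rightarrow> ('a \<Rightarrow> 'e) \<Rightarrow> 'a \<Rightarrow> 'e)
     \<Rightarrow> ('a \<Rightarrow> 'a) \<Rightarrow> ('a \<Rightarrow> 'a) \<Rightarrow> ('a \<Rightarrow> 'e) \<Rightarrow> 'a \<Rightarrow> 'e"
  where "curv E nabla X Y V p =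
    fminus E (fminus E (nabla X (nabla Y V) p) (nabla Y (nabla X V) p))
      (nabla (lie_bracket X Y) V p)"

definition Dcurv_fields ::
  "('a::euclidean_space, 'e, 'f::euclidean_space) vbundle
     \<Rightarrow> (('a \<Rightarrow> 'a) \<Rightarrow> ('a \<Rightarrow> 'e) \<Rightarrow> 'a \<Rightarrow> 'e)
     \<Rightarrow> (('a \<Rightarrow> 'a) \<Rightarrow> ('a \<Rightarrow> 'a) \<Rightarrow> 'a \<Rightarrow> 'a)
     \<Rightarrow> ('a \<Rightarrow> 'a) \<Rightarrow> ('a \<Rightarrow> 'a) \<Rightarrow> ('a \<Rightarrow> 'a) \<Rightarrow> ('a \<Rightarrow> 'e) \<Rightarrow> 'a \<Rightarrow> 'e"
  where "Dcurv_fields E nabla nb Z X Y V p =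
    fminus E (fminus E (fminus E
        (nabla Z (curv E nabla X Y V) p)
        (curv E nabla (nb Z X) Y V p))
        (curv E nabla X (nb Z Y) V p))
        (curv E nabla X Y (nabla Z V) p)"

text \<open>\<open>Dcurv E nabla nb p z x y v\<close> is \<open>(D\<^sub>z R)(x, y) v\<close> for tangent vectors z, x, y at p and v in the
  fibre over p: the common value at p of \<open>Dcurv_fields\<close> on all smooth global extensions of these
  vectors (the expression is tensorial, and such extensions exist).\<close>

definition Dcurv ::
  "('a::euclidean_space, 'e, 'f::euclidean_space) vbundle
     \<Rightarrow> (('a \<Rightarrow> 'a) \<Rightarrow> ('a \<Rightarrow> 'e) \<Rightarrow> 'a \<Rightarrow> 'e)
     \<Rightarrow> (('a \<Rightarrow> 'a) \<Rightarrow> ('a \<Rightarrow> 'a) \<Rightarrow> 'a \<Rightarrow> 'a)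
     \<Rightarrow> 'a \<Rightarrow> 'a \<Rightarrow> 'a \<Rightarrow> 'a \<Rightarrow> 'e \<Rightarrow> 'e"
  where "Dcurv E nabla nb p z x y v =
    (THE e. \<forall>Z X Y V. vfield Z \<longrightarrow> vfield X \<longrightarrow> vfield Y \<longrightarrow> smooth_section E V \<longrightarrow>
       Z p = z \<longrightarrow> X p = x \<longrightarrow> Y p = y \<longrightarrow> V p = v \<longrightarrow>
       Dcurv_fields E nabla nb Z X Y V p = e)"

end

theory Submission
  imports Defs "HOL-Library.Function_Algebras"
begin

text \<open>Along a great circle from \<open>p0\<close> to \<open>- p0\<close> with velocity \<open>N\<close> the hypothesis says that the curvature
  components \<open>R(N, \<xi>)\<close> are parallel. The second Bianchi identity then yields a linear second order
  equation for \<open>S = R(\<xi>, \<eta>) + [R(N, \<xi>), R(N, \<eta>)]\<close>, two first integrals of which vanish at \<open>p0\<close> and at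
  \<open>- p0\<close> respectively; this forces \<open>S = 0\<close>. At \<open>p0\<close>, where every direction can play the role of \<open>N\<close>, it
  follows that R respects the brackets of the orthogonal Lie algebra. This bracket identity is again
  parallel along the great circles, and it is the obstruction for \<open>sin t D\<^sub>\<xi> R\<close> to be parallel along
  them; as \<open>sin t D\<^sub>\<xi> R\<close> vanishes at \<open>p0\<close>, it vanishes everywhere.

  No parallel frames are needed: the Bianchi identity is the Jacobi identity for operators on global
  sections, and uniqueness of parallel transport is a Gronwall estimate for the coefficients with
  respect to a finite generating family of global sections.\<close>


section \<open>Smooth functions\<close>

text \<open>The radial direction is represented by \<open>radial p0\<close>, the gradient of the
  distance times the sine of the distance: this field is smooth at both poles and commutes with the
  Killing fields of the rotations that fix \<open>p0\<close>. Such Killing fields have length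
  proportional to \<open>sin t\<close> on a circle, and evaluated on them the Bianchi identity loses
  its brackets with the radial direction. With a prime for the covariant derivative along
  \<open>N\<close>, the result is that \<open>M = 2 cos t S + sin t S'\<close> is parallel, so
  \<open>sin^2 t S\<close> has derivative \<open>sin t M\<close>. Regularity at \<open>p0\<close>
  alone admits the solution \<open>S = M / (1 + cos t)\<close>, singular at \<open>- p0\<close>
  unless \<open>M = 0\<close>; this is why the argument runs from pole to pole. In the limit at
  \<open>p0\<close> the identity \<open>S = 0\<close> reads
  \<open>[R(N, \<xi>), R(N, \<eta>)] = - R(\<xi>, \<eta>)\<close> with any unit tangent vector
  orthogonal to \<open>\<xi>\<close> and \<open>\<eta>\<close> as \<open>N\<close>, and the Jacobi
  identity extends these relations to all brackets that occur later. The sine in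
  \<open>sin t D\<^sub>\<xi> R\<close> comes from a Killing field again, whose zero at
  \<open>p0\<close> supplies the initial value.\<close>

lemma Ck_on_cong:
  assumes "open W" "\<And>x. x \<in> W \<Longrightarrow> f x = g x" "Ck_on k W f"
  shows "Ck_on k W g"
  using assms(2,3)
proof (induction k arbitrary: f g)
  case 0
  then show ?case by (simp cong: continuous_on_cong)
next
  case (Suc k)
  have fd: "f differentiable (at x)" if "x \<in> W" for x using Suc that by simp
  have gd: "(g has_derivative frechet_derivative f (at x)) (at x)" if "x \<in> W" for x
    using fd[OF that] Suc.prems(1) assms(1) that
    by (meson frechet_derivative_works has_derivative_transform_within_open)
  have eq: "frechet_derivative f (at x) v = frechet_derivative g (at x) v" if "x \<in> W" for x v
    using frechet_derivative_at[OF gd[OF that]] by simp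
  have "Ck_on k W (\<lambda>x. frechet_derivative g (at x) v)" for v
    by (rule Suc.IH[of "\<lambda>x. frechet_derivative f (at x) v"]) (use eq Suc.prems in auto)
  then show ?case using gd by (auto simp: differentiable_def)
qed

lemma Ck_on_subset: "Ck_on k W f \<Longrightarrow> W' \<subseteq> W \<Longrightarrow> Ck_on k W' f"
  by (induction k arbitrary: f) (auto intro: continuous_on_subset)

lemma Ck_on_SucD: "Ck_on (Suc k) W f \<Longrightarrow> Ck_on k W f"
proof (induction k arbitrary: f)
  case 0
  then show ?case
    by (auto intro!: continuous_at_imp_continuous_on differentiable_imp_continuous_within)
next
  case (Suc k)
  then show ?case by (metis Ck_on.simps(2))
qed

lemma Ck_on_has_derivative:
  "Ck_on (Suc k) W f \<Longrightarrow> x \<in> W \<Longrightarrow> (f has_derivative frechet_derivative f (at x)) (at x)"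
  by (simp add: frechet_derivative_works[symmetric])

lemma Ck_on_SucI:
  assumes "open W" "\<And>x. x \<in> W \<Longrightarrow> (f has_derivative f' x) (at x)" "\<And>v. Ck_on k W (\<lambda>x. f' x v)"
  shows "Ck_on (Suc k) W f"
proof -
  have "Ck_on k W (\<lambda>x. frechet_derivative f (at x) v)" for v
    by (rule Ck_on_cong[OF assms(1) _ assms(3)[of v]]) (metis assms(2) frechet_derivative_at)
  then show ?thesis using assms(2) by (auto simp: differentiable_def)
qed

lemma Ck_on_const: "open W \<Longrightarrow> Ck_on k W (\<lambda>x. c)"
proof (induction k arbitrary: c)
  case (Suc k)
  then show ?case by (intro Ck_on_SucI[where f'="\<lambda>_ _. 0"]) auto
qed simp

lemma Ck_on_ident: "open W \<Longrightarrow> Ck_on k W (\<lambda>x. x)"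
proof (cases k)
  case (Suc k')
  then show "open W \<Longrightarrow> Ck_on k W (\<lambda>x. x)"
    unfolding Suc by (intro Ck_on_SucI[where f'="\<lambda>_ v. v"]) (auto simp: Ck_on_const)
qed (simp add: continuous_on_id)

lemma Ck_on_add:
  assumes "open W" "Ck_on k W f" "Ck_on k W g"
  shows "Ck_on k W (\<lambda>x. f x + g x)"
  using assms(2,3)
proof (induction k arbitrary: f g)
  case (Suc k)
  have "((\<lambda>x. f x + g x) has_derivative
      (\<lambda>v. frechet_derivative f (at x) v + frechet_derivative g (at x) v)) (at x)" if "x \<in> W" for x
    using Ck_on_has_derivative[OF Suc.prems(1) that] Ck_on_has_derivative[OF Suc.prems(2) that]
    by (rule has_derivative_add)
  then show ?case using Suc assms(1) by (intro Ck_on_SucI) auto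
qed (auto intro: continuous_intros)

text \<open>The product rule expresses the derivative by two products of the same shape, so the
  induction runs over all pairs \<open>f\<close>, \<open>g\<close>; the factor that is not
  differentiated is brought down one order by \<open>Ck_on_SucD\<close>.\<close>

lemma Ck_on_bilinear:
  assumes "bounded_bilinear pr" "open W" "Ck_on k W f" "Ck_on k W g"
  shows "Ck_on k W (\<lambda>x. pr (f x) (g x))"
  using assms(3,4)
proof (induction k arbitrary: f g)
  case 0
  then show ?case using bounded_bilinear.continuous_on[OF assms(1)] by auto
next
  case (Suc k)
  have "((\<lambda>x. pr (f x) (g x)) has_derivative
      (\<lambda>v. pr (f x) (frechet_derivative g (at x) v) + pr (frechet_derivative f (at x) v) (g x))) (at x)"
    if "x \<in> W" for x
    using bounded_bilinear.FDERIV[OF assms(1) Ck_on_has_derivative[OF Suc.prems(1) that]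
        Ck_on_has_derivative[OF Suc.prems(2) that]] .
  moreover have "Ck_on k W (\<lambda>x. pr (f x) (frechet_derivative g (at x) v) + pr (frechet_derivative f (at x) v) (g x))" for v
    using Suc.prems Ck_on_SucD[OF Suc.prems(1)] Ck_on_SucD[OF Suc.prems(2)]
    by (intro Ck_on_add Suc.IH assms(2)) auto
  ultimately show ?case using assms(2) by (intro Ck_on_SucI) auto
qed

lemma Ck_on_compose_real:
  fixes f :: "'a::euclidean_space \<Rightarrow> real" and \<phi> :: "real \<Rightarrow> real"
  assumes "open W" "open T" "f ` W \<subseteq> T" "Ck_on k T \<phi>" "Ck_on k W f"
  shows "Ck_on k W (\<lambda>x. \<phi> (f x))"
  using assms(4,5)
proof (induction k arbitrary: \<phi>)
  case 0
  then show ?case using assms(3) continuous_on_compose2 by auto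
next
  case (Suc k)
  have 1: "((\<lambda>x. \<phi> (f x)) has_derivative
      (\<lambda>v. frechet_derivative f (at x) v * frechet_derivative \<phi> (at (f x)) 1)) (at x)"
    if "x \<in> W" for x
  proof -
    have fT: "f x \<in> T" using that assms(3) by auto
    have lin: "linear (frechet_derivative \<phi> (at (f x)))"
      using Suc.prems(1) fT by (simp add: linear_frechet_derivative)
    have "frechet_derivative \<phi> (at (f x)) s = s * frechet_derivative \<phi> (at (f x)) 1" for s
      using linear_scale[OF lin, of s 1] by simp
    show ?thesis
      by (rule has_derivative_eq_rhs[OF has_derivative_compose[OF Ck_on_has_derivative[OF Suc.prems(2) that]
              Ck_on_has_derivative[OF Suc.prems(1) fT]]]) (rule ext, fact)
  qed
  have "Ck_on k W (\<lambda>x. frechet_derivative \<phi> (at (f x)) 1)"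
    by (rule Suc.IH) (use Suc.prems Ck_on_SucD in auto)
  then have "Ck_on k W (\<lambda>x. frechet_derivative f (at x) v * frechet_derivative \<phi> (at (f x)) 1)" for v
    using Suc.prems by (intro Ck_on_bilinear[OF bounded_bilinear_mult] assms(1)) auto
  with 1 show ?case using assms(1) by (intro Ck_on_SucI) auto
qed

text \<open>Constant multiples of powers of \<open>inverse\<close> are closed under differentiation,
  so the induction on the order closes once the exponent is left general.\<close>

lemma Ck_on_inverse: "Ck_on k {0<..} (\<lambda>x::real. inverse x ^ Suc n)"
proof (induction k arbitrary: n)
  case 0
  then show ?case by (auto intro!: continuous_intros)
next
  case (Suc k)
  have 1: "((\<lambda>x::real. inverse x ^ Suc n) has_derivative (\<lambda>v. v * (- real (Suc n) * inverse x ^ Suc (Suc n)))) (at x)"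
    if "x \<in> {0<..}" for x
  proof -
    have "(inverse has_real_derivative - (inverse x * inverse x)) (at x)"
      using that DERIV_inverse[of x] by (simp add: power2_eq_square)
    from DERIV_power_Suc[OF this, of n, unfolded has_field_derivative_def] show ?thesis
      by (rule has_derivative_eq_rhs) (auto simp: algebra_simps)
  qed
  show ?case
    by (rule Ck_on_SucI[OF _ 1])
      (auto simp del: power_Suc intro!: Ck_on_bilinear[OF bounded_bilinear_mult] Ck_on_const Suc.IH)
qed

section \<open>A smooth function that is flat at the origin\<close>

definition flat :: "nat \<Rightarrow> real \<Rightarrow> real"
  where "flat n x = (if x > 0 then inverse x ^ n * exp (- inverse x) else 0)"

lemma flat_pos_iff: "0 < flat n x \<longleftrightarrow> 0 < x" and flat_nonneg: "0 \<le> flat n x"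
  by (auto simp: flat_def)

lemma flat_tendsto_0: "(flat n \<longlongrightarrow> 0) (at 0)"
proof -
  have "((\<lambda>x. inverse x ^ n / exp (inverse x)) \<longlongrightarrow> (0::real)) (at_right 0)"
    using filterlim_compose[OF tendsto_power_div_exp_0 filterlim_inverse_at_top_right] .
  then have "(flat n \<longlongrightarrow> 0) (at_right 0)"
    by (rule Lim_transform_eventually)
      (auto simp: flat_def exp_minus field_simps eventually_at_right_less intro!: eventually_at_rightI[of 0 1])
  moreover have "(flat n \<longlongrightarrow> 0) (at_left 0)"
    by (rule Lim_transform_eventually[where f="\<lambda>_. 0"])
      (auto simp: flat_def intro!: eventually_at_leftI[of "-1"])
  ultimately show ?thesis by (simp add: filterlim_split_at)
qed

text \<open>The factors \<open>inverse x ^ n\<close> are carried along because the derivatives of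
  \<open>exp (- inverse x)\<close> lie in the span of this family; smoothness of every
  \<open>flat n\<close> then follows by a single induction.\<close>

lemma flat_has_derivative:
  "(flat n has_real_derivative (flat (n + 2) x - real n * flat (n + 1) x)) (at x)"
proof -
  consider "x < 0" | "x = 0" | "x > 0" by linarith
  then show ?thesis
  proof cases
    case 1
    have "(flat n has_real_derivative 0) (at x)"
      by (rule has_field_derivative_transform_within_open[where S="{..<0}" and f="\<lambda>_. 0"])
        (use 1 in \<open>auto simp: flat_def\<close>)
    then show ?thesis using 1 by (simp add: flat_def)
  next
    case 2
    \<comment> \<open>The difference quotient of \<open>flat n\<close> at 0 is
      \<open>flat (n + 1)\<close>, which tends to 0.\<close>
    have "((\<lambda>h. (flat n (0 + h) - flat n 0) / h) \<longlongrightarrow> 0) (at 0)"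
      by (rule Lim_transform_eventually[OF flat_tendsto_0[of "n+1"]])
        (auto simp: flat_def field_simps intro!: always_eventually)
    then show ?thesis using 2 by (simp add: DERIV_def flat_def)
  next
    case 3
    have inv: "(inverse has_real_derivative - (inverse x * inverse x)) (at x)"
      using 3 DERIV_inverse[of x] by (simp add: power2_eq_square)
    have pow: "((\<lambda>x. inverse x ^ n) has_real_derivative - (real n * inverse x ^ (n + 1))) (at x)"
    proof (cases n)
      case (Suc m)
      then show ?thesis using DERIV_power_Suc[OF inv, of m] by (simp add: algebra_simps)
    qed simp
    have "((\<lambda>x. inverse x ^ n * exp (- inverse x)) has_real_derivative
        (flat (n + 2) x - real n * flat (n + 1) x)) (at x)"
      by (rule DERIV_cong[OF DERIV_mult[OF pow DERIV_chain2[OF DERIV_exp DERIV_minus[OF inv]]]])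
        (use 3 in \<open>simp add: flat_def algebra_simps\<close>)
    then show ?thesis
      by (rule has_field_derivative_transform_within_open[where S="{0<..}"]) (use 3 in \<open>auto simp: flat_def\<close>)
  qed
qed

lemma Ck_on_flat: "Ck_on k UNIV (flat n)"
proof (induction k arbitrary: n)
  case 0
  then show ?case
    using flat_has_derivative by (auto intro!: continuous_at_imp_continuous_on DERIV_isCont)
next
  case (Suc k)
  have 1: "(flat n has_derivative (\<lambda>v. v * (flat (n + 2) x + (- real n) * flat (n + 1) x))) (at x)" for x
    by (rule has_derivative_eq_rhs[OF flat_has_derivative[of n x, unfolded has_field_derivative_def]])
      (auto simp: algebra_simps)
  show ?case
    by (rule Ck_on_SucI[OF open_UNIV 1])
      (intro Ck_on_bilinear[OF bounded_bilinear_mult] Ck_on_add Ck_on_const Suc.IH open_UNIV)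
qed

section \<open>Functions on subsets with local smooth extensions\<close>

definition Cinf_on :: "'a::euclidean_space set \<Rightarrow> ('a \<Rightarrow> 'b::real_normed_vector) \<Rightarrow> bool"
  where "Cinf_on W h \<longleftrightarrow> open W \<and> (\<forall>k. Ck_on k W h)"

lemma Cinf_onI: "open W \<Longrightarrow> (\<And>k. Ck_on k W h) \<Longrightarrow> Cinf_on W h"
  and Cinf_on_open: "Cinf_on W h \<Longrightarrow> open W"
  and Cinf_on_Ck: "Cinf_on W h \<Longrightarrow> Ck_on k W h"
  by (auto simp: Cinf_on_def)

lemma Cinf_on_subset: "Cinf_on W h \<Longrightarrow> open W' \<Longrightarrow> W' \<subseteq> W \<Longrightarrow> Cinf_on W' h"
  by (auto simp: Cinf_on_def intro: Ck_on_subset)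

lemma Cinf_on_Int: "Cinf_on W h \<Longrightarrow> open W' \<Longrightarrow> Cinf_on (W \<inter> W') h"
  by (rule Cinf_on_subset) (auto dest: Cinf_on_open)

lemma smooth_fun_iff: "smooth_fun A f \<longleftrightarrow> (\<forall>p\<in>A. \<exists>W h. Cinf_on W h \<and> p \<in> W \<and> (\<forall>q\<in>W \<inter> A. h q = f q))"
  unfolding smooth_fun_def Cinf_on_def by (simp only: conj_ac)

lemma smooth_fun_extension:
  assumes "smooth_fun A f" "p \<in> A"
  obtains W h where "Cinf_on W h" "p \<in> W" "\<forall>q\<in>W \<inter> A. h q = f q"
  using assms unfolding smooth_fun_iff by blast

lemma smooth_funI:
  assumes "Cinf_on W f" "A \<subseteq> W"
  shows "smooth_fun A f"
  unfolding smooth_fun_iff using assms by blast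

lemma smooth_fun_subset:
  assumes "smooth_fun A f" "B \<subseteq> A" shows "smooth_fun B f"
  using assms unfolding smooth_fun_iff by (meson IntD1 IntD2 IntI subsetD)

lemma smooth_fun_cong: "smooth_fun A f \<Longrightarrow> (\<And>x. x \<in> A \<Longrightarrow> f x = g x) \<Longrightarrow> smooth_fun A g"
  unfolding smooth_fun_def by simp

text \<open>Smoothness is a local property. The auxiliary \<open>f'\<close> may depend on the point,
  as functions defined through local extensions or by cutoffs require.\<close>

lemma smooth_fun_local:
  assumes "\<And>p. p \<in> A \<Longrightarrow> \<exists>W f'. open W \<and> p \<in> W \<and> smooth_fun (W \<inter> A) f' \<and> (\<forall>q\<in>W \<inter> A. f' q = f q)"
  shows "smooth_fun A f"
  unfolding smooth_fun_iff
proof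
  fix p assume p: "p \<in> A"
  then obtain W f' where W: "open W" "p \<in> W" "smooth_fun (W \<inter> A) f'" "\<forall>q\<in>W \<inter> A. f' q = f q"
    using assms by blast
  obtain W' h where W': "Cinf_on W' h" "p \<in> W'" "\<forall>q\<in>W' \<inter> (W \<inter> A). h q = f' q"
    by (rule smooth_fun_extension[OF W(3), of p]) (use p W in auto)
  then show "\<exists>W h. Cinf_on W h \<and> p \<in> W \<and> (\<forall>q\<in>W \<inter> A. h q = f q)"
    using W by (intro exI[of _ "W' \<inter> W"] exI[of _ h]) (auto intro: Cinf_on_Int)
qed

lemma smooth_fun_const: "smooth_fun A (\<lambda>x. c)"
  by (rule smooth_funI[of UNIV]) (auto simp: Ck_on_const Cinf_onI)

lemma smooth_fun_ident: "smooth_fun A (\<lambda>x. x)"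
  by (rule smooth_funI[of UNIV]) (auto simp: Ck_on_ident Cinf_onI)

lemma smooth_fun_lift2:
  fixes A :: "'a::euclidean_space set"
  assumes pr: "\<And>(W::'a set) k h1 h2. open W \<Longrightarrow> Ck_on k W h1 \<Longrightarrow> Ck_on k W h2 \<Longrightarrow> Ck_on k W (\<lambda>x. pr (h1 x) (h2 x))"
    and f: "smooth_fun A f" and g: "smooth_fun A g"
  shows "smooth_fun A (\<lambda>x. pr (f x) (g x))"
  unfolding smooth_fun_iff
proof
  fix p assume p: "p \<in> A"
  obtain W1 h1 where 1: "Cinf_on W1 h1" "p \<in> W1" "\<forall>q\<in>W1 \<inter> A. h1 q = f q"
    by (rule smooth_fun_extension[OF f p])
  obtain W2 h2 where 2: "Cinf_on W2 h2" "p \<in> W2" "\<forall>q\<in>W2 \<inter> A. h2 q = g q"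
    by (rule smooth_fun_extension[OF g p])
  have "Cinf_on (W1 \<inter> W2) h1" "Cinf_on (W1 \<inter> W2) h2"
    using 1 2 by (auto intro: Cinf_on_subset dest: Cinf_on_open)
  then have "Cinf_on (W1 \<inter> W2) (\<lambda>x. pr (h1 x) (h2 x))"
    by (intro Cinf_onI pr) (auto dest: Cinf_on_open Cinf_on_Ck)
  then show "\<exists>W h. Cinf_on W h \<and> p \<in> W \<and> (\<forall>q\<in>W \<inter> A. h q = pr (f q) (g q))"
    using 1 2 by (intro exI[of _ "W1 \<inter> W2"] exI[of _ "\<lambda>x. pr (h1 x) (h2 x)"]) auto
qed

lemma smooth_fun_add: "smooth_fun A f \<Longrightarrow> smooth_fun A g \<Longrightarrow> smooth_fun A (\<lambda>x. f x + g x)"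
  by (rule smooth_fun_lift2[where pr="(+)"]) (auto intro: Ck_on_add)

lemma smooth_fun_bilinear:
  "bounded_bilinear pr \<Longrightarrow> smooth_fun A f \<Longrightarrow> smooth_fun A g \<Longrightarrow> smooth_fun A (\<lambda>x. pr (f x) (g x))"
  by (rule smooth_fun_lift2[where pr=pr]) (auto intro: Ck_on_bilinear)

lemmas smooth_fun_mult = smooth_fun_bilinear[OF bounded_bilinear_mult]
  and smooth_fun_scaleR = smooth_fun_bilinear[OF bounded_bilinear_scaleR]
  and smooth_fun_inner = smooth_fun_bilinear[OF bounded_bilinear_inner]

lemma smooth_fun_minus: "smooth_fun A f \<Longrightarrow> smooth_fun A (\<lambda>x. - f x)"
  using smooth_fun_scaleR[OF smooth_fun_const[where c="-1"]] by fastforce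

lemma smooth_fun_diff: "smooth_fun A f \<Longrightarrow> smooth_fun A g \<Longrightarrow> smooth_fun A (\<lambda>x. f x - g x)"
  using smooth_fun_add[OF _ smooth_fun_minus] by fastforce

lemma smooth_fun_sum:
  "(\<And>i. i \<in> I \<Longrightarrow> smooth_fun A (f i)) \<Longrightarrow> smooth_fun A (\<lambda>x. \<Sum>i\<in>I. f i x)"
  by (induction I rule: infinite_finite_induct) (auto intro: smooth_fun_const smooth_fun_add)

lemma smooth_fun_compose_real:
  fixes f :: "'a::euclidean_space \<Rightarrow> real" and \<phi> :: "real \<Rightarrow> real"
  assumes "open T" "\<And>k. Ck_on k T \<phi>" "smooth_fun A f" "f ` A \<subseteq> T"
  shows "smooth_fun A (\<lambda>x. \<phi> (f x))"
  unfolding smooth_fun_iff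
proof
  fix p assume p: "p \<in> A"
  obtain W h where h: "Cinf_on W h" "p \<in> W" "\<forall>q\<in>W \<inter> A. h q = f q"
    by (rule smooth_fun_extension[OF assms(3) p])
  have "continuous_on W h" using Cinf_on_Ck[OF h(1), of 0] by simp
  \<comment> \<open>The extension \<open>h\<close> may leave \<open>T\<close> away from
    \<open>A\<close>, so its domain is cut down to the preimage of \<open>T\<close>.\<close>
  then have op: "open (W \<inter> h -` T)"
    using h(1) assms(1) by (simp add: continuous_open_preimage Cinf_on_open)
  have "p \<in> W \<inter> h -` T" using h p assms(4) by auto
  moreover have "Ck_on k (W \<inter> h -` T) (\<lambda>x. \<phi> (h x))" for k
    by (rule Ck_on_compose_real[OF op assms(1) _ assms(2)])
      (auto intro: Ck_on_subset[OF Cinf_on_Ck[OF h(1)]])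
  then have "Cinf_on (W \<inter> h -` T) (\<lambda>x. \<phi> (h x))" by (intro Cinf_onI op)
  ultimately show "\<exists>W h. Cinf_on W h \<and> p \<in> W \<and> (\<forall>q\<in>W \<inter> A. h q = \<phi> (f q))"
    using h(3) by (intro exI[of _ "W \<inter> h -` T"] exI[of _ "\<lambda>x. \<phi> (h x)"]) auto
qed

lemma smooth_fun_inverse:
  fixes f :: "'a::euclidean_space \<Rightarrow> real"
  assumes "smooth_fun A f" "\<And>x. x \<in> A \<Longrightarrow> f x > 0"
  shows "smooth_fun A (\<lambda>x. inverse (f x))"
  using smooth_fun_compose_real[OF _ Ck_on_inverse[where n=0], of A f] assms by auto

lemma smooth_fun_bump: "smooth_fun A (\<lambda>x::'a::euclidean_space. flat 0 (r\<^sup>2 - (x - p) \<bullet> (x - p)))"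
  by (rule smooth_fun_compose_real[OF open_UNIV Ck_on_flat])
    (auto intro!: smooth_fun_diff smooth_fun_const smooth_fun_inner smooth_fun_ident)

lemma smooth_fun_continuous_on:
  assumes "smooth_fun A f" shows "continuous_on A f"
  unfolding continuous_on_eq_continuous_within
proof
  fix p assume p: "p \<in> A"
  obtain W h where h: "Cinf_on W h" "p \<in> W" "\<forall>q\<in>W \<inter> A. h q = f q"
    by (rule smooth_fun_extension[OF assms p])
  have "continuous (at p) h"
    using Cinf_on_open[OF h(1)] h(2) Cinf_on_Ck[OF h(1), of 0] by (simp add: continuous_on_eq_continuous_at)
  then have "continuous (at p within A) h" by (rule continuous_at_imp_continuous_at_within)
  moreover have "eventually (\<lambda>q. h q = f q) (at p within A)"
    using h Cinf_on_open[OF h(1)] unfolding eventually_at_topological by blast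
  moreover have "h p = f p" using h p by blast
  ultimately show "continuous (at p within A) f"
    unfolding continuous_within by (auto intro: Lim_transform_eventually)
qed

section \<open>Derivatives along the sphere and the Lie bracket\<close>

lemma has_real_derivative_along_line:
  fixes h :: "'a::euclidean_space \<Rightarrow> real"
  assumes "(h has_derivative h') (at (q + \<sigma> *\<^sub>R u))"
  shows "((\<lambda>t. h (q + t *\<^sub>R u)) has_real_derivative h' u) (at \<sigma>)"
proof -
  have "((\<lambda>t. q + t *\<^sub>R u) has_derivative (\<lambda>t. t *\<^sub>R u)) (at \<sigma>)"
    by (auto intro!: derivative_eq_intros)
  from has_derivative_compose[OF this assms]
  have "((\<lambda>t. h (q + t *\<^sub>R u)) has_derivative (\<lambda>t. h' (t *\<^sub>R u))) (at \<sigma>)" .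
  moreover have "h' (t *\<^sub>R u) = h' u * t" for t
    using linear_scale[OF has_derivative_linear[OF assms], of t u] by simp
  ultimately show ?thesis by (simp add: has_field_derivative_def)
qed

text \<open>The mean value theorem is applied in the direction \<open>u\<close> and then in the
  direction \<open>v\<close>. The second difference is symmetric in \<open>u\<close> and
  \<open>v\<close>, so reading it in both orders compares the two mixed second derivatives.\<close>

lemma second_difference_mean_value:
  fixes h :: "'a::euclidean_space \<Rightarrow> real"
  assumes h: "Ck_on 2 W h" and W: "cball p (s * (norm u + norm v)) \<subseteq> W" and s: "0 < s"
  shows "\<exists>y\<in>cball p (s * (norm u + norm v)).
    h (p + s *\<^sub>R u + s *\<^sub>R v) - h (p + s *\<^sub>R u) - h (p + s *\<^sub>R v) + h p
      = s * (s * frechet_derivative (\<lambda>x. frechet_derivative h (at x) u) (at y) v)"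
proof -
  define D where "D = (\<lambda>x. frechet_derivative h (at x) u)"
  have h2: "Ck_on (Suc (Suc 0)) W h" using h by (simp add: numeral_2_eq_2)
  then have D: "Ck_on (Suc 0) W D" unfolding D_def by simp
  have inW: "p + a *\<^sub>R u + b *\<^sub>R v \<in> cball p (s * (norm u + norm v))"
    if "0 \<le> a" "a \<le> s" "0 \<le> b" "b \<le> s" for a b
  proof -
    have "norm (a *\<^sub>R u + b *\<^sub>R v) \<le> s * norm u + s * norm v"
      using that by (intro norm_triangle_le add_mono) (auto simp: mult_right_mono)
    then show ?thesis by (simp add: dist_norm algebra_simps norm_minus_commute)
  qed
  have dh: "((\<lambda>t. h (p + b *\<^sub>R v + t *\<^sub>R u)) has_real_derivative D (p + a *\<^sub>R u + b *\<^sub>R v)) (at a)"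
    if "0 \<le> a" "a \<le> s" "0 \<le> b" "b \<le> s" for a b
  proof -
    have "p + b *\<^sub>R v + a *\<^sub>R u \<in> W" using inW[OF that] W by (auto simp: algebra_simps)
    from has_real_derivative_along_line[OF Ck_on_has_derivative[OF h2 this]]
    show ?thesis by (simp add: D_def algebra_simps)
  qed
  \<comment> \<open>Mean value theorem for the difference of \<open>h\<close> along the two parallel
    segments in direction \<open>u\<close> that start at \<open>p + s *\<^sub>R v\<close> and at
    \<open>p\<close>.\<close>
  have "\<exists>z. 0 < z \<and> z < s \<and>
    (h (p + s *\<^sub>R v + s *\<^sub>R u) - h (p + 0 *\<^sub>R v + s *\<^sub>R u)) - (h (p + s *\<^sub>R v + 0 *\<^sub>R u) - h (p + 0 *\<^sub>R v + 0 *\<^sub>R u))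
     = (s - 0) * (D (p + z *\<^sub>R u + s *\<^sub>R v) - D (p + z *\<^sub>R u + 0 *\<^sub>R v))"
    by (rule MVT2[OF s], rule DERIV_diff; rule dh) (use s in simp_all)
  then obtain z where z: "0 < z" "z < s"
    "h (p + s *\<^sub>R u + s *\<^sub>R v) - h (p + s *\<^sub>R u) - h (p + s *\<^sub>R v) + h p
     = s * (D (p + z *\<^sub>R u + s *\<^sub>R v) - D (p + z *\<^sub>R u + 0 *\<^sub>R v))"
    by (auto simp: algebra_simps)
  have "\<exists>w. 0 < w \<and> w < s \<and> D (p + z *\<^sub>R u + s *\<^sub>R v) - D (p + z *\<^sub>R u + 0 *\<^sub>R v)
     = (s - 0) * frechet_derivative D (at (p + z *\<^sub>R u + w *\<^sub>R v)) v"
  proof (rule MVT2[OF s])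
    fix w assume w: "0 \<le> w" "w \<le> s"
    then have "p + z *\<^sub>R u + w *\<^sub>R v \<in> W" using inW[of z w] z W by auto
    from has_real_derivative_along_line[OF Ck_on_has_derivative[OF D this]]
    show "((\<lambda>w. D (p + z *\<^sub>R u + w *\<^sub>R v)) has_real_derivative
      frechet_derivative D (at (p + z *\<^sub>R u + w *\<^sub>R v)) v) (at w)" .
  qed
  then obtain w where "0 < w" "w < s" "D (p + z *\<^sub>R u + s *\<^sub>R v) - D (p + z *\<^sub>R u + 0 *\<^sub>R v)
     = s * frechet_derivative D (at (p + z *\<^sub>R u + w *\<^sub>R v)) v"
    by auto
  with z inW[of z w] show ?thesis unfolding D_def by force
qed

lemma second_derivative_symmetric:
  fixes h :: "'a::euclidean_space \<Rightarrow> real"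
  assumes "open W" "p \<in> W" "Ck_on 2 W h"
  shows "frechet_derivative (\<lambda>x. frechet_derivative h (at x) u) (at p) v
    = frechet_derivative (\<lambda>x. frechet_derivative h (at x) v) (at p) u" (is "?F p = ?G p")
proof -
  define F where "F = (\<lambda>p. frechet_derivative (\<lambda>x. frechet_derivative h (at x) u) (at p) v)"
  define G where "G = (\<lambda>p. frechet_derivative (\<lambda>x. frechet_derivative h (at x) v) (at p) u)"
  obtain r where r: "r > 0" "cball p r \<subseteq> W" using assms open_contains_cball by blast
  \<comment> \<open>The summand 1 keeps \<open>m\<close> positive when \<open>u = v = 0\<close>. The
    step \<open>s n\<close> is then small enough for the parallelogram to lie in the ball of radius
    \<open>r / real (Suc n)\<close> about \<open>p\<close>.\<close>
  define m where "m = norm u + norm v + 1"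
  have m: "m > 0" by (simp add: m_def add_nonneg_pos)
  have cont: "continuous_on W F" "continuous_on W G"
    using assms(3) unfolding F_def G_def by (auto simp: numeral_2_eq_2)
  define s where "s = (\<lambda>n. r / (m * real (Suc n)))"
  have s: "s n > 0" "s n * (norm u + norm v) \<le> r / real (Suc n)" for n
  proof -
    show "s n > 0" using r m by (simp add: s_def)
    have "s n * (norm u + norm v) \<le> s n * m"
      using \<open>s n > 0\<close> by (intro mult_left_mono) (auto simp: m_def)
    also have "\<dots> = r / real (Suc n)" using m by (simp add: s_def)
    finally show "s n * (norm u + norm v) \<le> r / real (Suc n)" .
  qed
  have ball: "cball p (s n * (norm u + norm v)) \<subseteq> W" for n
  proof -
    have "r / real (Suc n) \<le> r" using r by (simp add: divide_le_eq)
    then show ?thesis using s(2)[of n] r(2) by (meson order_trans subset_cball)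
  qed
  have "\<exists>y y'. y \<in> cball p (r / real (Suc n)) \<and> y' \<in> cball p (r / real (Suc n)) \<and> F y = G y'" for n
  proof -
    obtain y where y: "y \<in> cball p (s n * (norm u + norm v))"
      "h (p + s n *\<^sub>R u + s n *\<^sub>R v) - h (p + s n *\<^sub>R u) - h (p + s n *\<^sub>R v) + h p = s n * (s n * F y)"
      using second_difference_mean_value[OF assms(3) ball s(1)] unfolding F_def by blast
    have "cball p (s n * (norm v + norm u)) \<subseteq> W" using ball[of n] by (simp add: add.commute)
    then obtain y' where y': "y' \<in> cball p (s n * (norm v + norm u))"
      "h (p + s n *\<^sub>R v + s n *\<^sub>R u) - h (p + s n *\<^sub>R v) - h (p + s n *\<^sub>R u) + h p = s n * (s n * G y')"
      using second_difference_mean_value[OF assms(3) _ s(1)] unfolding G_def by blast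
    have "s n * (s n * F y) = s n * (s n * G y')"
      unfolding y(2)[symmetric] y'(2)[symmetric] by (simp add: algebra_simps)
    then have "F y = G y'" using s(1)[of n] by simp
    then show ?thesis using y(1) y'(1) s(2)[of n] by (intro exI[of _ y] exI[of _ y']) (auto simp: add.commute)
  qed
  then obtain y y' where y: "\<And>n. y n \<in> cball p (r / real (Suc n))"
    "\<And>n. y' n \<in> cball p (r / real (Suc n))" "\<And>n. F (y n) = G (y' n)" by metis
  have lim0: "(\<lambda>n. r / real (Suc n)) \<longlonglongrightarrow> 0"
    using tendsto_mult_right_zero[OF LIMSEQ_inverse_real_of_nat, of r] by (simp add: divide_inverse)
  have yp: "y \<longlonglongrightarrow> p"
    by (rule metric_tendsto_imp_tendsto[OF lim0])
      (use y(1) r in \<open>auto simp: dist_commute intro!: always_eventually\<close>)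
  have y'p: "y' \<longlonglongrightarrow> p"
    by (rule metric_tendsto_imp_tendsto[OF lim0])
      (use y(2) r in \<open>auto simp: dist_commute intro!: always_eventually\<close>)
  have "isCont F p" "isCont G p"
    using cont assms(1,2) by (auto simp: continuous_on_eq_continuous_at)
  then have "(\<lambda>n. F (y n)) \<longlonglongrightarrow> F p" "(\<lambda>n. G (y' n)) \<longlonglongrightarrow> G p"
    using yp y'p isCont_tendsto_compose by blast+
  then have "F p = G p" using y(3) LIMSEQ_unique by auto
  then show ?thesis unfolding F_def G_def .
qed

section \<open>Tangent vectors, great circles and derivatives within the sphere\<close>

lemma tangentD: "x \<in> tangent p \<Longrightarrow> x \<bullet> p = 0" and tangentD': "x \<in> tangent p \<Longrightarrow> p \<bullet> x = 0"
  by (auto simp: tangent_def inner_commute)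

lemma tangent_simps [simp]:
  "0 \<in> tangent p" "x \<in> tangent p \<Longrightarrow> c *\<^sub>R x \<in> tangent p" "x \<in> tangent p \<Longrightarrow> - x \<in> tangent p"
  "x \<in> tangent p \<Longrightarrow> y \<in> tangent p \<Longrightarrow> x + y \<in> tangent p"
  "x \<in> tangent p \<Longrightarrow> y \<in> tangent p \<Longrightarrow> x - y \<in> tangent p"
  by (auto simp: tangent_def inner_simps)

lemma usphere_inner: "p \<in> usphere \<Longrightarrow> p \<bullet> p = 1"
  by (simp add: norm_eq_1)

definition great_circle :: "'a::euclidean_space \<Rightarrow> 'a \<Rightarrow> real \<Rightarrow> 'a"
  where "great_circle p x t = cos t *\<^sub>R p + sin t *\<^sub>R x"

lemma great_circle_usphere:
  "p \<in> usphere \<Longrightarrow> x \<in> usphere \<Longrightarrow> x \<in> tangent p \<Longrightarrow> great_circle p x t \<in> usphere"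
  using sin_cos_squared_add3[of t]
  by (simp add: norm_eq_1 great_circle_def inner_simps tangent_def inner_commute algebra_simps)

lemma great_circle_derivative:
  "(great_circle p x has_vector_derivative (cos t *\<^sub>R x - sin t *\<^sub>R p)) (at t)"
  unfolding great_circle_def by (auto intro!: derivative_eq_intros simp: has_vector_derivative_def algebra_simps)

lemma has_vector_derivative_along_curve:
  assumes f: "(f has_derivative D) (at (c t) within usphere)"
    and c: "(c has_vector_derivative c') (at t)" "\<And>s. c s \<in> usphere"
  shows "((\<lambda>s. f (c s)) has_vector_derivative D c') (at t)"
proof -
  have "(f has_derivative D) (at (c t) within c ` UNIV)"
    using f by (rule has_derivative_subset) (use c in auto)
  from has_derivative_in_compose[OF c(1)[unfolded has_vector_derivative_def] this]
  show ?thesis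
    unfolding has_vector_derivative_def using linear_scale[OF has_derivative_linear[OF f]] by simp
qed

text \<open>Two derivatives within the sphere may differ on normal vectors, but along the great
  circle with initial velocity \<open>x /\<^sub>R norm x\<close> both compute the derivative of the
  same function of one real variable; linearity takes care of the length.\<close>

lemma sderiv_eqI:
  assumes f: "(f has_derivative D) (at p within usphere)" and p: "p \<in> usphere" and x: "x \<in> tangent p"
  shows "sderiv f p x = D x"
proof (cases "x = 0")
  have f': "(f has_derivative sderiv f p) (at p within usphere)"
    using f unfolding sderiv_def[abs_def] by (metis differentiable_def frechet_derivative_works)
  note lin = has_derivative_linear[OF f'] has_derivative_linear[OF f]
  {
    case True
    then show ?thesis using lin by (simp add: linear_0)
  next
    case False
    define u where "u = x /\<^sub>R norm x"
    have u: "u \<in> usphere" "u \<in> tangent p" using False x by (auto simp: u_def)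
    have 0: "great_circle p u 0 = p" by (simp add: great_circle_def)
    have "(great_circle p u has_vector_derivative u) (at 0)"
      using great_circle_derivative[of p u 0] by simp
    from has_vector_derivative_along_curve[OF _ this great_circle_usphere[OF p u]]
    have "((\<lambda>s. f (great_circle p u s)) has_vector_derivative sderiv f p u) (at 0)"
      "((\<lambda>s. f (great_circle p u s)) has_vector_derivative D u) (at 0)"
      using f f' 0 by auto
    then have "sderiv f p u = D u" by (rule vector_derivative_unique_at)
    moreover have "x = norm x *\<^sub>R u" using False by (simp add: u_def)
    ultimately show ?thesis using lin by (metis linear_scale)
  }
qed

lemma sderiv_cong:
  assumes "p \<in> usphere" "\<And>q. q \<in> usphere \<Longrightarrow> f q = g q"
  shows "sderiv f p = sderiv g p"
proof -
  have "(f has_derivative D) (at p within usphere) = (g has_derivative D) (at p within usphere)" for D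
    using has_derivative_transform[OF assms(1), of g f D] has_derivative_transform[OF assms(1), of f g D] assms(2)
    by fastforce
  then show ?thesis unfolding sderiv_def[abs_def] frechet_derivative_def by simp
qed

lemma has_derivative_extension:
  assumes "Cinf_on W h" "p \<in> W" "p \<in> A" "\<forall>q\<in>W \<inter> A. h q = f q"
  shows "(f has_derivative frechet_derivative h (at p)) (at p within A)"
proof -
  obtain d where d: "d > 0" "ball p d \<subseteq> W"
    using assms(1,2) Cinf_on_open open_contains_ball by blast
  have "(h has_derivative frechet_derivative h (at p)) (at p within A)"
    using Ck_on_has_derivative[OF Cinf_on_Ck[OF assms(1)] assms(2)] by (rule has_derivative_at_withinI)
  then show ?thesis
    by (rule has_derivative_transform_within[OF _ d(1) assms(3)])
      (use assms(4) d(2) in \<open>auto simp: dist_commute subset_iff\<close>)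
qed

lemma sderiv_extension:
  assumes "Cinf_on W h" "p \<in> W" "p \<in> usphere" "\<forall>q\<in>W \<inter> usphere. h q = f q" "x \<in> tangent p"
  shows "sderiv f p x = frechet_derivative h (at p) x"
  using sderiv_eqI[OF has_derivative_extension[OF assms(1-4)] assms(3,5)] .

lemma has_sderiv:
  assumes "smooth_fun usphere f" "p \<in> usphere"
  shows "(f has_derivative sderiv f p) (at p within usphere)"
proof -
  obtain W h where "Cinf_on W h" "p \<in> W" "\<forall>q\<in>W \<inter> usphere. h q = f q"
    by (rule smooth_fun_extension[OF assms])
  from has_derivative_extension[OF this(1,2) assms(2) this(3)] show ?thesis
    unfolding sderiv_def[abs_def] by (metis differentiable_def frechet_derivative_works)
qed

lemma linear_sderiv: "smooth_fun usphere f \<Longrightarrow> p \<in> usphere \<Longrightarrow> linear (sderiv f p)"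
  by (rule has_derivative_linear[OF has_sderiv])

lemma sderiv_along_curve:
  fixes f :: "'a::euclidean_space \<Rightarrow> real"
  assumes "smooth_fun usphere f" "(c has_vector_derivative c') (at t)" "\<And>s. c s \<in> usphere"
  shows "((\<lambda>s. f (c s)) has_real_derivative sderiv f (c t) c') (at t)"
  using has_vector_derivative_along_curve[OF has_sderiv[OF assms(1)] assms(2)] assms(3)
  by (simp add: has_real_derivative_iff_has_vector_derivative)

context
  fixes p x :: "'a::euclidean_space"
  assumes p: "p \<in> usphere" and x: "x \<in> tangent p"
begin

lemma sderiv_const: "sderiv (\<lambda>q. c) p x = 0"
  by (rule sderiv_eqI[OF has_derivative_const p x])

lemma sderiv_ident: "sderiv (\<lambda>q. q) p x = x"
  by (rule sderiv_eqI[OF has_derivative_ident p x])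

lemma sderiv_inner: "sderiv (\<lambda>q. a \<bullet> q) p x = a \<bullet> x"
  by (rule sderiv_eqI[OF _ p x]) (auto intro!: derivative_eq_intros)

lemma sderiv_add:
  "smooth_fun usphere f \<Longrightarrow> smooth_fun usphere g \<Longrightarrow> sderiv (\<lambda>q. f q + g q) p x = sderiv f p x + sderiv g p x"
  by (rule sderiv_eqI[OF has_derivative_add[OF has_sderiv has_sderiv] p x]) (use p in auto)

lemma sderiv_diff:
  "smooth_fun usphere f \<Longrightarrow> smooth_fun usphere g \<Longrightarrow> sderiv (\<lambda>q. f q - g q) p x = sderiv f p x - sderiv g p x"
  by (rule sderiv_eqI[OF has_derivative_diff[OF has_sderiv has_sderiv] p x]) (use p in auto)

lemma sderiv_bilinear:
  "bounded_bilinear pr \<Longrightarrow> smooth_fun usphere f \<Longrightarrow> smooth_fun usphere g \<Longrightarrow>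
    sderiv (\<lambda>q. pr (f q) (g q)) p x = pr (f p) (sderiv g p x) + pr (sderiv f p x) (g p)"
  by (rule sderiv_eqI[OF bounded_bilinear.FDERIV[OF _ has_sderiv has_sderiv] p x]) (use p in auto)

lemma sderiv_linear:
  "bounded_linear L \<Longrightarrow> smooth_fun usphere f \<Longrightarrow> sderiv (\<lambda>q. L (f q)) p x = L (sderiv f p x)"
  by (rule sderiv_eqI[OF bounded_linear.has_derivative[OF _ has_sderiv] p x]) (use p in auto)

end

lemmas sderiv_mult = sderiv_bilinear[OF _ _ bounded_bilinear_mult]
  and sderiv_scaleR = sderiv_bilinear[OF _ _ bounded_bilinear_scaleR]
  and sderiv_inner2 = sderiv_bilinear[OF _ _ bounded_bilinear_inner]

lemma vfieldI: "(\<And>p. p \<in> usphere \<Longrightarrow> X p \<in> tangent p) \<Longrightarrow> smooth_fun usphere X \<Longrightarrow> vfield X"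
  and vfield_tangent: "vfield X \<Longrightarrow> p \<in> usphere \<Longrightarrow> X p \<in> tangent p"
  and vfield_smooth: "vfield X \<Longrightarrow> smooth_fun usphere X"
  by (auto simp: vfield_def)

lemma Cinf_on_frechet: "Cinf_on W h \<Longrightarrow> Cinf_on W (\<lambda>x. frechet_derivative h (at x) v)"
  using Ck_on.simps(2)[of _ W h] unfolding Cinf_on_def by blast

lemma linear_frechet_extension:
  assumes "Cinf_on W h" "q \<in> W" shows "linear (frechet_derivative h (at q))"
  using Ck_on_has_derivative[OF Cinf_on_Ck[OF assms(1)] assms(2)] by (rule has_derivative_linear)

lemma linear_Basis_sum:
  fixes L :: "'a::euclidean_space \<Rightarrow> 'b::real_vector"
  assumes "linear L" shows "(\<Sum>i\<in>Basis. (x \<bullet> i) *\<^sub>R L i) = L x"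
  by (subst (2) euclidean_representation[of x, symmetric]) (simp add: linear_sum[OF assms] linear_scale[OF assms])

lemma smooth_fun_sderiv:
  assumes f: "smooth_fun usphere f" and X: "vfield X"
  shows "smooth_fun usphere (\<lambda>q. sderiv f q (X q))"
proof (rule smooth_fun_local)
  fix p :: 'a assume p: "p \<in> usphere"
  obtain W h where h: "Cinf_on W h" "p \<in> W" "\<forall>q\<in>W \<inter> usphere. h q = f q"
    by (rule smooth_fun_extension[OF f p])
  \<comment> \<open>The derivative of the extension is linear in the direction, so expanding
    \<open>X q\<close> in the ambient basis gives a smooth expression: the components of
    \<open>X\<close> times the partial derivatives of \<open>h\<close>.\<close>
  let ?f = "\<lambda>q. \<Sum>i\<in>Basis. (X q \<bullet> i) *\<^sub>R frechet_derivative h (at q) i"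
  have "smooth_fun (W \<inter> usphere) ?f"
    using smooth_fun_subset[OF vfield_smooth[OF X], of "W \<inter> usphere"]
    by (intro smooth_fun_sum smooth_fun_scaleR smooth_fun_inner smooth_fun_const
        smooth_funI[OF Cinf_on_frechet[OF h(1)]]) auto
  moreover have "?f q = sderiv f q (X q)" if "q \<in> W \<inter> usphere" for q
    using linear_Basis_sum[OF linear_frechet_extension[OF h(1), of q]]
      sderiv_extension[OF h(1) _ _ h(3), of q "X q"] vfield_tangent[OF X] that by auto
  ultimately show "\<exists>W f'. open W \<and> p \<in> W \<and> smooth_fun (W \<inter> usphere) f' \<and>
      (\<forall>q\<in>W \<inter> usphere. f' q = sderiv f q (X q))"
    using h(2) Cinf_on_open[OF h(1)] by blast
qed

text \<open>Differentiating \<open>Y q \<bullet> q = 0\<close> shows that the normal part of the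
  ambient derivative is \<open>- (X p \<bullet> Y p) *\<^sub>R p\<close>. The second summand removes
  it, so this is the tangential projection of the ambient derivative.\<close>

definition sconn :: "('a::euclidean_space \<Rightarrow> 'a) \<Rightarrow> ('a \<Rightarrow> 'a) \<Rightarrow> 'a \<Rightarrow> 'a"
  where "sconn X Y p = sderiv Y p (X p) + (X p \<bullet> Y p) *\<^sub>R p"

text \<open>The normal corrections cancel, so this is the ambient commutator
  \<open>sderiv Y p (X p) - sderiv X p (Y p)\<close>. It is the computable substitute for
  \<open>lie_bracket\<close>, which is a definite description.\<close>

definition sbracket :: "('a::euclidean_space \<Rightarrow> 'a) \<Rightarrow> ('a \<Rightarrow> 'a) \<Rightarrow> 'a \<Rightarrow> 'a"
  where "sbracket X Y p = sconn X Y p - sconn Y X p"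

lemma vfield_sconn:
  assumes X: "vfield X" and Y: "vfield Y" shows "vfield (sconn X Y)"
proof (rule vfieldI)
  show "smooth_fun usphere (sconn X Y)"
    unfolding sconn_def[abs_def]
    by (intro smooth_fun_add smooth_fun_sderiv smooth_fun_scaleR smooth_fun_inner smooth_fun_ident
        vfield_smooth X Y)
  fix p :: 'a assume p: "p \<in> usphere"
  have "sderiv (\<lambda>q. Y q \<bullet> q) p (X p) = sderiv (\<lambda>q. 0::real) p (X p)"
    by (intro fun_cong[OF sderiv_cong[OF p]] tangentD vfield_tangent Y)
  then have "Y p \<bullet> X p + sderiv Y p (X p) \<bullet> p = 0"
    using p X Y by (simp add: sderiv_inner2 vfield_tangent vfield_smooth smooth_fun_ident sderiv_ident sderiv_const)
  then show "sconn X Y p \<in> tangent p"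
    using usphere_inner[OF p] by (simp add: sconn_def tangent_def inner_simps inner_commute)
qed

lemma vfield_add: "vfield X \<Longrightarrow> vfield Y \<Longrightarrow> vfield (\<lambda>q. X q + Y q)"
  and vfield_diff: "vfield X \<Longrightarrow> vfield Y \<Longrightarrow> vfield (\<lambda>q. X q - Y q)"
  and vfield_scale: "smooth_fun usphere f \<Longrightarrow> vfield X \<Longrightarrow> vfield (\<lambda>q. f q *\<^sub>R X q)"
  and vfield_zero: "vfield (\<lambda>q. 0)"
  by (auto simp: vfield_def smooth_fun_add smooth_fun_diff smooth_fun_scaleR smooth_fun_const)

lemma vfield_sbracket: "vfield X \<Longrightarrow> vfield Y \<Longrightarrow> vfield (sbracket X Y)"
  unfolding sbracket_def[abs_def] by (intro vfield_diff vfield_sconn)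

text \<open>In the second summand \<open>Y p\<close> is frozen, so it is the Hessian of the local
  extension on \<open>X p\<close> and \<open>Y p\<close>; by symmetry it drops out of commutators,
  and only the first order summand survives.\<close>

lemma sderiv_sderiv:
  fixes f :: "'a::euclidean_space \<Rightarrow> real"
  assumes f: "Cinf_on W h" "p \<in> W" "\<forall>q\<in>W \<inter> usphere. h q = f q"
    and X: "vfield X" and Y: "vfield Y" and p: "p \<in> usphere"
  shows "sderiv (\<lambda>q. sderiv f q (Y q)) p (X p) = frechet_derivative h (at p) (sderiv Y p (X p))
    + frechet_derivative (\<lambda>q. frechet_derivative h (at q) (Y p)) (at p) (X p)"
proof -
  define D where "D = (\<lambda>i q. frechet_derivative h (at q) i)"
  have D: "(D i has_derivative frechet_derivative (D i) (at p)) (at p)" for i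
    unfolding D_def by (rule Ck_on_has_derivative[OF Cinf_on_Ck[OF Cinf_on_frechet[OF f(1)]] f(2)])
  obtain d where d: "d > 0" "ball p d \<subseteq> W"
    using f(1,2) Cinf_on_open open_contains_ball by blast
  have sum: "(\<Sum>i\<in>Basis. (v \<bullet> i) *\<^sub>R D i q) = D v q" if "q \<in> W" for v q
    unfolding D_def by (rule linear_Basis_sum[OF linear_frechet_extension[OF f(1) that]])
  have "((\<lambda>q. \<Sum>i\<in>Basis. (Y q \<bullet> i) *\<^sub>R D i q) has_derivative
     (\<lambda>x. \<Sum>i\<in>Basis. (Y p \<bullet> i) *\<^sub>R frechet_derivative (D i) (at p) x + (sderiv Y p x \<bullet> i) *\<^sub>R D i p))
     (at p within usphere)"
    by (intro has_derivative_sum has_derivative_scaleR has_derivative_inner_left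
        has_sderiv vfield_smooth Y p has_derivative_at_withinI[OF D])
  then have "((\<lambda>q. sderiv f q (Y q)) has_derivative
     (\<lambda>x. \<Sum>i\<in>Basis. (Y p \<bullet> i) *\<^sub>R frechet_derivative (D i) (at p) x + (sderiv Y p x \<bullet> i) *\<^sub>R D i p))
     (at p within usphere)"
  proof (rule has_derivative_transform_within[OF _ d(1) p])
    fix q :: 'a assume "q \<in> usphere" "dist q p < d"
    moreover from this have "q \<in> W" using d(2) by (auto simp: dist_commute)
    ultimately show "(\<Sum>i\<in>Basis. (Y q \<bullet> i) *\<^sub>R D i q) = sderiv f q (Y q)"
      using sum[of q "Y q"] sderiv_extension[OF f(1) _ _ f(3), of q "Y q"] vfield_tangent[OF Y]
      by (simp add: D_def)
  qed
  from sderiv_eqI[OF this p vfield_tangent[OF X p]]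
  have 1: "sderiv (\<lambda>q. sderiv f q (Y q)) p (X p) =
     (\<Sum>i\<in>Basis. (Y p \<bullet> i) *\<^sub>R frechet_derivative (D i) (at p) (X p)) + D (sderiv Y p (X p)) p"
    using sum[OF f(2)] by (simp add: sum.distrib)
  have "((\<lambda>q. \<Sum>i\<in>Basis. (Y p \<bullet> i) *\<^sub>R D i q) has_derivative
     (\<lambda>x. \<Sum>i\<in>Basis. (Y p \<bullet> i) *\<^sub>R frechet_derivative (D i) (at p) x)) (at p)"
    by (intro has_derivative_sum has_derivative_scaleR_right D)
  then have "(D (Y p) has_derivative
     (\<lambda>x. \<Sum>i\<in>Basis. (Y p \<bullet> i) *\<^sub>R frechet_derivative (D i) (at p) x)) (at p)"
    by (rule has_derivative_transform_within_open[OF _ Cinf_on_open[OF f(1)] f(2)]) (rule sum)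
  from fun_cong[OF frechet_derivative_at[OF this], of "X p"] 1
  show ?thesis by (simp add: D_def)
qed

lemma sderiv_sbracket:
  fixes f :: "'a::euclidean_space \<Rightarrow> real"
  assumes X: "vfield X" and Y: "vfield Y" and p: "p \<in> usphere" and f: "smooth_fun usphere f"
  shows "sderiv f p (sbracket X Y p) =
      sderiv (\<lambda>q. sderiv f q (Y q)) p (X p) - sderiv (\<lambda>q. sderiv f q (X q)) p (Y p)"
proof -
  have t: "sbracket X Y p \<in> tangent p"
    by (intro vfield_tangent vfield_sbracket X Y p)
  have eq: "sbracket X Y p = sderiv Y p (X p) - sderiv X p (Y p)"
    by (simp add: sbracket_def sconn_def inner_commute)
  obtain W h where h: "Cinf_on W h" "p \<in> W" "\<forall>q\<in>W \<inter> usphere. h q = f q"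
    by (rule smooth_fun_extension[OF f p])
  have "sderiv f p (sbracket X Y p) = frechet_derivative h (at p) (sderiv Y p (X p))
      - frechet_derivative h (at p) (sderiv X p (Y p))"
    using sderiv_extension[OF h(1,2) p h(3) t] linear_diff[OF linear_frechet_extension[OF h(1,2)]]
    by (simp add: eq)
  then show ?thesis
    using sderiv_sderiv[OF h X Y p] sderiv_sderiv[OF h Y X p]
      second_derivative_symmetric[OF Cinf_on_open[OF h(1)] h(2) Cinf_on_Ck[OF h(1)], of "X p" "Y p"]
    by simp
qed

lemma smooth_fun_inner_const: "smooth_fun A (\<lambda>q. a \<bullet> q)"
  by (intro smooth_fun_inner smooth_fun_const smooth_fun_ident)

text \<open>Existence is \<open>sderiv_sbracket\<close>. For uniqueness, the linear functions
  \<open>\<lambda>q. a \<bullet> q\<close> already separate tangent vectors.\<close>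

lemma lie_bracket_eq:
  fixes X Y :: "'a::euclidean_space \<Rightarrow> 'a"
  assumes X: "vfield X" and Y: "vfield Y" and p: "p \<in> usphere"
  shows "lie_bracket X Y p = sbracket X Y p"
  unfolding lie_bracket_def
proof (rule the_equality)
  have t: "sbracket X Y p \<in> tangent p"
    by (intro vfield_tangent vfield_sbracket X Y p)
  show *: "sbracket X Y p \<in> tangent p \<and> (\<forall>f::'a \<Rightarrow> real. smooth_fun usphere f \<longrightarrow>
      sderiv f p (sbracket X Y p) =
      sderiv (\<lambda>q. sderiv f q (Y q)) p (X p) - sderiv (\<lambda>q. sderiv f q (X q)) p (Y p))"
    by (intro conjI t allI impI sderiv_sbracket X Y p)
  fix w assume w: "w \<in> tangent p \<and> (\<forall>f::'a \<Rightarrow> real. smooth_fun usphere f \<longrightarrow>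
      sderiv f p w = sderiv (\<lambda>q. sderiv f q (Y q)) p (X p) - sderiv (\<lambda>q. sderiv f q (X q)) p (Y p))"
  have "a \<bullet> w = a \<bullet> sbracket X Y p" for a
  proof -
    have "a \<bullet> w = sderiv (\<lambda>q. a \<bullet> q) p w"
      by (rule sderiv_inner[OF p conjunct1[OF w], symmetric])
    also have "\<dots> = sderiv (\<lambda>q. a \<bullet> q) p (sbracket X Y p)"
      using w[THEN conjunct2, rule_format, OF smooth_fun_inner_const[of usphere a]]
        *[THEN conjunct2, rule_format, OF smooth_fun_inner_const[of usphere a]]
      by (rule trans[OF _ sym])
    also have "\<dots> = a \<bullet> sbracket X Y p" by (rule sderiv_inner[OF p t])
    finally show ?thesis .
  qed
  then show "w = sbracket X Y p" by (rule iffD1[OF vector_eq_ldot, OF allI])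
qed

section \<open>The Levi-Civita connection of the sphere\<close>

lemma sconn_cong:
  assumes "p \<in> usphere" "X p = X' p" "\<And>q. q \<in> usphere \<Longrightarrow> Y q = Y' q"
  shows "sconn X Y p = sconn X' Y' p"
  using assms sderiv_cong[of p Y Y'] by (simp add: sconn_def)

lemma sconn_add_right:
  "p \<in> usphere \<Longrightarrow> vfield X \<Longrightarrow> vfield Y \<Longrightarrow> vfield Z \<Longrightarrow>
    sconn X (\<lambda>q. Y q + Z q) p = sconn X Y p + sconn X Z p"
  by (simp add: sconn_def sderiv_add vfield_tangent vfield_smooth algebra_simps inner_simps)

lemma sconn_scale_right:
  "p \<in> usphere \<Longrightarrow> smooth_fun usphere f \<Longrightarrow> vfield X \<Longrightarrow> vfield Y \<Longrightarrow>
    sconn X (\<lambda>q. f q *\<^sub>R Y q) p = sderiv f p (X p) *\<^sub>R Y p + f p *\<^sub>R sconn X Y p"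
  by (simp add: sconn_def sderiv_scaleR vfield_tangent vfield_smooth algebra_simps)

lemma sconn_lincomb_left:
  assumes p: "p \<in> usphere" and Y: "vfield Y" and eq: "X p = a *\<^sub>R X1 p + b *\<^sub>R X2 p"
  shows "sconn X Y p = a *\<^sub>R sconn X1 Y p + b *\<^sub>R sconn X2 Y p"
  using linear_sderiv[OF vfield_smooth[OF Y] p]
  by (simp add: sconn_def eq linear_add linear_scale inner_simps algebra_simps)

lemma sconn_scale_left:
  assumes p: "p \<in> usphere" and Y: "vfield Y" and eq: "X p = a *\<^sub>R X1 p"
  shows "sconn X Y p = a *\<^sub>R sconn X1 Y p"
  using sconn_lincomb_left[OF p Y, of X a X1 0 X1] eq by simp

lemma sconn_metric:
  assumes "p \<in> usphere" "vfield X" "vfield Y" "vfield Z"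
  shows "sderiv (\<lambda>q. Y q \<bullet> Z q) p (X p) = sconn X Y p \<bullet> Z p + Y p \<bullet> sconn X Z p"
  using assms tangentD[OF vfield_tangent, of Z p] tangentD[OF vfield_tangent, of Y p]
  by (simp add: sconn_def sderiv_inner2 vfield_tangent vfield_smooth inner_simps inner_commute)

text \<open>The difference of the two connections, paired with a third field, is symmetric in the
  first two arguments because both have the same torsion, and skew in the last two because both are
  metric. Six alternating exchanges turn it into its own negative.\<close>

lemma levi_civita_eq_sconn:
  fixes nb :: "('a::euclidean_space \<Rightarrow> 'a) \<Rightarrow> ('a \<Rightarrow> 'a) \<Rightarrow> 'a \<Rightarrow> 'a"
  assumes nb: "levi_civita nb" and X: "vfield X" and Y: "vfield Y" and p: "p \<in> usphere"
  shows "nb X Y p = sconn X Y p"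
proof -
  define T where "T = (\<lambda>X Y Z. (nb X Y p - sconn X Y p) \<bullet> Z p)"
  note d = nb[unfolded levi_civita_def, THEN conjunct1]
    nb[unfolded levi_civita_def, THEN conjunct2, THEN conjunct1]
    nb[unfolded levi_civita_def, THEN conjunct2, THEN conjunct2, THEN conjunct1]
    nb[unfolded levi_civita_def, THEN conjunct2, THEN conjunct2, THEN conjunct2, THEN conjunct1]
    nb[unfolded levi_civita_def, THEN conjunct2, THEN conjunct2, THEN conjunct2, THEN conjunct2, THEN conjunct1]
    nb[unfolded levi_civita_def, THEN conjunct2, THEN conjunct2, THEN conjunct2, THEN conjunct2, THEN conjunct2, THEN conjunct1]
    nb[unfolded levi_civita_def, THEN conjunct2, THEN conjunct2, THEN conjunct2, THEN conjunct2, THEN conjunct2, THEN conjunct2]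
  have nb_field: "vfield (nb X Y)" if "vfield X" "vfield Y" for X Y
    using d(1) that by simp
  have nb_metric: "sderiv (\<lambda>q. Y q \<bullet> Z q) p (X p) = nb X Y p \<bullet> Z p + Y p \<bullet> nb X Z p"
    if "vfield X" "vfield Y" "vfield Z" for X Y Z
    using d(6) that p by simp
  have nb_torsion: "nb X Y p - nb Y X p = lie_bracket X Y p" if "vfield X" "vfield Y" for X Y
    using d(7) that p by simp
  have sym: "T X Y Z = T Y X Z" if "vfield X" "vfield Y" for X Y Z
  proof -
    have "nb X Y p - sconn X Y p = nb Y X p - sconn Y X p"
      using nb_torsion[OF that] lie_bracket_eq[OF that p] by (simp add: sbracket_def algebra_simps)
    then show ?thesis by (simp add: T_def)
  qed
  have skew: "T X Y Z = - T X Z Y" if "vfield X" "vfield Y" "vfield Z" for X Y Z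
    using nb_metric[OF that] sconn_metric[OF p that] by (simp add: T_def inner_simps inner_commute)
  have zero: "T X Y Z = 0" if "vfield X" "vfield Y" "vfield Z" for X Y Z
  proof -
    have "T X Y Z = - T X Z Y" using that by (rule skew)
    also have "\<dots> = - T Z X Y" using sym[of X Z] that by simp
    also have "\<dots> = T Z Y X" using skew[of Z X Y] that by simp
    also have "\<dots> = T Y Z X" using sym[of Z Y] that by simp
    also have "\<dots> = - T Y X Z" using skew[of Y Z X] that by simp
    also have "\<dots> = - T X Y Z" using sym[of X Y] that by simp
    finally show ?thesis by simp
  qed
  \<comment> \<open>Tested against the difference field itself, the vanishing pairing is a squared
    length.\<close>
  have "T X Y (\<lambda>q. nb X Y q - sconn X Y q) = 0"
    by (intro zero vfield_diff nb_field vfield_sconn X Y)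
  then show ?thesis by (simp add: T_def)
qed

text \<open>The tangential part of a constant field. It extends any tangent vector \<open>a\<close>
  at a point to a global field, and the fields with \<open>a\<close> in \<open>Basis\<close>
  generate all vector fields.\<close>

definition tfield :: "'a::euclidean_space \<Rightarrow> 'a \<Rightarrow> 'a"
  where "tfield a q = a - (a \<bullet> q) *\<^sub>R q"

text \<open>The Killing field of a rotation in the plane of \<open>a\<close> and \<open>b\<close>;
  for orthonormal \<open>a\<close>, \<open>b\<close> it turns \<open>a\<close> towards
  \<open>b\<close>.\<close>

definition kfield :: "'a::euclidean_space \<Rightarrow> 'a \<Rightarrow> 'a \<Rightarrow> 'a"
  where "kfield a b q = (a \<bullet> q) *\<^sub>R b - (b \<bullet> q) *\<^sub>R a"

text \<open>The gradient of \<open>- (a \<bullet> q)\<close>. For a unit vector \<open>a\<close> it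
  is the gradient of the distance to \<open>a\<close> times the sine of the distance, hence smooth
  at both poles. Its covariant derivative is a multiple of the identity.\<close>

definition radial :: "'a::euclidean_space \<Rightarrow> 'a \<Rightarrow> 'a"
  where "radial a q = (a \<bullet> q) *\<^sub>R q - a"

lemma vfield_tfield: "vfield (tfield a)"
  unfolding tfield_def[abs_def]
  by (intro vfieldI smooth_fun_diff smooth_fun_const smooth_fun_scaleR smooth_fun_inner_const smooth_fun_ident)
    (simp add: tangent_def inner_simps usphere_inner)

lemma vfield_kfield: "vfield (kfield a b)"
  unfolding kfield_def[abs_def]
  by (intro vfieldI smooth_fun_diff smooth_fun_const smooth_fun_scaleR smooth_fun_inner_const smooth_fun_ident)
    (simp add: tangent_def inner_simps)

lemma vfield_radial: "vfield (radial a)"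
  unfolding radial_def[abs_def]
  by (intro vfieldI smooth_fun_diff smooth_fun_const smooth_fun_scaleR smooth_fun_inner_const smooth_fun_ident)
    (simp add: tangent_def inner_simps usphere_inner)

lemma sderiv_tfield: "p \<in> usphere \<Longrightarrow> x \<in> tangent p \<Longrightarrow> sderiv (tfield a) p x = - ((a \<bullet> p) *\<^sub>R x + (a \<bullet> x) *\<^sub>R p)"
  by (simp add: tfield_def[abs_def] sderiv_diff sderiv_scaleR sderiv_const sderiv_ident sderiv_inner
      smooth_fun_const smooth_fun_scaleR smooth_fun_inner_const smooth_fun_ident)

lemma sconn_tfield:
  assumes p: "p \<in> usphere" and X: "vfield X"
  shows "sconn X (tfield a) p = - (a \<bullet> p) *\<^sub>R X p"
  using tangentD[OF vfield_tangent[OF X p]]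
  by (simp add: sconn_def sderiv_tfield[OF p vfield_tangent[OF X p]] tfield_def  inner_simps inner_commute algebra_simps)

lemma sderiv_radial: "p \<in> usphere \<Longrightarrow> x \<in> tangent p \<Longrightarrow> sderiv (radial a) p x = (a \<bullet> p) *\<^sub>R x + (a \<bullet> x) *\<^sub>R p"
  by (simp add: radial_def[abs_def] sderiv_diff sderiv_scaleR sderiv_const sderiv_ident sderiv_inner
      smooth_fun_const smooth_fun_scaleR smooth_fun_inner_const smooth_fun_ident)

lemma sconn_radial:
  assumes p: "p \<in> usphere" and X: "vfield X"
  shows "sconn X (radial a) p = (a \<bullet> p) *\<^sub>R X p"
  using tangentD[OF vfield_tangent[OF X p]]
  by (simp add: sconn_def sderiv_radial[OF p vfield_tangent[OF X p]] radial_def  inner_simps inner_commute algebra_simps)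

lemma sderiv_kfield: "p \<in> usphere \<Longrightarrow> x \<in> tangent p \<Longrightarrow> sderiv (kfield a b) p x = (a \<bullet> x) *\<^sub>R b - (b \<bullet> x) *\<^sub>R a"
  by (simp add: kfield_def[abs_def] sderiv_diff sderiv_scaleR sderiv_const sderiv_ident sderiv_inner
      smooth_fun_const smooth_fun_scaleR smooth_fun_inner_const smooth_fun_ident)

lemma sconn_kfield:
  assumes p: "p \<in> usphere" and X: "vfield X"
  shows "sconn X (kfield a b) p = (a \<bullet> X p) *\<^sub>R tfield b p - (b \<bullet> X p) *\<^sub>R tfield a p"
  using tangentD[OF vfield_tangent[OF X p]]
  by (simp add: sconn_def sderiv_kfield[OF p vfield_tangent[OF X p]] kfield_def tfield_def inner_simps inner_commute algebra_simps)

text \<open>A redundant frame that is global although the sphere need not be parallelizable. It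
  turns linearity over functions into dependence on the value at a point.\<close>

lemma vfield_eq_sum_tfield:
  assumes "p \<in> usphere" "vfield X"
  shows "X p = (\<Sum>i\<in>Basis. (X p \<bullet> i) *\<^sub>R tfield i p)"
proof -
  have "(\<Sum>i\<in>Basis. (X p \<bullet> i) *\<^sub>R tfield i p) = (\<Sum>i\<in>Basis. (X p \<bullet> i) *\<^sub>R i) - (\<Sum>i\<in>Basis. (X p \<bullet> i) * (p \<bullet> i)) *\<^sub>R p"
    by (simp add: tfield_def scaleR_sum_left sum_subtractf algebra_simps inner_commute)
  also have "\<dots> = X p - (X p \<bullet> p) *\<^sub>R p"
    unfolding euclidean_representation euclidean_inner[of "X p" p] ..
  finally show ?thesis using tangentD[OF vfield_tangent[OF assms(2,1)]] by simp
qed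

lemma sconn_inner_const:
  assumes p: "p \<in> usphere" and X: "vfield X" and Y: "vfield Y"
  shows "sconn X Y p \<bullet> a = sderiv (\<lambda>q. Y q \<bullet> a) p (X p) + (X p \<bullet> Y p) * (a \<bullet> p)"
  using sderiv_linear[OF p vfield_tangent[OF X p] bounded_linear_inner_left vfield_smooth[OF Y], of a]
  by (simp add: sconn_def inner_simps inner_commute)

text \<open>Pairing with a constant vector \<open>a\<close> reduces the claim to second derivatives
  of \<open>\<lambda>q. Y q \<bullet> a\<close>, whose commutator is the derivative along
  \<open>sbracket Z W\<close>. After the bracket term is subtracted, only the corrections containing
  \<open>a \<bullet> Z p\<close> and \<open>a \<bullet> W p\<close> survive.\<close>

lemma sphere_curvature:
  assumes p: "p \<in> usphere" and Z: "vfield Z" and W: "vfield W" and Y: "vfield Y"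
  shows "sconn Z (sconn W Y) p - sconn W (sconn Z Y) p - sconn (sbracket Z W) Y p
    = (W p \<bullet> Y p) *\<^sub>R Z p - (Z p \<bullet> Y p) *\<^sub>R W p"
proof -
  have sm: "smooth_fun usphere (\<lambda>q. Y q \<bullet> a)" for a
    by (intro smooth_fun_inner smooth_fun_const vfield_smooth Y)
  have two: "sconn Z (sconn W Y) p \<bullet> a = sderiv (\<lambda>q. sderiv (\<lambda>q. Y q \<bullet> a) q (W q)) p (Z p)
      + (sconn Z W p \<bullet> Y p + W p \<bullet> sconn Z Y p) * (a \<bullet> p) + (W p \<bullet> Y p) * (a \<bullet> Z p)
      + (Z p \<bullet> sconn W Y p) * (a \<bullet> p)" if Z: "vfield Z" and W: "vfield W" for Z W a
  proof -
    have "sderiv (\<lambda>q. sconn W Y q \<bullet> a) p (Z p)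
      = sderiv (\<lambda>q. sderiv (\<lambda>q. Y q \<bullet> a) q (W q) + (W q \<bullet> Y q) * (a \<bullet> q)) p (Z p)"
      by (intro fun_cong[OF sderiv_cong] p sconn_inner_const W Y)
    also have "\<dots> = sderiv (\<lambda>q. sderiv (\<lambda>q. Y q \<bullet> a) q (W q)) p (Z p) + sderiv (\<lambda>q. (W q \<bullet> Y q) * (a \<bullet> q)) p (Z p)"
      by (intro sderiv_add p vfield_tangent Z smooth_fun_sderiv sm W smooth_fun_mult smooth_fun_inner
          vfield_smooth Y smooth_fun_const smooth_fun_ident)
    also have "sderiv (\<lambda>q. (W q \<bullet> Y q) * (a \<bullet> q)) p (Z p) =
      (W p \<bullet> Y p) * (a \<bullet> Z p) + (sconn Z W p \<bullet> Y p + W p \<bullet> sconn Z Y p) * (a \<bullet> p)"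
      using sconn_metric[OF p Z W Y] sderiv_inner[OF p vfield_tangent[OF Z p], of a]
      by (subst sderiv_mult)
        (simp_all only: p vfield_tangent Z smooth_fun_inner vfield_smooth W Y smooth_fun_const smooth_fun_ident)
    finally show ?thesis
      using sconn_inner_const[OF p Z vfield_sconn[OF W Y], of a] by simp
  qed
  have "(sconn Z (sconn W Y) p - sconn W (sconn Z Y) p - sconn (sbracket Z W) Y p) \<bullet> a
    = ((W p \<bullet> Y p) *\<^sub>R Z p - (Z p \<bullet> Y p) *\<^sub>R W p) \<bullet> a" for a
    using two[OF Z W, of a] two[OF W Z, of a] sconn_inner_const[OF p vfield_sbracket[OF Z W] Y, of a]
      sderiv_sbracket[OF Z W p sm[of a]]
    by (simp add: sbracket_def inner_simps inner_commute algebra_simps)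
  then show ?thesis by (rule iffD1[OF vector_eq_rdot, OF allI])
qed

section \<open>Connections in global coordinates\<close>

lemma sbracket_cong:
  assumes "p \<in> usphere" "\<And>q. q \<in> usphere \<Longrightarrow> X q = X' q" "\<And>q. q \<in> usphere \<Longrightarrow> Y q = Y' q"
  shows "sbracket X Y p = sbracket X' Y' p"
  using assms sconn_cong[of p X X' Y Y'] sconn_cong[of p Y Y' X X'] by (simp add: sbracket_def)

text \<open>The factors 1 and -1 give the right side the shape of a combination with two coefficient
  functions, so that \<open>nab_lin\<close> applies to it and then to each bracket.\<close>

lemma sbracket_lincomb_left:
  assumes p: "p \<in> usphere" and f: "smooth_fun usphere f" and h: "smooth_fun usphere h"
    and X: "vfield X" and X': "vfield X'" and Y: "vfield Y"
  shows "sbracket (\<lambda>q. f q *\<^sub>R X q + h q *\<^sub>R X' q) Y p =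
    1 *\<^sub>R (f p *\<^sub>R sbracket X Y p + h p *\<^sub>R sbracket X' Y p)
    + (-1) *\<^sub>R (sderiv f p (Y p) *\<^sub>R X p + sderiv h p (Y p) *\<^sub>R X' p)"
  using sconn_lincomb_left[OF p Y, of "\<lambda>q. f q *\<^sub>R X q + h q *\<^sub>R X' q" "f p" X "h p" X']
    sconn_add_right[OF p Y vfield_scale[OF f X] vfield_scale[OF h X']]
    sconn_scale_right[OF p f Y X] sconn_scale_right[OF p h Y X']
  by (simp add: sbracket_def algebra_simps)

definition fs :: "('a \<Rightarrow> real) \<Rightarrow> ('i \<Rightarrow> 'a \<Rightarrow> real) \<Rightarrow> 'i \<Rightarrow> 'a \<Rightarrow> real"
  where "fs f v = (\<lambda>i p. f p * v i p)"

lemma fs_apply [simp]: "fs f v i p = f p * v i p"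
  by (simp add: fs_def)

lemma sum_fun_apply2: "(\<Sum>j\<in>J. v j) i p = (\<Sum>j\<in>J. v j i p)" for v :: "'j \<Rightarrow> 'i \<Rightarrow> 'a \<Rightarrow> real"
  by (induction J rule: infinite_finite_induct) auto

abbreviation fdiff :: "('a::euclidean_space \<Rightarrow> real) \<Rightarrow> ('a \<Rightarrow> 'a) \<Rightarrow> 'a \<Rightarrow> real"
  where "fdiff f X \<equiv> (\<lambda>p. sderiv f p (X p))"

text \<open>A section is coded by its coefficients with respect to a finite generating family \<open>s\<close> of
  global sections, so that linear algebra in the fibres becomes arithmetic of real functions. Off the
  sphere the coefficients are 0, which makes equality of sections equality of functions.\<close>

locale coord_connection =
  fixes Sec :: "('i \<Rightarrow> 'a::euclidean_space \<Rightarrow> real) set"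
    and nab :: "('a \<Rightarrow> 'a) \<Rightarrow> ('i \<Rightarrow> 'a \<Rightarrow> real) \<Rightarrow> 'i \<Rightarrow> 'a \<Rightarrow> real"
    and I :: "'i set" and s :: "'i \<Rightarrow> 'i \<Rightarrow> 'a \<Rightarrow> real"
  assumes finite_I: "finite I"
    and sec_smooth: "v \<in> Sec \<Longrightarrow> smooth_fun usphere (v i)"
    and sec_ext: "v \<in> Sec \<Longrightarrow> p \<notin> usphere \<Longrightarrow> v i p = 0"
    and sec_zero [simp]: "0 \<in> Sec"
    and sec_add [simp]: "v \<in> Sec \<Longrightarrow> w \<in> Sec \<Longrightarrow> v + w \<in> Sec"
    and sec_scale [simp]: "smooth_fun usphere f \<Longrightarrow> v \<in> Sec \<Longrightarrow> fs f v \<in> Sec"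
    and gen_sec [simp]: "i \<in> I \<Longrightarrow> s i \<in> Sec"
    and gen: "v \<in> Sec \<Longrightarrow> v = (\<Sum>i\<in>I. fs (v i) (s i))"
    and nab_sec [simp]: "vfield X \<Longrightarrow> v \<in> Sec \<Longrightarrow> nab X v \<in> Sec"
    and nab_cong: "vfield X \<Longrightarrow> vfield X' \<Longrightarrow> v \<in> Sec \<Longrightarrow> (\<And>p. p \<in> usphere \<Longrightarrow> X p = X' p) \<Longrightarrow> nab X v = nab X' v"
    and nab_add: "vfield X \<Longrightarrow> v \<in> Sec \<Longrightarrow> w \<in> Sec \<Longrightarrow> nab X (v + w) = nab X v + nab X w"
    and nab_scale: "smooth_fun usphere f \<Longrightarrow> vfield X \<Longrightarrow> v \<in> Sec \<Longrightarrow>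
      nab X (fs f v) = fs (fdiff f X) v + fs f (nab X v)"
    and nab_lin: "smooth_fun usphere f \<Longrightarrow> smooth_fun usphere h \<Longrightarrow> vfield X \<Longrightarrow> vfield X' \<Longrightarrow> v \<in> Sec \<Longrightarrow>
      nab (\<lambda>q. f q *\<^sub>R X q + h q *\<^sub>R X' q) v = fs f (nab X v) + fs h (nab X' v)"
begin

section \<open>Sections as a module over the smooth functions\<close>

lemma sec_neg: "fs (\<lambda>_. -1) v = - v"
  by (simp add: fun_eq_iff)

lemma sec_diff [simp]: "v \<in> Sec \<Longrightarrow> w \<in> Sec \<Longrightarrow> v - w \<in> Sec"
  using sec_add[OF _ sec_scale[OF smooth_fun_const, of w "-1"], of v] by (simp add: sec_neg)

lemma sec_sum: "(\<And>j. j \<in> J \<Longrightarrow> v j \<in> Sec) \<Longrightarrow> (\<Sum>j\<in>J. v j) \<in> Sec"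
  by (induction J rule: infinite_finite_induct) auto

lemma sec_eqI:
  assumes "v \<in> Sec" "w \<in> Sec" "\<And>i p. p \<in> usphere \<Longrightarrow> v i p = w i p"
  shows "v = w"
proof (intro ext)
  fix i p show "v i p = w i p" using assms(3)[of p i] sec_ext[OF assms(1), of p i] sec_ext[OF assms(2), of p i]
      by (cases "p \<in> usphere") auto
qed

lemma nab_diff: "vfield X \<Longrightarrow> v \<in> Sec \<Longrightarrow> w \<in> Sec \<Longrightarrow> nab X (v - w) = nab X v - nab X w"
  using nab_add[of X "v - w" w] by (simp add: eq_diff_eq)

lemma nab_zero: "vfield X \<Longrightarrow> nab X 0 = 0"
  using nab_diff[of X 0 0] by simp

lemma nab_sum: "vfield X \<Longrightarrow> (\<And>j. j \<in> J \<Longrightarrow> v j \<in> Sec) \<Longrightarrow> nab X (\<Sum>j\<in>J. v j) = (\<Sum>j\<in>J. nab X (v j))"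
  by (induction J rule: infinite_finite_induct) (auto simp: nab_zero nab_add sec_sum)

text \<open>Linearity over the smooth functions characterizes bundle endomorphisms; only the
  behaviour on \<open>Sec\<close> is constrained.\<close>

definition endo :: "(('i \<Rightarrow> 'a \<Rightarrow> real) \<Rightarrow> 'i \<Rightarrow> 'a \<Rightarrow> real) \<Rightarrow> bool"
  where "endo A \<longleftrightarrow> (\<forall>v\<in>Sec. A v \<in> Sec) \<and> (\<forall>v\<in>Sec. \<forall>w\<in>Sec. A (v + w) = A v + A w) \<and>
    (\<forall>f. smooth_fun usphere f \<longrightarrow> (\<forall>v\<in>Sec. A (fs f v) = fs f (A v)))"

lemma endoI:
  "(\<And>v. v \<in> Sec \<Longrightarrow> A v \<in> Sec) \<Longrightarrow> (\<And>v w. v \<in> Sec \<Longrightarrow> w \<in> Sec \<Longrightarrow> A (v + w) = A v + A w) \<Longrightarrow>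
   (\<And>f v. smooth_fun usphere f \<Longrightarrow> v \<in> Sec \<Longrightarrow> A (fs f v) = fs f (A v)) \<Longrightarrow> endo A"
  and endo_sec [simp]: "endo A \<Longrightarrow> v \<in> Sec \<Longrightarrow> A v \<in> Sec"
  and endo_add: "endo A \<Longrightarrow> v \<in> Sec \<Longrightarrow> w \<in> Sec \<Longrightarrow> A (v + w) = A v + A w"
  and endo_scale: "endo A \<Longrightarrow> smooth_fun usphere f \<Longrightarrow> v \<in> Sec \<Longrightarrow> A (fs f v) = fs f (A v)"
  by (auto simp: endo_def)

lemma endo_diff: "endo A \<Longrightarrow> v \<in> Sec \<Longrightarrow> w \<in> Sec \<Longrightarrow> A (v - w) = A v - A w"
  using endo_add[of A "v - w" w] by (simp add: eq_diff_eq)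

lemma endo_zero: "endo A \<Longrightarrow> A 0 = 0"
  using endo_diff[of A 0 0] by simp

lemma endo_sum:
  assumes A: "endo A" and v: "\<And>j. j \<in> J \<Longrightarrow> v j \<in> Sec"
  shows "A (\<Sum>j\<in>J. v j) = (\<Sum>j\<in>J. A (v j))"
  using v by (induction J rule: infinite_finite_induct) (auto simp: endo_zero[OF A] endo_add[OF A] sec_sum)

lemma endo_expand:
  assumes "endo A" "v \<in> Sec" shows "A v = (\<Sum>i\<in>I. fs (v i) (A (s i)))"
  by (subst gen[OF assms(2)])
    (simp add: endo_sum[OF assms(1)] endo_scale[OF assms(1)] sec_smooth[OF assms(2)])

text \<open>After expansion in the generators a section enters only through its coefficients at
  \<open>p\<close>.\<close>

lemma endo_pointwise:
  assumes A: "endo A" and v: "v \<in> Sec" "w \<in> Sec" and eq: "\<And>i. v i p = w i p"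
  shows "A v j p = A w j p"
  by (simp add: endo_expand[OF A v(1)] endo_expand[OF A v(2)] sum_fun_apply2 eq)

lemma endo_pointwise_lincomb:
  assumes A: "endo A" and v: "v \<in> Sec" "w1 \<in> Sec" "w2 \<in> Sec" and eq: "\<And>i. v i p = a * w1 i p + b * w2 i p"
  shows "A v j p = a * A w1 j p + b * A w2 j p"
  by (simp add: endo_expand[OF A v(1)] endo_expand[OF A v(2)] endo_expand[OF A v(3)] sum_fun_apply2 eq
      sum_distrib_left sum.distrib algebra_simps)

section \<open>Covariant derivatives, commutators and curvature as operators on sections\<close>

definition cov where "cov Z A = (\<lambda>v. nab Z (A v) - A (nab Z v))"

definition comm where "comm A B = (\<lambda>v. A (B v) - B (A v))"
  for A B :: "('i \<Rightarrow> 'a \<Rightarrow> real) \<Rightarrow> 'i \<Rightarrow> 'a \<Rightarrow> real"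

definition Rm where "Rm X Y = (\<lambda>v. nab X (nab Y v) - nab Y (nab X v) - nab (sbracket X Y) v)"

text \<open>The operator form of \<open>Dcurv_fields\<close>: \<open>cov\<close> collects its first
  and last terms, while \<open>sconn\<close>, and \<open>sbracket\<close> inside \<open>Rm\<close>,
  stand for the Levi-Civita connection and the Lie bracket.\<close>

definition DR where
  "DR Z X Y = (\<lambda>v. cov Z (Rm X Y) v - Rm (sconn Z X) Y v - Rm X (sconn Z Y) v)"

lemma endo_comm [simp]:
  assumes A: "endo A" and B: "endo B" shows "endo (comm A B)"
  by (rule endoI) (simp_all add: comm_def A B endo_add[OF A] endo_add[OF B] endo_scale[OF A] endo_scale[OF B],
      simp_all add: fun_eq_iff algebra_simps)

lemma endo_plus [simp]:
  assumes A: "endo A" and B: "endo B" shows "endo (\<lambda>v. A v + B v)"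
  by (rule endoI) (simp_all add: A B endo_add[OF A] endo_add[OF B] endo_scale[OF A] endo_scale[OF B],
      simp_all add: fun_eq_iff algebra_simps)

lemma endo_minus [simp]:
  assumes A: "endo A" and B: "endo B" shows "endo (\<lambda>v. A v - B v)"
  by (rule endoI) (simp_all add: A B endo_add[OF A] endo_add[OF B] endo_scale[OF A] endo_scale[OF B],
      simp_all add: fun_eq_iff algebra_simps)

lemma endo_fs [simp]:
  assumes h: "smooth_fun usphere h" and A: "endo A" shows "endo (\<lambda>v. fs h (A v))"
  by (rule endoI) (simp_all add: h A endo_add[OF A] endo_scale[OF A], simp_all add: fun_eq_iff algebra_simps)

lemma endo_cov [simp]:
  assumes Z: "vfield Z" and A: "endo A" shows "endo (cov Z A)"
proof (rule endoI)
  fix f :: "'a \<Rightarrow> real" and v assume f: "smooth_fun usphere f" and v: "v \<in> Sec"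
  have "smooth_fun usphere (fdiff f Z)" by (rule smooth_fun_sderiv[OF f Z])
  then have "cov Z A (fs f v) = fs (fdiff f Z) (A v) + fs f (nab Z (A v)) - (fs (fdiff f Z) (A v) + fs f (A (nab Z v)))"
    using assms f v by (simp add: cov_def endo_add[OF A] endo_scale[OF A] nab_scale)
  then show "cov Z A (fs f v) = fs f (cov Z A v)"
    by (simp add: cov_def fun_eq_iff algebra_simps)
next
  fix v w assume "v \<in> Sec" "w \<in> Sec"
  then show "cov Z A (v + w) = cov Z A v + cov Z A w"
    using assms by (simp add: cov_def endo_add[OF A] nab_add)
qed (use assms in \<open>simp add: cov_def\<close>)

lemma endo_Rm [simp]:
  assumes X: "vfield X" and Y: "vfield Y" shows "endo (Rm X Y)"
proof (rule endoI)
  note XY = vfield_sbracket[OF X Y]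
  fix f :: "'a \<Rightarrow> real" and v assume f: "smooth_fun usphere f" and v: "v \<in> Sec"
  note sm = smooth_fun_sderiv[OF f X] smooth_fun_sderiv[OF f Y] smooth_fun_sderiv[OF f XY]
  let ?g = "\<lambda>p. fdiff (fdiff f Y) X p - fdiff (fdiff f X) Y p - fdiff f (sbracket X Y) p"
  have 1: "nab X (nab Y (fs f v)) = fs (fdiff (fdiff f Y) X) v + fs (fdiff f Y) (nab X v)
      + (fs (fdiff f X) (nab Y v) + fs f (nab X (nab Y v)))"
    using X Y f v sm by (simp add: nab_scale nab_add)
  have 2: "nab Y (nab X (fs f v)) = fs (fdiff (fdiff f X) Y) v + fs (fdiff f X) (nab Y v)
      + (fs (fdiff f Y) (nab X v) + fs f (nab Y (nab X v)))"
    using X Y f v sm by (simp add: nab_scale nab_add)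
  have "Rm X Y (fs f v) = fs ?g v + fs f (Rm X Y v)"
    unfolding Rm_def 1 2 nab_scale[OF f XY v] by (simp add: fun_eq_iff algebra_simps)
  \<comment> \<open>On the sphere the coefficient vanishes by the defining property of the bracket;
    off the sphere the section is 0 by convention.\<close>
  also have "fs ?g v = 0"
  proof (intro ext)
    fix i p
    show "fs ?g v i p = 0 i p"
      using sderiv_sbracket[OF X Y _ f, of p] sec_ext[OF v, of p i] by (cases "p \<in> usphere") simp_all
  qed
  finally show "Rm X Y (fs f v) = fs f (Rm X Y v)" by (simp only: add_0_left)
next
  fix v w assume "v \<in> Sec" "w \<in> Sec"
  then show "Rm X Y (v + w) = Rm X Y v + Rm X Y w"
    using assms vfield_sbracket[OF X Y] by (simp add: Rm_def nab_add)
qed (use assms vfield_sbracket[OF X Y] in \<open>simp add: Rm_def\<close>)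

lemma endo_DR [simp]: "vfield Z \<Longrightarrow> vfield X \<Longrightarrow> vfield Y \<Longrightarrow> endo (DR Z X Y)"
  unfolding DR_def by (intro endo_minus endo_cov endo_Rm vfield_sconn)

text \<open>The counterpart of \<open>endo\<close> for vector field arguments. Values of vector
  fields off the sphere are arbitrary, so invariance under changing them is demanded
  separately.\<close>

definition tens :: "(('a \<Rightarrow> 'a) \<Rightarrow> 'i \<Rightarrow> 'a \<Rightarrow> real) \<Rightarrow> bool"
  where "tens B \<longleftrightarrow>
    (\<forall>X X'. vfield X \<longrightarrow> vfield X' \<longrightarrow> (\<forall>p\<in>usphere. X p = X' p) \<longrightarrow> B X = B X') \<and>
    (\<forall>f h X X'. smooth_fun usphere f \<longrightarrow> smooth_fun usphere h \<longrightarrow> vfield X \<longrightarrow> vfield X' \<longrightarrow>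
      B (\<lambda>q. f q *\<^sub>R X q + h q *\<^sub>R X' q) = fs f (B X) + fs h (B X'))"

lemma tensI:
  assumes "\<And>X X'. vfield X \<Longrightarrow> vfield X' \<Longrightarrow> (\<And>p. p \<in> usphere \<Longrightarrow> X p = X' p) \<Longrightarrow> B X = B X'"
    and "\<And>f h X X'. smooth_fun usphere f \<Longrightarrow> smooth_fun usphere h \<Longrightarrow> vfield X \<Longrightarrow> vfield X' \<Longrightarrow>
      B (\<lambda>q. f q *\<^sub>R X q + h q *\<^sub>R X' q) = fs f (B X) + fs h (B X')"
  shows "tens B"
  unfolding tens_def using assms by blast

lemma tens_cong: "tens B \<Longrightarrow> vfield X \<Longrightarrow> vfield X' \<Longrightarrow> (\<And>p. p \<in> usphere \<Longrightarrow> X p = X' p) \<Longrightarrow> B X = B X'"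
  and tens_lin: "tens B \<Longrightarrow> smooth_fun usphere f \<Longrightarrow> smooth_fun usphere h \<Longrightarrow> vfield X \<Longrightarrow> vfield X' \<Longrightarrow>
      B (\<lambda>q. f q *\<^sub>R X q + h q *\<^sub>R X' q) = fs f (B X) + fs h (B X')"
  unfolding tens_def by blast+

lemma vfield_sum:
  "(\<And>k. k \<in> K \<Longrightarrow> vfield (F k)) \<Longrightarrow> vfield (\<lambda>q. \<Sum>k\<in>K. F k q)"
proof (induction K rule: infinite_finite_induct)
  case (insert k K)
  then show ?case using vfield_add[of "F k" "\<lambda>q. \<Sum>k\<in>K. F k q"] by simp
qed (simp_all add: vfield_zero)

lemma tens_sum:
  assumes B: "tens B" and K: "finite K" "\<And>k. k \<in> K \<Longrightarrow> smooth_fun usphere (f k)" "\<And>k. k \<in> K \<Longrightarrow> vfield (F k)"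
  shows "B (\<lambda>q. \<Sum>k\<in>K. f k q *\<^sub>R F k q) = (\<Sum>k\<in>K. fs (f k) (B (F k)))"
  using K
proof (induction K)
  case empty
  show ?case
    using tens_lin[OF B smooth_fun_const smooth_fun_const vfield_zero vfield_zero, of 0 0]
    by (simp add: fun_eq_iff)
next
  case (insert k K)
  have "B (\<lambda>q. f k q *\<^sub>R F k q + 1 *\<^sub>R (\<Sum>k\<in>K. f k q *\<^sub>R F k q))
      = fs (f k) (B (F k)) + fs (\<lambda>_. 1) (B (\<lambda>q. \<Sum>k\<in>K. f k q *\<^sub>R F k q))"
    using insert.prems by (intro tens_lin[OF B] smooth_fun_const vfield_sum vfield_scale) auto
  then show ?case using insert by (simp add: fun_eq_iff sum_fun_apply2)
qed

text \<open>The expansion in the frame of the \<open>tfield k\<close> shows dependence on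
  \<open>X p\<close> alone. On it rest \<open>tens_pt\<close>, \<open>tens_pt1\<close> and
  \<open>tens_pt0\<close>, by which a field is exchanged for another one with a proportional value
  at a single point.\<close>

lemma tens_expand:
  assumes B: "tens B" and X: "vfield X" and p: "p \<in> usphere"
  shows "B X i p = (\<Sum>k\<in>Basis. (X p \<bullet> k) * B (tfield k) i p)"
proof -
  have sm: "smooth_fun usphere (\<lambda>q. X q \<bullet> k)" for k
    by (intro smooth_fun_inner smooth_fun_const vfield_smooth X)
  have "B X = B (\<lambda>q. \<Sum>k\<in>Basis. (X q \<bullet> k) *\<^sub>R tfield k q)"
    by (intro tens_cong[OF B X] vfield_sum vfield_scale sm vfield_tfield vfield_eq_sum_tfield[OF _ X])
  also have "\<dots> = (\<Sum>k\<in>Basis. fs (\<lambda>q. X q \<bullet> k) (B (tfield k)))"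
    by (intro tens_sum[OF B] finite_Basis sm vfield_tfield)
  finally show ?thesis by (simp add: sum_fun_apply2)
qed

lemma tens_pt:
  assumes B: "tens B" and X: "vfield X" "vfield X1" "vfield X2" and p: "p \<in> usphere"
    and eq: "X p = a *\<^sub>R X1 p + b *\<^sub>R X2 p"
  shows "B X i p = a * B X1 i p + b * B X2 i p"
  by (simp add: tens_expand[OF B X(1) p] tens_expand[OF B X(2) p] tens_expand[OF B X(3) p] eq inner_simps
      sum_distrib_left sum.distrib algebra_simps)

lemma tens_pt1:
  assumes "tens B" "vfield X" "vfield X1" "p \<in> usphere" "X p = a *\<^sub>R X1 p"
  shows "B X i p = a * B X1 i p"
  using tens_pt[OF assms(1-3) assms(3,4), of a 0] assms(5) by simp

lemma tens_pt0: "tens B \<Longrightarrow> vfield X \<Longrightarrow> p \<in> usphere \<Longrightarrow> X p = 0 \<Longrightarrow> B X i p = 0"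
  using tens_pt1[of B X X p 0] by simp

lemma tens_nab: "v \<in> Sec \<Longrightarrow> tens (\<lambda>X. nab X v)"
  by (rule tensI) (auto intro: nab_cong nab_lin)

lemma tens_cov:
  assumes A: "endo A" and v: "v \<in> Sec" shows "tens (\<lambda>Z. cov Z A v)"
proof (rule tensI)
  fix X X' :: "'a \<Rightarrow> 'a" assume "vfield X" "vfield X'" "\<And>p. p \<in> usphere \<Longrightarrow> X p = X' p"
  then show "cov X A v = cov X' A v"
    using nab_cong[of X X' "A v"] nab_cong[of X X' v] assms by (simp add: cov_def)
next
  fix f h :: "'a \<Rightarrow> real" and X X' :: "'a \<Rightarrow> 'a"
  assume "smooth_fun usphere f" "smooth_fun usphere h" "vfield X" "vfield X'"
  then have "cov (\<lambda>q. f q *\<^sub>R X q + h q *\<^sub>R X' q) A v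
    = fs f (nab X (A v)) + fs h (nab X' (A v)) - (fs f (A (nab X v)) + fs h (A (nab X' v)))"
    using A v by (simp add: cov_def nab_lin endo_add[OF A] endo_scale[OF A])
  then show "cov (\<lambda>q. f q *\<^sub>R X q + h q *\<^sub>R X' q) A v = fs f (cov X A v) + fs h (cov X' A v)"
    by (simp add: cov_def fun_eq_iff algebra_simps)
qed

lemma Rm_skew:
  assumes X: "vfield X" and Y: "vfield Y" and v: "v \<in> Sec"
  shows "Rm Y X v = - Rm X Y v"
proof -
  note XY = vfield_sbracket[OF X Y]
  have eq: "sbracket Y X = (\<lambda>q. (\<lambda>_. -1) q *\<^sub>R sbracket X Y q + (\<lambda>_. 0) q *\<^sub>R sbracket X Y q)"
    by (simp add: sbracket_def fun_eq_iff)
  have "nab (sbracket Y X) v = fs (\<lambda>_. -1) (nab (sbracket X Y) v) + fs (\<lambda>_. 0) (nab (sbracket X Y) v)"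
    unfolding eq by (intro nab_lin smooth_fun_const XY v)
  then show ?thesis by (simp add: Rm_def fun_eq_iff)
qed

text \<open>The derivatives of the coefficients that \<open>nab Y\<close> produces are cancelled by
  those in the bracket.\<close>

lemma tens_Rm1:
  assumes Y: "vfield Y" and v: "v \<in> Sec"
  shows "tens (\<lambda>X. Rm X Y v)"
proof (rule tensI)
  fix X X' :: "'a \<Rightarrow> 'a" assume X: "vfield X" "vfield X'" and eq: "\<And>p. p \<in> usphere \<Longrightarrow> X p = X' p"
  have "nab (sbracket X Y) v = nab (sbracket X' Y) v"
    by (intro nab_cong vfield_sbracket X Y v sbracket_cong eq refl)
  then show "Rm X Y v = Rm X' Y v"
    using nab_cong[OF X _ eq, of v] nab_cong[OF X _ eq, of "nab Y v"] Y v by (simp add: Rm_def)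
next
  fix f h :: "'a \<Rightarrow> real" and X X' :: "'a \<Rightarrow> 'a"
  assume f: "smooth_fun usphere f" and h: "smooth_fun usphere h" and X: "vfield X" and X': "vfield X'"
  note sm = smooth_fun_sderiv[OF f Y] smooth_fun_sderiv[OF h Y]
  note br = vfield_sbracket[OF X Y] vfield_sbracket[OF X' Y]
  have lc: "vfield (\<lambda>q. f q *\<^sub>R X q + h q *\<^sub>R X' q)"
    by (intro vfield_add vfield_scale f h X X')
  have "nab (sbracket (\<lambda>q. f q *\<^sub>R X q + h q *\<^sub>R X' q) Y) v
    = nab (\<lambda>q. (\<lambda>_. 1) q *\<^sub>R (\<lambda>q. f q *\<^sub>R sbracket X Y q + h q *\<^sub>R sbracket X' Y q) q
       + (\<lambda>_. -1) q *\<^sub>R (\<lambda>q. fdiff f Y q *\<^sub>R X q + fdiff h Y q *\<^sub>R X' q) q) v"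
    by (intro nab_cong vfield_sbracket lc Y v vfield_add vfield_scale smooth_fun_const f h X X' sm br)
      (simp add: sbracket_lincomb_left f h X X' Y)
  also have "\<dots> = fs (\<lambda>_. 1) (nab (\<lambda>q. f q *\<^sub>R sbracket X Y q + h q *\<^sub>R sbracket X' Y q) v)
      + fs (\<lambda>_. -1) (nab (\<lambda>q. fdiff f Y q *\<^sub>R X q + fdiff h Y q *\<^sub>R X' q) v)"
    by (intro nab_lin smooth_fun_const vfield_add vfield_scale f h X X' sm br v)
  finally have "nab (sbracket (\<lambda>q. f q *\<^sub>R X q + h q *\<^sub>R X' q) Y) v
    = fs f (nab (sbracket X Y) v) + fs h (nab (sbracket X' Y) v)
      - fs (fdiff f Y) (nab X v) - fs (fdiff h Y) (nab X' v)"
    using f h X X' sm br v by (simp add: nab_lin fun_eq_iff)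
  then show "Rm (\<lambda>q. f q *\<^sub>R X q + h q *\<^sub>R X' q) Y v = fs f (Rm X Y v) + fs h (Rm X' Y v)"
    using f h X X' Y v by (simp add: Rm_def nab_lin nab_add nab_scale fun_eq_iff algebra_simps)
qed

lemma tens_uminus: "tens B \<Longrightarrow> tens (\<lambda>X. - B X)"
  by (rule tensI) (auto simp: tens_lin fun_eq_iff algebra_simps dest: tens_cong)

lemma tens_change:
  assumes B: "tens B" and C: "\<And>X. vfield X \<Longrightarrow> C X = B X" shows "tens C"
proof (rule tensI)
  fix X X' :: "'a \<Rightarrow> 'a" assume "vfield X" "vfield X'" "\<And>p. p \<in> usphere \<Longrightarrow> X p = X' p"
  then show "C X = C X'" using tens_cong[OF B, of X X'] C[of X] C[of X'] by simp
qed (simp add: C vfield_add vfield_scale tens_lin[OF B])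

lemma tens_Rm2: "vfield X \<Longrightarrow> v \<in> Sec \<Longrightarrow> tens (\<lambda>Y. Rm X Y v)"
  by (rule tens_change[OF tens_uminus[OF tens_Rm1]]) (auto intro: Rm_skew)

lemma DR_skew:
  assumes Z: "vfield Z" and X: "vfield X" and Y: "vfield Y" and v: "v \<in> Sec"
  shows "DR Z Y X v = - DR Z X Y v"
proof -
  have "nab Z (- Rm X Y v) = - nab Z (Rm X Y v)"
    using nab_scale[OF smooth_fun_const Z, of "Rm X Y v" "-1"] X Y Z v sderiv_const vfield_tangent[OF Z]
    using nab_diff[OF Z sec_zero, of "Rm X Y v"] by (simp add: nab_zero)
  then show ?thesis
    using Rm_skew[OF X Y] Rm_skew[OF vfield_sconn[OF Z X] Y] Rm_skew[OF X vfield_sconn[OF Z Y]] X Y Z v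
    by (simp add: DR_def cov_def)
qed

lemma tens_DR1:
  assumes X: "vfield X" and Y: "vfield Y" and v: "v \<in> Sec"
  shows "tens (\<lambda>Z. DR Z X Y v)"
proof (rule tensI)
  fix Z Z' :: "'a \<Rightarrow> 'a" assume Z: "vfield Z" "vfield Z'" and eq: "\<And>p. p \<in> usphere \<Longrightarrow> Z p = Z' p"
  have 1: "cov Z (Rm X Y) v = cov Z' (Rm X Y) v"
    by (intro tens_cong[OF tens_cov] endo_Rm X Y v Z eq)
  have 2: "Rm (sconn Z X) Y v = Rm (sconn Z' X) Y v"
    by (intro tens_cong[OF tens_Rm1] X Y v Z vfield_sconn sconn_cong eq refl)
  have 3: "Rm X (sconn Z Y) v = Rm X (sconn Z' Y) v"
    by (intro tens_cong[OF tens_Rm2] X Y v Z vfield_sconn sconn_cong eq refl)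
  show "DR Z X Y v = DR Z' X Y v" by (simp add: DR_def 1 2 3)
next
  fix f h :: "'a \<Rightarrow> real" and Z Z' :: "'a \<Rightarrow> 'a"
  assume f: "smooth_fun usphere f" and h: "smooth_fun usphere h" and Z: "vfield Z" and Z': "vfield Z'"
  let ?Z = "\<lambda>q. f q *\<^sub>R Z q + h q *\<^sub>R Z' q"
  have fZ: "vfield ?Z" by (intro vfield_add vfield_scale f h Z Z')
  have 1: "cov ?Z (Rm X Y) v = fs f (cov Z (Rm X Y) v) + fs h (cov Z' (Rm X Y) v)"
    by (intro tens_lin[OF tens_cov] endo_Rm X Y v Z Z' f h)
  have sc: "Rm (sconn ?Z W) W' v = fs f (Rm (sconn Z W) W' v) + fs h (Rm (sconn Z' W) W' v)"
    if W: "vfield W" "vfield W'" for W W'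
  proof -
    have "Rm (sconn ?Z W) W' v = Rm (\<lambda>q. f q *\<^sub>R sconn Z W q + h q *\<^sub>R sconn Z' W q) W' v"
      by (intro tens_cong[OF tens_Rm1] v W vfield_sconn fZ vfield_add vfield_scale Z Z' f h)
        (simp add: sconn_lincomb_left W)
    also have "\<dots> = fs f (Rm (sconn Z W) W' v) + fs h (Rm (sconn Z' W) W' v)"
      by (intro tens_lin[OF tens_Rm1] v W vfield_sconn Z Z' f h)
    finally show ?thesis .
  qed
  have 3: "Rm X (sconn ?Z Y) v = fs f (Rm X (sconn Z Y) v) + fs h (Rm X (sconn Z' Y) v)"
    using sc[OF Y X] Rm_skew[OF _ X v] fZ Z Z' Y by (simp add: vfield_sconn fun_eq_iff)
  show "DR ?Z X Y v = fs f (DR Z X Y v) + fs h (DR Z' X Y v)"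
    unfolding DR_def 1 sc[OF X Y] 3 by (simp add: fun_eq_iff algebra_simps)
qed

text \<open>Here \<open>sconn Z\<close> differentiates the coefficients; the resulting curvature
  terms cancel those created by \<open>nab Z\<close> inside \<open>cov\<close>.\<close>

lemma tens_DR2:
  assumes Z: "vfield Z" and Y: "vfield Y" and v: "v \<in> Sec"
  shows "tens (\<lambda>X. DR Z X Y v)"
proof (rule tensI)
  fix X X' :: "'a \<Rightarrow> 'a" assume X: "vfield X" "vfield X'" and eq: "\<And>p. p \<in> usphere \<Longrightarrow> X p = X' p"
  have 1: "Rm X W w = Rm X' W w" if "vfield W" "w \<in> Sec" for W w
    using that by (intro tens_cong[OF tens_Rm1] X eq)
  have 2: "Rm (sconn Z X) Y v = Rm (sconn Z X') Y v"
    by (intro tens_cong[OF tens_Rm1] X Y v Z vfield_sconn sconn_cong eq refl)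
  show "DR Z X Y v = DR Z X' Y v"
    using Z Y v by (simp add: DR_def cov_def 1 2 vfield_sconn)
next
  fix f h :: "'a \<Rightarrow> real" and X X' :: "'a \<Rightarrow> 'a"
  assume f: "smooth_fun usphere f" and h: "smooth_fun usphere h" and X: "vfield X" and X': "vfield X'"
  let ?X = "\<lambda>q. f q *\<^sub>R X q + h q *\<^sub>R X' q"
  note sm = smooth_fun_sderiv[OF f Z] smooth_fun_sderiv[OF h Z]
  have fX: "vfield ?X" by (intro vfield_add vfield_scale f h X X')
  have lin: "Rm ?X W w = fs f (Rm X W w) + fs h (Rm X' W w)" if "vfield W" "w \<in> Sec" for W w
    using that by (intro tens_lin[OF tens_Rm1] f h X X')
  have "Rm (sconn Z ?X) Y v
    = Rm (\<lambda>q. 1 *\<^sub>R (\<lambda>q. fdiff f Z q *\<^sub>R X q + fdiff h Z q *\<^sub>R X' q) q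
       + 1 *\<^sub>R (\<lambda>q. f q *\<^sub>R sconn Z X q + h q *\<^sub>R sconn Z X' q) q) Y v"
    by (intro tens_cong[OF tens_Rm1] Y v vfield_sconn Z fX vfield_add vfield_scale sm X X' f h smooth_fun_const)
      (simp add: sconn_add_right sconn_scale_right Z X X' f h vfield_scale)
  also have "\<dots> = fs (\<lambda>_. 1) (Rm (\<lambda>q. fdiff f Z q *\<^sub>R X q + fdiff h Z q *\<^sub>R X' q) Y v)
      + fs (\<lambda>_. 1) (Rm (\<lambda>q. f q *\<^sub>R sconn Z X q + h q *\<^sub>R sconn Z X' q) Y v)"
    by (intro tens_lin[OF tens_Rm1] Y v vfield_sconn Z fX vfield_add vfield_scale sm X X' f h smooth_fun_const)
  also have "Rm (\<lambda>q. fdiff f Z q *\<^sub>R X q + fdiff h Z q *\<^sub>R X' q) Y v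
      = fs (fdiff f Z) (Rm X Y v) + fs (fdiff h Z) (Rm X' Y v)"
    by (intro tens_lin[OF tens_Rm1] Y v sm X X')
  also have "Rm (\<lambda>q. f q *\<^sub>R sconn Z X q + h q *\<^sub>R sconn Z X' q) Y v
      = fs f (Rm (sconn Z X) Y v) + fs h (Rm (sconn Z X') Y v)"
    by (intro tens_lin[OF tens_Rm1] Y v vfield_sconn Z X X' f h)
  finally show "DR Z ?X Y v = fs f (DR Z X Y v) + fs h (DR Z X' Y v)"
    using Z Y X X' v f h
    by (simp add: DR_def cov_def lin vfield_sconn nab_add nab_scale fun_eq_iff algebra_simps)
qed

lemma tens_DR3: "vfield Z \<Longrightarrow> vfield X \<Longrightarrow> v \<in> Sec \<Longrightarrow> tens (\<lambda>Y. DR Z X Y v)"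
  by (rule tens_change[OF tens_uminus[OF tens_DR2[where Z=Z and Y=X]]]) (auto intro: DR_skew)

end

section \<open>Parallel transport along great circles\<close>

text \<open>A Gronwall estimate for the sum of squares \<open>\<phi>\<close>: the bound
  \<open>\<bar>\<phi>' t\<bar> \<le> C * \<phi> t\<close> makes
  \<open>\<phi> t * exp (- C * t)\<close> nonincreasing and \<open>\<phi> t * exp (C * t)\<close>
  nondecreasing, so a zero at either end forces \<open>\<phi>\<close> to vanish.\<close>

lemma linear_ode_zero:
  fixes u u' :: "'k \<Rightarrow> real \<Rightarrow> real"
  assumes K: "finite K" and cont: "\<And>k. k \<in> K \<Longrightarrow> continuous_on {a..b} (u k)"
    and deriv: "\<And>k t. k \<in> K \<Longrightarrow> t \<in> {a<..<b} \<Longrightarrow> (u k has_real_derivative u' k t) (at t)"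
    and bound: "\<And>k t. k \<in> K \<Longrightarrow> t \<in> {a<..<b} \<Longrightarrow> \<bar>u' k t\<bar> \<le> M * (\<Sum>j\<in>K. \<bar>u j t\<bar>)"
    and init: "(\<forall>k\<in>K. u k a = 0) \<or> (\<forall>k\<in>K. u k b = 0)"
    and t: "t \<in> {a<..<b}" and k: "k \<in> K"
  shows "u k t = 0"
proof -
  define \<phi> where "\<phi> = (\<lambda>t. \<Sum>k\<in>K. (u k t)\<^sup>2)"
  define \<phi>' where "\<phi>' = (\<lambda>t. \<Sum>k\<in>K. 2 * u k t * u' k t)"
  \<comment> \<open>The 2 is that of the derivative of a square, the cardinality comes from
    Cauchy-Schwarz, and \<open>M\<close> enters by its absolute value because its sign is not
    known.\<close>
  define C where "C = 2 * (\<bar>M\<bar> * real (card K))"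
  have nonneg: "0 \<le> \<phi> t" for t by (simp add: \<phi>_def sum_nonneg)
  have d: "(\<phi> has_real_derivative \<phi>' t) (at t)" if "t \<in> {a<..<b}" for t
    unfolding \<phi>_def \<phi>'_def using deriv[OF _ that] by (auto intro!: derivative_eq_intros sum.cong)
  have c: "continuous_on {a..b} \<phi>" unfolding \<phi>_def by (intro continuous_intros cont)
  have b: "\<bar>\<phi>' t\<bar> \<le> C * \<phi> t" if "t \<in> {a<..<b}" for t
  proof -
    have "\<bar>\<phi>' t\<bar> \<le> (\<Sum>k\<in>K. \<bar>2 * u k t * u' k t\<bar>)" unfolding \<phi>'_def by (rule sum_abs)
    also have "\<dots> \<le> (\<Sum>k\<in>K. 2 * \<bar>u k t\<bar> * (\<bar>M\<bar> * (\<Sum>j\<in>K. \<bar>u j t\<bar>)))"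
    proof (rule sum_mono)
      fix k assume k: "k \<in> K"
      have "M * (\<Sum>j\<in>K. \<bar>u j t\<bar>) \<le> \<bar>M\<bar> * (\<Sum>j\<in>K. \<bar>u j t\<bar>)"
        by (intro mult_right_mono sum_nonneg) auto
      then have "\<bar>u' k t\<bar> \<le> \<bar>M\<bar> * (\<Sum>j\<in>K. \<bar>u j t\<bar>)" using bound[OF k that] by linarith
      then show "\<bar>2 * u k t * u' k t\<bar> \<le> 2 * \<bar>u k t\<bar> * (\<bar>M\<bar> * (\<Sum>j\<in>K. \<bar>u j t\<bar>))"
        by (simp add: abs_mult mult_left_mono)
    qed
    also have "\<dots> = 2 * \<bar>M\<bar> * (\<Sum>k\<in>K. \<bar>u k t\<bar>)\<^sup>2"
      by (simp add: sum_distrib_right[symmetric] sum_distrib_left[symmetric] power2_eq_square)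
    also have "\<dots> \<le> 2 * \<bar>M\<bar> * (\<phi> t * real (card K))"
      using sum_squared_le_sum_of_squares[of "\<lambda>k. \<bar>u k t\<bar>" K] by (intro mult_left_mono) (simp_all add: \<phi>_def)
    finally show ?thesis by (simp add: C_def algebra_simps)
  qed
  have "\<phi> t \<le> 0"
    using init
  proof
    assume 0: "\<forall>k\<in>K. u k a = 0"
    have "\<phi> t * exp (- C * t) \<le> \<phi> a * exp (- C * a)"
    proof (rule DERIV_nonpos_imp_decreasing_open[where f="\<lambda>t. \<phi> t * exp (- C * t)"])
      show "a \<le> t" using t by simp
      show "continuous_on {a..t} (\<lambda>t. \<phi> t * exp (- C * t))"
        using t by (intro continuous_intros continuous_on_subset[OF c]) auto
      fix x assume "a < x" "x < t"
      then have x: "x \<in> {a<..<b}" using t by auto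
      have "((\<lambda>t. \<phi> t * exp (- C * t)) has_real_derivative (\<phi>' x - C * \<phi> x) * exp (- C * x)) (at x)"
        by (auto intro!: derivative_eq_intros d[OF x] simp: algebra_simps)
      moreover have "(\<phi>' x - C * \<phi> x) * exp (- C * x) \<le> 0"
        using b[OF x] by (intro mult_nonpos_nonneg) auto
      ultimately show "\<exists>y. ((\<lambda>t. \<phi> t * exp (- C * t)) has_real_derivative y) (at x) \<and> y \<le> 0" by blast
    qed
    also have "\<phi> a = 0" using 0 by (simp add: \<phi>_def)
    finally show "\<phi> t \<le> 0" by (simp add: mult_le_0_iff)
  next
    assume 0: "\<forall>k\<in>K. u k b = 0"
    have "\<phi> t * exp (C * t) \<le> \<phi> b * exp (C * b)"
    proof (rule DERIV_nonneg_imp_increasing_open[where f="\<lambda>t. \<phi> t * exp (C * t)"])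
      show "t \<le> b" using t by simp
      show "continuous_on {t..b} (\<lambda>t. \<phi> t * exp (C * t))"
        using t by (intro continuous_intros continuous_on_subset[OF c]) auto
      fix x assume "t < x" "x < b"
      then have x: "x \<in> {a<..<b}" using t by auto
      have "((\<lambda>t. \<phi> t * exp (C * t)) has_real_derivative (\<phi>' x + C * \<phi> x) * exp (C * x)) (at x)"
        by (auto intro!: derivative_eq_intros d[OF x] simp: algebra_simps)
      moreover have "(\<phi>' x + C * \<phi> x) * exp (C * x) \<ge> 0"
        using b[OF x] by (intro mult_nonneg_nonneg) auto
      ultimately show "\<exists>y. ((\<lambda>t. \<phi> t * exp (C * t)) has_real_derivative y) (at x) \<and> 0 \<le> y" by blast
    qed
    also have "\<phi> b = 0" using 0 by (simp add: \<phi>_def)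
    finally show "\<phi> t \<le> 0" by (simp add: mult_le_0_iff)
  qed
  with nonneg[of t] have "\<phi> t = 0" by simp
  then show ?thesis using K k by (simp add: \<phi>_def sum_nonneg_eq_0_iff)
qed

context coord_connection
begin

section \<open>Calculus of endomorphisms at a point\<close>

lemma endo_pt1:
  assumes "endo A" "v \<in> Sec" "w \<in> Sec" "\<And>i. v i p = a * w i p"
  shows "A v j p = a * A w j p"
  using endo_pointwise_lincomb[OF assms(1-3) assms(3), of p a 0 j] assms(4) by simp

lemma endo_pt0: "endo A \<Longrightarrow> v \<in> Sec \<Longrightarrow> (\<And>i. v i p = 0) \<Longrightarrow> A v j p = 0"
  using endo_pt1[of A v v p 0] by simp

lemma cov_comm:
  assumes Z: "vfield Z" and A: "endo A" and B: "endo B" and v: "v \<in> Sec"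
  shows "cov Z (comm A B) v i p = comm (cov Z A) B v i p + comm A (cov Z B) v i p"
proof -
  have "nab Z (A (B v) - B (A v)) = nab Z (A (B v)) - nab Z (B (A v))"
    using assms by (simp add: nab_diff)
  moreover have "A (nab Z (B v) - B (nab Z v)) = A (nab Z (B v)) - A (B (nab Z v))"
    "B (nab Z (A v) - A (nab Z v)) = B (nab Z (A v)) - B (A (nab Z v))"
    using assms by (simp_all add: endo_diff[OF A] endo_diff[OF B])
  ultimately show ?thesis unfolding cov_def comm_def by simp
qed

lemma cov_plus:
  assumes Z: "vfield Z" and A: "endo A" and B: "endo B" and v: "v \<in> Sec"
  shows "cov Z (\<lambda>v. A v + B v) v i p = cov Z A v i p + cov Z B v i p"
  using assms by (simp add: cov_def nab_add)

lemma cov_minus: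
  assumes Z: "vfield Z" and A: "endo A" and B: "endo B" and v: "v \<in> Sec"
  shows "cov Z (\<lambda>v. A v - B v) v i p = cov Z A v i p - cov Z B v i p"
  using assms by (simp add: cov_def nab_diff)

lemma cov_fs:
  assumes Z: "vfield Z" and f: "smooth_fun usphere f" and A: "endo A" and v: "v \<in> Sec"
  shows "cov Z (\<lambda>v. fs f (A v)) v i p = sderiv f p (Z p) * A v i p + f p * cov Z A v i p"
  using assms by (simp add: cov_def nab_scale algebra_simps)

lemma cov_cong:
  assumes "vfield Z" "v \<in> Sec" "\<And>v. v \<in> Sec \<Longrightarrow> A v = B v"
  shows "cov Z A v = cov Z B v"
  using assms by (simp add: cov_def)

lemma comm_pt0:
  assumes A: "endo A" and B: "endo B" and v: "v \<in> Sec" and 0: "\<And>v i. v \<in> Sec \<Longrightarrow> A v i p = 0"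
  shows "comm A B v i p = 0" "comm B A v i p = 0"
  using endo_pt0[OF B endo_sec[OF A v], of p] 0 endo_sec[OF B v] v by (simp_all add: comm_def)

text \<open>Proportionality at the single point \<open>p\<close> suffices although operators are
  composed, because endomorphisms act fibrewise. In this way commutators of different global
  operators are compared at a point.\<close>

lemma comm_pt_scale:
  assumes A: "endo A" "endo A'" and B: "endo B" "endo B'" and v: "v \<in> Sec"
    and eqA: "\<And>v i. v \<in> Sec \<Longrightarrow> A v i p = a * A' v i p" and eqB: "\<And>v i. v \<in> Sec \<Longrightarrow> B v i p = b * B' v i p"
  shows "comm A B v i p = a * b * comm A' B' v i p"
proof -
  have "A (B v) i p = a * (b * A' (B' v) i p)"
    using endo_pt1[OF A(2) endo_sec[OF B(1) v] endo_sec[OF B(2) v] eqB[OF v]] eqA[OF endo_sec[OF B(1) v]] by simp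
  moreover have "B (A v) i p = b * (a * B' (A' v) i p)"
    using endo_pt1[OF B(2) endo_sec[OF A(1) v] endo_sec[OF A(2) v] eqA[OF v]] eqB[OF endo_sec[OF A(1) v]] by simp
  ultimately show ?thesis by (simp add: comm_def algebra_simps)
qed

lemma nab_expand:
  assumes w: "w \<in> Sec" and Z: "vfield Z"
  shows "nab Z w i p = (\<Sum>j\<in>I. sderiv (w j) p (Z p) * s j i p + w j p * nab Z (s j) i p)"
proof -
  have "nab Z w = nab Z (\<Sum>j\<in>I. fs (w j) (s j))" using gen[OF w] by simp
  also have "\<dots> = (\<Sum>j\<in>I. nab Z (fs (w j) (s j)))"
    using Z by (intro nab_sum) (simp_all add: sec_smooth[OF w])
  also have "\<dots> = (\<Sum>j\<in>I. fs (fdiff (w j) Z) (s j) + fs (w j) (nab Z (s j)))"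
    using Z by (intro sum.cong refl nab_scale sec_smooth[OF w]) simp_all
  finally show ?thesis by (simp add: sum_fun_apply2)
qed

lemma sec_continuous_on: "w \<in> Sec \<Longrightarrow> continuous_on usphere (w i)"
  by (rule smooth_fun_continuous_on[OF sec_smooth])

text \<open>The generators are redundant, so the coefficients satisfy
  \<open>w i = (\<Sum>j\<in>I. w j * s j i)\<close>. Differentiating this and comparing with
  \<open>nab_expand\<close> writes an ordinary derivative as the covariant one plus terms of order
  zero in \<open>w\<close>, so that parallel sections solve a linear system.\<close>

lemma fdiff_coord:
  assumes w: "w \<in> Sec" and Z: "vfield Z" and p: "p \<in> usphere"
  shows "sderiv (w i) p (Z p) = nab Z w i p - (\<Sum>j\<in>I. w j p * (nab Z (s j) i p - sderiv (s j i) p (Z p)))"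
proof -
  have sm: "smooth_fun usphere (w j)" "j \<in> I \<Longrightarrow> smooth_fun usphere (s j i)" for j
    by (simp_all add: sec_smooth w)
  have "(\<Sum>j\<in>J. w j q * s j i q) = (\<Sum>j\<in>J. fs (w j) (s j)) i q" for J q
    by (simp add: sum_fun_apply2)
  then have "w i = (\<lambda>q. \<Sum>j\<in>I. w j q * s j i q)"
    using gen[OF w] by (simp add: fun_eq_iff)
  then have "sderiv (w i) p (Z p) = sderiv (\<lambda>q. \<Sum>j\<in>I. w j q * s j i q) p (Z p)" by simp
  also have "\<dots> = (\<Sum>j\<in>I. w j p * sderiv (s j i) p (Z p) + sderiv (w j) p (Z p) * s j i p)"
    by (rule sderiv_eqI[OF has_derivative_sum[OF has_derivative_mult] p vfield_tangent[OF Z p]])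
      (auto intro!: has_sderiv sm p)
  also have "\<dots> = nab Z w i p - (\<Sum>j\<in>I. w j p * (nab Z (s j) i p - sderiv (s j i) p (Z p)))"
    unfolding nab_expand[OF w Z] by (simp add: sum_subtractf[symmetric] algebra_simps)
  finally show ?thesis .
qed

end

locale great_circle_connection = coord_connection Sec nab I s
  for Sec :: "('i \<Rightarrow> 'a::euclidean_space \<Rightarrow> real) set" and nab I s +
  fixes p0 \<theta> :: 'a
  assumes p0: "p0 \<in> usphere" and th: "\<theta> \<in> usphere" "\<theta> \<in> tangent p0"
begin

abbreviation \<gamma> where "\<gamma> \<equiv> great_circle p0 \<theta>"
text \<open>The velocity of the circle, extended to the Killing field of the rotation in its plane;
  this extension is smooth on the whole sphere.\<close>

abbreviation N where "N \<equiv> kfield p0 \<theta>"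

lemma circle [simp]: "\<gamma> t \<in> usphere"
  by (rule great_circle_usphere[OF p0 th])

lemma norm_circle [simp]: "norm (\<gamma> t) = 1"
  using circle[of t] by simp

lemma continuous_on_circle: "continuous_on T \<gamma>"
  unfolding great_circle_def by (intro continuous_intros)

lemma circle_ends: "\<gamma> 0 = p0" "\<gamma> pi = - p0"
  by (simp_all add: great_circle_def)

lemma inners: "p0 \<bullet> p0 = 1" "\<theta> \<bullet> \<theta> = 1" "\<theta> \<bullet> p0 = 0" "p0 \<bullet> \<theta> = 0"
  using p0 th tangentD[OF th(2)] by (simp_all add: norm_eq_1 inner_commute)

lemma circle_inner: "p0 \<bullet> \<gamma> t = cos t" "\<theta> \<bullet> \<gamma> t = sin t" "a \<bullet> p0 = 0 \<Longrightarrow> a \<bullet> \<theta> = 0 \<Longrightarrow> a \<bullet> \<gamma> t = 0"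
  by (simp_all add: great_circle_def inner_simps inners)

lemma N_circle: "N (\<gamma> t) = cos t *\<^sub>R \<theta> - sin t *\<^sub>R p0"
  by (simp add: kfield_def circle_inner)

lemma N_inner: "p0 \<bullet> N (\<gamma> t) = - sin t" "\<theta> \<bullet> N (\<gamma> t) = cos t"
  by (simp_all add: N_circle inner_simps inners)

lemma N_norm: "N (\<gamma> t) \<bullet> N (\<gamma> t) = 1"
  using sin_cos_squared_add3[of t] by (simp add: N_circle inner_simps inners algebra_simps)

lemma vfield_N [simp]: "vfield N" and vfield_radial' [simp]: "vfield (radial p0)"
  and vfield_t [simp]: "vfield (tfield a)" and vfield_k [simp]: "vfield (kfield a b)"
  by (simp_all add: vfield_kfield vfield_radial vfield_tfield)

lemma radial_circle: "radial p0 (\<gamma> t) = sin t *\<^sub>R N (\<gamma> t)"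
proof -
  have eq: "cos t * cos t - 1 = - (sin t * sin t)"
    using sin_cos_squared_add3[of t] by linarith
  have "radial p0 (\<gamma> t) = (cos t * cos t - 1) *\<^sub>R p0 + (cos t * sin t) *\<^sub>R \<theta>"
    unfolding radial_def circle_inner by (simp add: great_circle_def algebra_simps)
  then show ?thesis unfolding N_circle eq by (simp add: algebra_simps)
qed

lemma derivative_along_circle:
  "smooth_fun usphere f \<Longrightarrow> ((\<lambda>t. f (\<gamma> t)) has_real_derivative sderiv f (\<gamma> t) (N (\<gamma> t))) (at t)" for f :: "'a \<Rightarrow> real"
  by (rule sderiv_along_curve) (use great_circle_derivative[of p0 \<theta> t] in \<open>simp_all add: N_circle\<close>)

text \<open>The poles are left out, so that division by \<open>sin t\<close> is possible; the values
  there are recovered by continuity.\<close>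

definition null :: "(('i \<Rightarrow> 'a \<Rightarrow> real) \<Rightarrow> 'i \<Rightarrow> 'a \<Rightarrow> real) \<Rightarrow> bool"
  where "null A \<longleftrightarrow> (\<forall>v\<in>Sec. \<forall>i. \<forall>t\<in>{0<..<pi}. A v i (\<gamma> t) = 0)"

lemma nullI: "(\<And>v i t. v \<in> Sec \<Longrightarrow> 0 < t \<Longrightarrow> t < pi \<Longrightarrow> A v i (\<gamma> t) = 0) \<Longrightarrow> null A"
  and nullD: "null A \<Longrightarrow> v \<in> Sec \<Longrightarrow> 0 < t \<Longrightarrow> t < pi \<Longrightarrow> A v i (\<gamma> t) = 0"
  by (auto simp: null_def)

lemma nab_circle_zero:
  assumes w: "w \<in> Sec" and 0: "\<And>i t. 0 < t \<Longrightarrow> t < pi \<Longrightarrow> w i (\<gamma> t) = 0" and t: "0 < t" "t < pi"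
  shows "nab N w i (\<gamma> t) = 0"
proof -
  have "sderiv (w j) (\<gamma> t) (N (\<gamma> t)) = 0" for j
  proof (rule DERIV_unique)
    show "((\<lambda>t. w j (\<gamma> t)) has_real_derivative sderiv (w j) (\<gamma> t) (N (\<gamma> t))) (at t)"
      by (rule derivative_along_circle[OF sec_smooth[OF w]])
    show "((\<lambda>t. w j (\<gamma> t)) has_real_derivative 0) (at t)"
      by (rule has_field_derivative_transform_within_open[of "\<lambda>_. 0" _ _ "{0<..<pi}"]) (use 0 t in auto)
  qed
  then show ?thesis using 0 t by (simp add: nab_expand[OF w])
qed

lemma null_cov: 
  assumes A: "endo A" and 0: "null A" shows "null (cov N A)"
proof (rule nullI)
  fix v i t assume v: "v \<in> Sec" and t: "0 < t" "t < pi"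
  have "nab N (A v) i (\<gamma> t) = 0"
    by (rule nab_circle_zero) (use A v t nullD[OF 0] in auto)
  then show "cov N A v i (\<gamma> t) = 0" using nullD[OF 0 _ t, of "nab N v"] v by (simp add: cov_def)
qed

lemma sec_circle_continuous: "w \<in> Sec \<Longrightarrow> continuous_on T (\<lambda>t. w i (\<gamma> t))"
  by (rule continuous_on_compose2[OF sec_continuous_on continuous_on_circle]) auto

lemma sec_zero_ends:
  assumes w: "w \<in> Sec" and 0: "\<And>t. 0 < t \<Longrightarrow> t < pi \<Longrightarrow> w i (\<gamma> t) = 0"
  shows "w i p0 = 0" "w i (- p0) = 0"
proof -
  have "{0..pi} \<subseteq> closure {0<..<pi}" using pi_gt_zero by simp
  moreover have "w i (\<gamma> t) \<in> {0}" if "t \<in> closure {0<..<pi}" for t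
    by (rule image_subset_iff[THEN iffD1, rule_format, OF image_closure_subset[OF sec_circle_continuous[OF w] closed_singleton] that])
      (use 0 in auto)
  ultimately have "w i (\<gamma> t) = 0" if "t \<in> {0..pi}" for t using that by auto
  from this[of 0] this[of pi] show "w i p0 = 0" "w i (- p0) = 0"
    using circle_ends pi_ge_zero by simp_all
qed

lemma null_ends:
  assumes A: "endo A" and 0: "null A" and v: "v \<in> Sec"
  shows "A v i p0 = 0" "A v i (- p0) = 0"
  using sec_zero_ends[OF endo_sec[OF A v], of i] nullD[OF 0 v] by auto

text \<open>Uniqueness of parallel transport for endomorphisms. Along the circle \<open>par\<close>
  reads \<open>nab N (A (s m)) = A (nab N (s m))\<close>; expanding the right side in generators and
  the left side by \<open>fdiff_coord\<close> gives a linear system for the functions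
  \<open>A (s m) l (\<gamma> t)\<close>. Either pole can carry the initial value.\<close>

lemma parallel_null:
  assumes A: "endo A" and par: "null (cov N A)"
    and init: "(\<forall>v\<in>Sec. \<forall>i. A v i p0 = 0) \<or> (\<forall>v\<in>Sec. \<forall>i. A v i (- p0) = 0)"
  shows "null A"
proof -
  \<comment> \<open>\<open>b\<close> holds the coefficients of the derivatives of the generators,
    \<open>c\<close> the zero order terms of \<open>fdiff_coord\<close>. Continuity on the compact
    interval will bound both.\<close>
  define b where "b = (\<lambda>m j t. nab N (s m) j (\<gamma> t))"
  define c where "c = (\<lambda>l j t. nab N (s j) l (\<gamma> t) - sderiv (s j l) (\<gamma> t) (N (\<gamma> t)))"
  define u where "u = (\<lambda>k t. A (s (snd k)) (fst k) (\<gamma> t))"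
  define u' where "u' = (\<lambda>k t. sderiv (A (s (snd k)) (fst k)) (\<gamma> t) (N (\<gamma> t)))"
  have As: "A (s m) \<in> Sec" if "m \<in> I" for m using A that by simp
  have contb: "continuous_on {0..pi} (b m j)" if "m \<in> I" for m j
    unfolding b_def using that by (intro sec_circle_continuous) simp
  have contc: "continuous_on {0..pi} (c l j)" if "j \<in> I" for l j
  proof -
    have "continuous_on {0..pi} (\<lambda>t. sderiv (s j l) (\<gamma> t) (N (\<gamma> t)))"
      by (rule continuous_on_compose2[OF smooth_fun_continuous_on[OF smooth_fun_sderiv[OF sec_smooth vfield_N]]])
        (use that in \<open>auto intro!: continuous_on_circle\<close>)
    then show ?thesis unfolding c_def using that
      by (intro continuous_on_diff[OF sec_circle_continuous]) simp_all
  qed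
  have "\<exists>B. \<forall>m\<in>I. \<forall>j\<in>I. \<forall>t\<in>{0..pi}. \<bar>b m j t\<bar> \<le> B \<and> \<bar>c m j t\<bar> \<le> B"
  proof -
    have "\<exists>B. \<forall>t\<in>{0..pi}. \<bar>b m j t\<bar> \<le> B \<and> \<bar>c m j t\<bar> \<le> B" if "m \<in> I" "j \<in> I" for m j
    proof -
      have "bounded (b m j ` {0..pi})" "bounded (c m j ` {0..pi})"
        using contb contc that by (auto intro!: compact_imp_bounded compact_continuous_image)
      then obtain B1 B2 where "\<forall>t\<in>{0..pi}. \<bar>b m j t\<bar> \<le> B1" "\<forall>t\<in>{0..pi}. \<bar>c m j t\<bar> \<le> B2"
        by (auto simp: bounded_iff)
      then show ?thesis by (intro exI[of _ "max B1 B2"]) (simp add: le_max_iff_disj)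
    qed
    then obtain B where B: "\<And>m j. m \<in> I \<Longrightarrow> j \<in> I \<Longrightarrow> \<forall>t\<in>{0..pi}. \<bar>b m j t\<bar> \<le> B m j \<and> \<bar>c m j t\<bar> \<le> B m j"
      by metis
    have "B m j \<le> (\<Sum>m\<in>I. \<Sum>j\<in>I. \<bar>B m j\<bar>)" if "m \<in> I" "j \<in> I" for m j
    proof -
      have "B m j \<le> \<bar>B m j\<bar>" by simp
      also have "\<dots> \<le> (\<Sum>j\<in>I. \<bar>B m j\<bar>)" using that finite_I by (intro member_le_sum) auto
      also have "\<dots> \<le> (\<Sum>m\<in>I. \<Sum>j\<in>I. \<bar>B m j\<bar>)"
        using that finite_I by (intro member_le_sum[of m I "\<lambda>m. \<Sum>j\<in>I. \<bar>B m j\<bar>"]) (auto intro: sum_nonneg)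
      finally show ?thesis .
    qed
    with B show ?thesis by (intro exI[of _ "\<Sum>m\<in>I. \<Sum>j\<in>I. \<bar>B m j\<bar>"]) (meson order_trans)
  qed
  then obtain B where B: "\<And>m j t. m \<in> I \<Longrightarrow> j \<in> I \<Longrightarrow> t \<in> {0..pi} \<Longrightarrow> \<bar>b m j t\<bar> \<le> B"
    "\<And>m j t. m \<in> I \<Longrightarrow> j \<in> I \<Longrightarrow> t \<in> {0..pi} \<Longrightarrow> \<bar>c m j t\<bar> \<le> B" by blast
  have u0: "u k t = 0" if k: "k \<in> I \<times> I" and t: "t \<in> {0<..<pi}" for k t
  proof (rule linear_ode_zero[OF _ _ _ _ _ t k])
    show "finite (I \<times> I)" using finite_I by simp
    show "continuous_on {0..pi} (u k)" if "k \<in> I \<times> I" for k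
      unfolding u_def using that by (intro sec_circle_continuous As) auto
    show "(u k has_real_derivative u' k t) (at t)" if "k \<in> I \<times> I" for k t
      unfolding u_def u'_def using that by (intro derivative_along_circle sec_smooth As) auto
    show "(\<forall>k\<in>I \<times> I. u k 0 = 0) \<or> (\<forall>k\<in>I \<times> I. u k pi = 0)"
      using init by (auto simp: u_def circle_ends)
    show "\<bar>u' k t\<bar> \<le> (2 * \<bar>B\<bar>) * (\<Sum>k\<in>I \<times> I. \<bar>u k t\<bar>)" if k: "k \<in> I \<times> I" and t: "t \<in> {0<..<pi}" for k t
    proof -
      obtain l m where k': "k = (l, m)" "l \<in> I" "m \<in> I" using k by auto
      have "nab N (A (s m)) l (\<gamma> t) = A (nab N (s m)) l (\<gamma> t)"
        using nullD[OF par gen_sec[OF k'(3)], of t l] t by (simp add: cov_def)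
      also have "\<dots> = (\<Sum>j\<in>I. b m j t * u (l, j) t)"
        using endo_expand[OF A, of "nab N (s m)"] k'(3) by (simp add: sum_fun_apply2 b_def u_def)
      finally have u': "u' k t = (\<Sum>j\<in>I. b m j t * u (l, j) t) - (\<Sum>j\<in>I. u (j, m) t * c l j t)"
        using fdiff_coord[OF As[OF k'(3)] vfield_N circle, of l t] by (simp add: u'_def c_def u_def k'(1))
      have total: "(\<Sum>k\<in>I \<times> I. \<bar>u k t\<bar>) = (\<Sum>l\<in>I. \<Sum>j\<in>I. \<bar>u (l, j) t\<bar>)"
        by (simp add: sum.cartesian_product case_prod_beta')
      have bB: "\<bar>b m j t\<bar> \<le> \<bar>B\<bar>" and cB: "\<bar>c l j t\<bar> \<le> \<bar>B\<bar>" if "j \<in> I" for j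
        using B(1)[OF k'(3) that, of t] B(2)[OF k'(2) that, of t] t by auto
      have "\<bar>\<Sum>j\<in>I. b m j t * u (l, j) t\<bar> \<le> (\<Sum>j\<in>I. \<bar>b m j t * u (l, j) t\<bar>)" by (rule sum_abs)
      also have "\<dots> \<le> (\<Sum>j\<in>I. \<bar>B\<bar> * \<bar>u (l, j) t\<bar>)"
        using bB by (intro sum_mono) (simp add: abs_mult mult_right_mono)
      also have "\<dots> = \<bar>B\<bar> * (\<Sum>j\<in>I. \<bar>u (l, j) t\<bar>)" by (simp add: sum_distrib_left)
      also have "\<dots> \<le> \<bar>B\<bar> * (\<Sum>k\<in>I \<times> I. \<bar>u k t\<bar>)"
        unfolding total using k' finite_I
        by (intro mult_left_mono member_le_sum[of l I "\<lambda>l. \<Sum>j\<in>I. \<bar>u (l, j) t\<bar>"]) (auto intro: sum_nonneg)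
      finally have 1: "\<bar>\<Sum>j\<in>I. b m j t * u (l, j) t\<bar> \<le> \<bar>B\<bar> * (\<Sum>k\<in>I \<times> I. \<bar>u k t\<bar>)" .
      have "\<bar>\<Sum>j\<in>I. u (j, m) t * c l j t\<bar> \<le> (\<Sum>j\<in>I. \<bar>u (j, m) t * c l j t\<bar>)" by (rule sum_abs)
      also have "\<dots> \<le> (\<Sum>j\<in>I. \<bar>B\<bar> * \<bar>u (j, m) t\<bar>)"
        using cB by (intro sum_mono) (simp add: abs_mult mult_right_mono mult.commute)
      also have "\<dots> = \<bar>B\<bar> * (\<Sum>j\<in>I. \<bar>u (j, m) t\<bar>)" by (simp add: sum_distrib_left)
      also have "\<dots> \<le> \<bar>B\<bar> * (\<Sum>j\<in>I. \<Sum>m\<in>I. \<bar>u (j, m) t\<bar>)"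
        using k' finite_I by (intro mult_left_mono sum_mono member_le_sum) auto
      finally have 2: "\<bar>\<Sum>j\<in>I. u (j, m) t * c l j t\<bar> \<le> \<bar>B\<bar> * (\<Sum>k\<in>I \<times> I. \<bar>u k t\<bar>)"
        unfolding total .
      show ?thesis unfolding u' using 1 2 by (simp add: algebra_simps)
    qed
  qed
  show ?thesis
  proof (rule nullI)
    fix v i t assume v: "v \<in> Sec" and t: "0 < t" "t < pi"
    \<comment> \<open>The system covers coordinates with index in \<open>I\<close>;
      \<open>gen\<close> recovers the remaining ones from these.\<close>
    have "A (s m) i (\<gamma> t) = 0" if "m \<in> I" for m
    proof -
      have "A (s m) l (\<gamma> t) = 0" if "l \<in> I" for l
        using u0[of "(l, m)" t] that \<open>m \<in> I\<close> t by (simp add: u_def)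
      then show ?thesis
        using fun_cong[OF fun_cong[OF gen[OF As[OF that]]], of i "\<gamma> t"] by (simp add: sum_fun_apply2)
    qed
    then show "A v i (\<gamma> t) = 0" by (simp add: endo_expand[OF A v] sum_fun_apply2)
  qed
qed

end

section \<open>Radially parallel curvature\<close>

context coord_connection
begin

lemma nab_zero_field:
  assumes X: "vfield X" and 0: "\<And>p. p \<in> usphere \<Longrightarrow> X p = 0" and v: "v \<in> Sec"
  shows "nab X v = 0"
  by (rule sec_eqI) (use X v tens_pt0[OF tens_nab[OF v] X _ 0] in auto)

lemma nab_commute:
  assumes B: "vfield B" and X: "vfield X" and 0: "\<And>p. p \<in> usphere \<Longrightarrow> sbracket B X p = 0" and v: "v \<in> Sec"
  shows "nab B (nab X v) = nab X (nab B v) + Rm B X v"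
proof -
  have "nab (sbracket B X) v = 0" by (rule nab_zero_field[OF vfield_sbracket[OF B X] 0 v])
  then show ?thesis by (simp add: Rm_def fun_eq_iff)
qed

text \<open>The second Bianchi identity: \<open>nab B\<close> is moved through every term of
  \<open>Rm X Y\<close>, each exchange costing one curvature term because the brackets with
  \<open>B\<close> vanish. The bracket of \<open>X\<close> and \<open>Y\<close> is kept, since the
  Killing fields inserted later need not commute with each other.\<close>

lemma cov_Rm_commuting:
  assumes B: "vfield B" and X: "vfield X" and Y: "vfield Y" and v: "v \<in> Sec"
    and BX: "\<And>p. p \<in> usphere \<Longrightarrow> sbracket B X p = 0" and BY: "\<And>p. p \<in> usphere \<Longrightarrow> sbracket B Y p = 0"
    and BXY: "\<And>p. p \<in> usphere \<Longrightarrow> sbracket B (sbracket X Y) p = 0"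
  shows "cov B (Rm X Y) v = (\<lambda>i p. cov X (Rm B Y) v i p - cov Y (Rm B X) v i p - Rm B (sbracket X Y) v i p)"
proof -
  note XY = vfield_sbracket[OF X Y]
  have 1: "nab B (nab X (nab Y v)) = nab X (nab Y (nab B v)) + nab X (Rm B Y v) + Rm B X (nab Y v)"
    using nab_commute[OF B X BX, of "nab Y v"] nab_commute[OF B Y BY v] B X Y v by (simp add: nab_add)
  have 2: "nab B (nab Y (nab X v)) = nab Y (nab X (nab B v)) + nab Y (Rm B X v) + Rm B Y (nab X v)"
    using nab_commute[OF B Y BY, of "nab X v"] nab_commute[OF B X BX v] B X Y v by (simp add: nab_add)
  have 3: "nab B (nab (sbracket X Y) v) = nab (sbracket X Y) (nab B v) + Rm B (sbracket X Y) v"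
    by (rule nab_commute[OF B XY BXY v])
  have "nab B (Rm X Y v) = nab B (nab X (nab Y v)) - nab B (nab Y (nab X v)) - nab B (nab (sbracket X Y) v)"
    unfolding Rm_def using B X Y XY v by (simp add: nab_diff)
  then show ?thesis
    unfolding cov_def[of B "Rm X Y"] 1 2 3 by (simp add: cov_def Rm_def[of X Y] fun_eq_iff)
qed

text \<open>The Ricci identity for endomorphisms: the curvature acts on them by commutator, and the
  bracket term is absent.\<close>

lemma cov_cov_commuting:
  assumes B: "vfield B" and X: "vfield X" and v: "v \<in> Sec" and A: "endo A"
    and BX: "\<And>p. p \<in> usphere \<Longrightarrow> sbracket B X p = 0"
  shows "cov B (cov X A) v i p = cov X (cov B A) v i p + comm (Rm B X) A v i p"
proof -
  have 1: "nab B (nab X (A v)) = nab X (nab B (A v)) + Rm B X (A v)"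
    using nab_commute[OF B X BX] A v by simp
  have "A (nab B (nab X v)) = A (nab X (nab B v) + Rm B X v)"
    using nab_commute[OF B X BX v] by simp
  then have 2: "A (nab B (nab X v)) = A (nab X (nab B v)) + A (Rm B X v)"
    using A B X v by (simp add: endo_add[OF A])
  show ?thesis
    unfolding cov_def comm_def using A B X v by (simp add: nab_diff 1 2)
qed

end

text \<open>The hypothesis is imposed on \<open>radial p0\<close> instead of the gradient of the
  distance. Off the poles the two differ by a positive factor, at the poles the condition is void,
  and the field is globally smooth.\<close>

locale radial_connection = coord_connection Sec nab I s
  for Sec :: "('i \<Rightarrow> 'a::euclidean_space \<Rightarrow> real) set" and nab I s +
  fixes p0 :: 'a
  assumes p0: "p0 \<in> usphere"
    and radial_DR: "vfield X \<Longrightarrow> v \<in> Sec \<Longrightarrow> p \<in> usphere \<Longrightarrow> DR (radial p0) (radial p0) X v i p = 0"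
begin

abbreviation \<beta> where "\<beta> \<equiv> radial p0"

text \<open>Both correction terms of \<open>DR\<close> are \<open>p0 \<bullet> q\<close> times the
  curvature: the first by \<open>sconn_radial\<close>, the second because
  \<open>sconn \<beta> Z = sconn Z \<beta>\<close> when the bracket vanishes. Hence the factor
  2.\<close>

lemma cov_radial_Rm:
  assumes Z: "vfield Z" and br: "\<And>p. p \<in> usphere \<Longrightarrow> sbracket \<beta> Z p = 0" and v: "v \<in> Sec"
  shows "cov \<beta> (Rm \<beta> Z) v = fs (\<lambda>q. 2 * (p0 \<bullet> q)) (Rm \<beta> Z v)"
proof (rule sec_eqI)
  have sm: "smooth_fun usphere (\<lambda>q. 2 * (p0 \<bullet> q))"
    by (intro smooth_fun_mult smooth_fun_const smooth_fun_inner_const)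
  show "cov \<beta> (Rm \<beta> Z) v \<in> Sec" by (rule endo_sec[OF endo_cov[OF vfield_radial endo_Rm[OF vfield_radial Z]] v])
  show "fs (\<lambda>q. 2 * (p0 \<bullet> q)) (Rm \<beta> Z v) \<in> Sec" by (rule sec_scale[OF sm endo_sec[OF endo_Rm[OF vfield_radial Z] v]])
  fix i and p :: 'a assume p: "p \<in> usphere"
  have "Rm (sconn \<beta> \<beta>) Z v i p = (p0 \<bullet> p) * Rm \<beta> Z v i p"
    by (intro tens_pt1[OF tens_Rm1[OF Z v]] vfield_sconn vfield_radial p sconn_radial)
  moreover have "sconn \<beta> Z p = (p0 \<bullet> p) *\<^sub>R Z p"
    using br[OF p] sconn_radial[OF p Z, of p0] by (simp add: sbracket_def)
  then have "Rm \<beta> (sconn \<beta> Z) v i p = (p0 \<bullet> p) * Rm \<beta> Z v i p"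
    by (intro tens_pt1[OF tens_Rm2[OF vfield_radial v]] vfield_sconn vfield_radial p Z)
  ultimately show "cov \<beta> (Rm \<beta> Z) v i p = fs (\<lambda>q. 2 * (p0 \<bullet> q)) (Rm \<beta> Z v) i p"
    using radial_DR[OF Z v p, of i] by (simp add: DR_def)
qed

text \<open>In the radial coordinate \<open>c = - p0 \<bullet> q\<close> this is a second order equation for the curvature on
  the orbits of the isotropy group.\<close>

lemma cov_radial_cov_radial_Rm:
  assumes X: "vfield X" and Y: "vfield Y" and v: "v \<in> Sec" and p: "p \<in> usphere"
    and BX: "\<And>p. p \<in> usphere \<Longrightarrow> sbracket \<beta> X p = 0" and BY: "\<And>p. p \<in> usphere \<Longrightarrow> sbracket \<beta> Y p = 0"
    and BXY: "\<And>p. p \<in> usphere \<Longrightarrow> sbracket \<beta> (sbracket X Y) p = 0"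
    and X0: "p0 \<bullet> X p = 0" and Y0: "p0 \<bullet> Y p = 0"
  shows "cov \<beta> (cov \<beta> (Rm X Y)) v i p
    = 2 * (p0 \<bullet> p) * cov \<beta> (Rm X Y) v i p + 2 * comm (Rm \<beta> X) (Rm \<beta> Y) v i p"
proof -
  note B = vfield_radial[of p0] and XY = vfield_sbracket[OF X Y]
  let ?h = "\<lambda>q. 2 * (p0 \<bullet> q)"
  have sm: "smooth_fun usphere ?h"
    by (intro smooth_fun_mult smooth_fun_const smooth_fun_inner_const)
  have dh: "sderiv ?h p (Z p) = 2 * (p0 \<bullet> Z p)" if "vfield Z" for Z
    by (rule sderiv_eqI[OF _ p vfield_tangent[OF that p]]) (auto intro!: derivative_eq_intros)
  \<comment> \<open>At \<open>p\<close> the field \<open>X\<close> is tangent to the level set of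
    \<open>p0 \<bullet> q\<close>, so the factor \<open>?h\<close> is not differentiated by
    \<open>X\<close>; the commutator is the price of exchanging \<open>\<beta>\<close> and
    \<open>X\<close>.\<close>
  have mixed: "cov \<beta> (cov X (Rm \<beta> Y)) v i p = 2 * (p0 \<bullet> p) * cov X (Rm \<beta> Y) v i p + comm (Rm \<beta> X) (Rm \<beta> Y) v i p"
    if X: "vfield X" and Y: "vfield Y" and X0: "p0 \<bullet> X p = 0"
      and BX: "\<And>p. p \<in> usphere \<Longrightarrow> sbracket \<beta> X p = 0" and BY: "\<And>p. p \<in> usphere \<Longrightarrow> sbracket \<beta> Y p = 0" for X Y
  proof -
    have "cov X (cov \<beta> (Rm \<beta> Y)) v i p = cov X (\<lambda>v. fs ?h (Rm \<beta> Y v)) v i p"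
      using cov_cong[OF X v cov_radial_Rm[OF Y BY]] by simp
    also have "\<dots> = 2 * (p0 \<bullet> p) * cov X (Rm \<beta> Y) v i p"
      using cov_fs[OF X sm endo_Rm[OF B Y] v, of i p] dh[OF X] X0 by simp
    finally show ?thesis
      using cov_cov_commuting[OF B X v endo_Rm[OF B Y] BX, of i p] by simp
  qed
  let ?G = "\<lambda>v. cov X (Rm \<beta> Y) v - cov Y (Rm \<beta> X) v - Rm \<beta> (sbracket X Y) v"
  have G: "cov \<beta> (Rm X Y) v = ?G v" if "v \<in> Sec" for v
    using cov_Rm_commuting[OF B X Y that BX BY BXY] by (simp add: fun_eq_iff)
  have "cov \<beta> (cov \<beta> (Rm X Y)) v i p = cov \<beta> ?G v i p"
    using cov_cong[OF B v G] by simp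
  also have "\<dots> = cov \<beta> (cov X (Rm \<beta> Y)) v i p - cov \<beta> (cov Y (Rm \<beta> X)) v i p - cov \<beta> (Rm \<beta> (sbracket X Y)) v i p"
    using B X Y XY v by (simp add: cov_minus)
  also have "\<dots> = 2 * (p0 \<bullet> p) * ?G v i p + comm (Rm \<beta> X) (Rm \<beta> Y) v i p - comm (Rm \<beta> Y) (Rm \<beta> X) v i p"
    using mixed[OF X Y X0 BX BY] mixed[OF Y X Y0 BY BX] cov_radial_Rm[OF XY BXY v]
    by (simp add: algebra_simps)
  also have "comm (Rm \<beta> Y) (Rm \<beta> X) v i p = - comm (Rm \<beta> X) (Rm \<beta> Y) v i p"
    by (simp add: comm_def)
  finally show ?thesis using G[OF v] by simp
qed

end

locale radial_circle = radial_connection Sec nab I s p0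
  for Sec :: "('i \<Rightarrow> 'a::euclidean_space \<Rightarrow> real) set" and nab I s p0 +
  fixes \<theta> :: 'a
  assumes th: "\<theta> \<in> usphere" "\<theta> \<in> tangent p0"

sublocale radial_circle \<subseteq> great_circle_connection Sec nab I s p0 \<theta>
  by unfold_locales (use p0 th in auto)

section \<open>The curvature along one half circle\<close>

context radial_circle
begin

text \<open>Vectors orthogonal to the plane of the circle are tangent to the sphere along the whole
  circle and parallel there, so constant vectors serve as a parallel frame.\<close>

definition perp where "perp \<xi> \<longleftrightarrow> \<xi> \<bullet> p0 = 0 \<and> \<xi> \<bullet> \<theta> = 0"

lemma perpD: "perp \<xi> \<Longrightarrow> \<xi> \<bullet> p0 = 0" "perp \<xi> \<Longrightarrow> \<xi> \<bullet> \<theta> = 0" "perp \<xi> \<Longrightarrow> p0 \<bullet> \<xi> = 0" "perp \<xi> \<Longrightarrow> \<theta> \<bullet> \<xi> = 0"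
  "perp \<xi> \<Longrightarrow> \<xi> \<bullet> \<gamma> t = 0" "perp \<xi> \<Longrightarrow> \<xi> \<bullet> N (\<gamma> t) = 0"
  by (auto simp: perp_def inner_commute circle_inner N_circle inner_simps)

text \<open>Two extensions of the direction \<open>\<xi>\<close>: \<open>tfield \<xi>\<close> is
  parallel along the circle, whereas \<open>kfield \<theta> \<xi>\<close> commutes with
  \<open>\<beta>\<close> and restricts to a Jacobi field that vanishes at the poles.\<close>

lemma fields_circle:
  assumes "perp \<xi>"
  shows "tfield \<xi> (\<gamma> t) = \<xi>" "kfield \<theta> \<xi> (\<gamma> t) = sin t *\<^sub>R \<xi>"
  using perpD[OF assms] by (simp_all add: tfield_def kfield_def circle_inner)

lemma sin_pos: "0 < t \<Longrightarrow> t < pi \<Longrightarrow> sin t \<noteq> 0"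
  using sin_gt_zero by force

lemma sconn_N_N: "sconn N N (\<gamma> t) = 0"
proof -
  have "sconn N N (\<gamma> t) = - sin t *\<^sub>R tfield \<theta> (\<gamma> t) - cos t *\<^sub>R tfield p0 (\<gamma> t)"
    by (simp add: sconn_kfield N_inner)
  also have "\<dots> = (sin t * sin t + cos t * cos t) *\<^sub>R \<gamma> t - (cos t *\<^sub>R p0 + sin t *\<^sub>R \<theta>)"
    by (simp add: tfield_def circle_inner algebra_simps del: sin_cos_squared_add3)
  also have "sin t * sin t + cos t * cos t = 1" using sin_cos_squared_add3[of t] by linarith
  also have "1 *\<^sub>R \<gamma> t - (cos t *\<^sub>R p0 + sin t *\<^sub>R \<theta>) = 0" by (simp add: great_circle_def)
  finally show ?thesis .
qed

lemma sconn_N_tfield: "perp \<xi> \<Longrightarrow> sconn N (tfield \<xi>) (\<gamma> t) = 0"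
  by (simp add: sconn_tfield perpD)

text \<open>Along the circle \<open>\<beta>\<close> is \<open>sin t\<close> times \<open>N\<close>,
  and both slots are tensorial, so the hypothesis passes to \<open>N\<close> after division by
  \<open>(sin t)\<^sup>2\<close>.\<close>

lemma DR_N_N:
  assumes Z: "vfield Z" and v: "v \<in> Sec" and t: "0 < t" "t < pi"
  shows "DR N N Z v i (\<gamma> t) = 0"
proof -
  have "0 = DR \<beta> \<beta> Z v i (\<gamma> t)" using radial_DR[OF Z v circle] by simp
  also have "\<dots> = sin t * DR N \<beta> Z v i (\<gamma> t)"
    by (rule tens_pt1[OF tens_DR1]) (simp_all add: Z v radial_circle)
  also have "DR N \<beta> Z v i (\<gamma> t) = sin t * DR N N Z v i (\<gamma> t)"
    by (rule tens_pt1[OF tens_DR2]) (simp_all add: Z v radial_circle)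
  finally show ?thesis using sin_pos[OF t] by simp
qed

lemma cov_N_rho:
  assumes xi: "perp \<xi>" shows "null (cov N (Rm N (tfield \<xi>)))"
proof (rule nullI)
  fix v i t assume v: "v \<in> Sec" and t: "0 < t" "t < pi"
  have "Rm (sconn N N) (tfield \<xi>) v i (\<gamma> t) = 0"
    by (rule tens_pt0[OF tens_Rm1]) (simp_all add: v vfield_sconn sconn_N_N)
  moreover have "Rm N (sconn N (tfield \<xi>)) v i (\<gamma> t) = 0"
    by (rule tens_pt0[OF tens_Rm2]) (simp_all add: v vfield_sconn sconn_N_tfield[OF xi])
  ultimately show "cov N (Rm N (tfield \<xi>)) v i (\<gamma> t) = 0"
    using DR_N_N[OF vfield_t v t, of \<xi> i] by (simp add: DR_def)
qed

text \<open>Rotations that fix \<open>p0\<close> preserve the function of which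
  \<open>\<beta>\<close> is the gradient.\<close>

lemma sbracket_radial_kfield:
  assumes "a \<bullet> p0 = 0" "b \<bullet> p0 = 0" "p \<in> usphere"
  shows "sbracket \<beta> (kfield a b) p = 0"
  using assms(1,2)
  by (simp add: sbracket_def sconn_kfield[OF assms(3)] sconn_radial[OF assms(3)])
    (simp add: radial_def kfield_def tfield_def inner_simps inner_commute algebra_simps)

text \<open>The bracket is again the field of a rotation fixing \<open>p0\<close> and hence commutes
  with \<open>\<beta>\<close>, as \<open>cov_radial_cov_radial_Rm\<close> requires.\<close>

lemma sbracket_kfield:
  assumes xi: "perp \<xi>" and et: "perp \<eta>" and p: "p \<in> usphere"
  shows "sbracket (kfield \<theta> \<xi>) (kfield \<theta> \<eta>) p = kfield \<eta> \<xi> p"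
  using perpD[OF xi] perpD[OF et] inners
  by (simp add: sbracket_def sconn_kfield[OF p])
    (simp add: kfield_def tfield_def inner_simps inner_commute algebra_simps)

lemma Rm_radial_kfield:
  assumes v: "v \<in> Sec" and ze: "perp \<zeta>"
  shows "Rm \<beta> (kfield \<theta> \<zeta>) v i (\<gamma> t) = (sin t)\<^sup>2 * Rm N (tfield \<zeta>) v i (\<gamma> t)"
proof -
  have "Rm \<beta> (kfield \<theta> \<zeta>) v i (\<gamma> t) = sin t * Rm N (kfield \<theta> \<zeta>) v i (\<gamma> t)"
    by (rule tens_pt1[OF tens_Rm1]) (simp_all add: v radial_circle)
  also have "Rm N (kfield \<theta> \<zeta>) v i (\<gamma> t) = sin t * Rm N (tfield \<zeta>) v i (\<gamma> t)"
    by (rule tens_pt1[OF tens_Rm2]) (simp_all add: v fields_circle ze)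
  finally show ?thesis by (simp add: power2_eq_square)
qed

context
  fixes \<xi> \<eta> assumes xi: "perp \<xi>" and et: "perp \<eta>"
begin

abbreviation (input) "R0 \<equiv> Rm (tfield \<xi>) (tfield \<eta>)"
abbreviation (input) "\<kappa> \<equiv> comm (Rm N (tfield \<xi>)) (Rm N (tfield \<eta>))"
text \<open>On the circle this is the derivative of \<open>(sin t)^2 R0\<close> along
  \<open>N\<close>, divided by \<open>sin t\<close>. The global functions
  \<open>p0 \<bullet> q\<close> and \<open>\<theta> \<bullet> q\<close> restrict to
  \<open>cos t\<close> and \<open>sin t\<close>.\<close>

abbreviation (input) "M' \<equiv> (\<lambda>v. fs (\<lambda>q. 2 * (p0 \<bullet> q)) (R0 v) + fs (\<lambda>q. \<theta> \<bullet> q) (cov N R0 v))"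

lemma smooth_coeffs:
  "smooth_fun usphere (\<lambda>q. 2 * (p0 \<bullet> q))" "smooth_fun usphere (\<lambda>q. \<theta> \<bullet> q)" "smooth_fun usphere (\<lambda>q. (\<theta> \<bullet> q)\<^sup>2)"
  "smooth_fun usphere (\<lambda>q. 1 - p0 \<bullet> q)" "smooth_fun usphere (\<lambda>q. 1 + p0 \<bullet> q)"
  unfolding power2_eq_square
  by (intro smooth_fun_mult smooth_fun_const smooth_fun_inner_const smooth_fun_add smooth_fun_diff)+

lemma sderiv_coeffs:
  "sderiv (\<lambda>q. 2 * (p0 \<bullet> q)) (\<gamma> t) (N (\<gamma> t)) = - 2 * sin t"
  "sderiv (\<lambda>q. \<theta> \<bullet> q) (\<gamma> t) (N (\<gamma> t)) = cos t"
  "sderiv (\<lambda>q. (\<theta> \<bullet> q)\<^sup>2) (\<gamma> t) (N (\<gamma> t)) = 2 * sin t * cos t"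
  "sderiv (\<lambda>q. 1 - p0 \<bullet> q) (\<gamma> t) (N (\<gamma> t)) = sin t"
  "sderiv (\<lambda>q. 1 + p0 \<bullet> q) (\<gamma> t) (N (\<gamma> t)) = - sin t"
  by (rule trans[OF sderiv_eqI[OF _ circle vfield_tangent[OF vfield_N circle]]],
      (auto intro!: derivative_eq_intros)[], simp add: N_inner circle_inner)+

lemma endos: "endo R0" "endo \<kappa>" "endo M'" "endo (Rm N (tfield \<xi>))" "endo (Rm N (tfield \<eta>))" "endo (cov N R0)"
  using smooth_coeffs by simp_all

lemma null_cov_kappa: "null (cov N \<kappa>)"
proof (rule nullI)
  fix v i t assume v: "v \<in> Sec" and t: "0 < t" "t < pi"
  have "comm (cov N (Rm N (tfield \<xi>))) (Rm N (tfield \<eta>)) v i (\<gamma> t) = 0"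
    by (rule comm_pt0(1)) (simp_all add: v nullD[OF cov_N_rho[OF xi] _ t])
  moreover have "comm (Rm N (tfield \<xi>)) (cov N (Rm N (tfield \<eta>))) v i (\<gamma> t) = 0"
    by (rule comm_pt0(2)) (simp_all add: v nullD[OF cov_N_rho[OF et] _ t])
  ultimately show "cov N \<kappa> v i (\<gamma> t) = 0" using v by (simp add: cov_comm)
qed

text \<open>On the Killing fields the curvature is \<open>?F = (sin t)^2 R0\<close>, and its
  derivative along \<open>\<beta>\<close> is \<open>?G = (sin t)^2 M'\<close>. Inserted into
  \<open>cov_radial_cov_radial_Rm\<close>, the terms \<open>2 cos t (sin t)^2 M'\<close> on both
  sides cancel, and \<open>(sin t)^3\<close> can be divided out.\<close>

lemma cov_N_M':
  assumes v: "v \<in> Sec" and t: "0 < t" "t < pi"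
  shows "cov N M' v i (\<gamma> t) = 2 * sin t * \<kappa> v i (\<gamma> t)"
proof -
  let ?X = "kfield \<theta> \<xi>" and ?Y = "kfield \<theta> \<eta>"
  let ?F = "Rm ?X ?Y"
  let ?G = "cov \<beta> ?F"
  have F: "?F v i (\<gamma> t) = (sin t)\<^sup>2 * R0 v i (\<gamma> t)" if v: "v \<in> Sec" for v i t
  proof -
    have "?F v i (\<gamma> t) = sin t * Rm (tfield \<xi>) ?Y v i (\<gamma> t)"
      by (rule tens_pt1[OF tens_Rm1]) (simp_all add: v fields_circle xi)
    also have "Rm (tfield \<xi>) ?Y v i (\<gamma> t) = sin t * R0 v i (\<gamma> t)"
      by (rule tens_pt1[OF tens_Rm2]) (simp_all add: v fields_circle et)
    finally show ?thesis by (simp add: power2_eq_square)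
  qed
  have K: "comm (Rm \<beta> ?X) (Rm \<beta> ?Y) v i (\<gamma> t) = (sin t)\<^sup>2 * (sin t)\<^sup>2 * \<kappa> v i (\<gamma> t)"
    by (rule comm_pt_scale) (simp_all add: v Rm_radial_kfield xi et)
  have covF: "cov N ?F v i (\<gamma> t) = 2 * sin t * cos t * R0 v i (\<gamma> t) + (sin t)\<^sup>2 * cov N R0 v i (\<gamma> t)"
    if v: "v \<in> Sec" and t: "0 < t" "t < pi" for v i t
  proof -
    \<comment> \<open>The relation \<open>F\<close> concerns points of the circle only. Stated as
      the vanishing of a global endomorphism along the circle, it can be differentiated by
      \<open>null_cov\<close>.\<close>
    have "null (\<lambda>v. ?F v - fs (\<lambda>q. (\<theta> \<bullet> q)\<^sup>2) (R0 v))"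
      by (rule nullI) (simp add: F circle_inner)
    then have "null (cov N (\<lambda>v. ?F v - fs (\<lambda>q. (\<theta> \<bullet> q)\<^sup>2) (R0 v)))"
      by (rule null_cov[rotated]) (simp add: smooth_coeffs)
    from nullD[OF this v t, of i] show ?thesis
      using v by (simp add: cov_minus cov_fs smooth_coeffs sderiv_coeffs circle_inner)
  qed
  have beta: "cov \<beta> A v i (\<gamma> t) = sin t * cov N A v i (\<gamma> t)" if "endo A" "v \<in> Sec" for A v i t
    by (rule tens_pt1[OF tens_cov]) (simp_all add: that radial_circle)
  have G: "?G v i (\<gamma> t) = (sin t)\<^sup>2 * M' v i (\<gamma> t)" if v: "v \<in> Sec" and t: "0 < t" "t < pi" for v i t
    using beta[of ?F v i t] covF[OF v t] v by (simp add: circle_inner power2_eq_square algebra_simps)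
  have "null (\<lambda>v. ?G v - fs (\<lambda>q. (\<theta> \<bullet> q)\<^sup>2) (M' v))"
    by (rule nullI) (use G in \<open>simp add: circle_inner\<close>)
  then have "null (cov N (\<lambda>v. ?G v - fs (\<lambda>q. (\<theta> \<bullet> q)\<^sup>2) (M' v)))"
    by (rule null_cov[rotated]) (simp add: smooth_coeffs)
  from nullD[OF this v t, of i]
  have covG: "cov N ?G v i (\<gamma> t) = 2 * sin t * cos t * M' v i (\<gamma> t) + (sin t)\<^sup>2 * cov N M' v i (\<gamma> t)"
    using v endos by (simp add: cov_minus cov_fs[OF _ _ endos(3)] smooth_coeffs sderiv_coeffs circle_inner)
  have XY: "sbracket \<beta> (sbracket ?X ?Y) p = 0" if "p \<in> usphere" for p
  proof -
    have "sbracket \<beta> (sbracket ?X ?Y) p = sbracket \<beta> (kfield \<eta> \<xi>) p"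
      by (rule sbracket_cong[OF that]) (simp_all only: sbracket_kfield xi et)
    then show ?thesis using sbracket_radial_kfield[of \<eta> \<xi> p] perpD[OF xi] perpD[OF et] that by simp
  qed
  have "cov \<beta> ?G v i (\<gamma> t) = 2 * (p0 \<bullet> \<gamma> t) * ?G v i (\<gamma> t) + 2 * comm (Rm \<beta> ?X) (Rm \<beta> ?Y) v i (\<gamma> t)"
    by (rule cov_radial_cov_radial_Rm[OF _ _ v circle _ _ XY])
      (use perpD[OF xi] perpD[OF et] inners in \<open>simp_all add: sbracket_radial_kfield fields_circle xi et\<close>)
  then have "sin t * (2 * sin t * cos t * M' v i (\<gamma> t) + (sin t)\<^sup>2 * cov N M' v i (\<gamma> t))
    = 2 * cos t * ((sin t)\<^sup>2 * M' v i (\<gamma> t)) + 2 * ((sin t)\<^sup>2 * (sin t)\<^sup>2 * \<kappa> v i (\<gamma> t))"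
    unfolding K G[OF v t] covG[symmetric] circle_inner(1) using beta[of ?G v i t] v by simp
  then have "(sin t)^3 * cov N M' v i (\<gamma> t) = (sin t)^3 * (2 * sin t * \<kappa> v i (\<gamma> t))"
    by (simp only: power2_eq_square power3_eq_cube) (simp only: algebra_simps)
  then show ?thesis using sin_pos[OF t] by simp
qed

text \<open>\<open>1 - cos t\<close> and \<open>- (1 + cos t)\<close> are the antiderivatives of
  \<open>sin t\<close> that vanish at \<open>p0\<close> and at \<open>- p0\<close>. Hence all
  coefficients of \<open>?J\<close> vanish at \<open>p0\<close> and those of \<open>?J'\<close> at
  \<open>- p0\<close>, which gives the initial values for \<open>parallel_null\<close>.\<close>

lemma null_curvature_identity: "null (\<lambda>v. R0 v + \<kappa> v)"
proof -
  let ?S = "\<lambda>v. R0 v + \<kappa> v"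
  \<comment> \<open>The added term has derivative \<open>- 2 sin t \<kappa>\<close> along the
    circle, because \<open>\<kappa>\<close> is parallel; this cancels the right side of
    \<open>cov_N_M'\<close>.\<close>
  let ?M = "\<lambda>v. M' v + fs (\<lambda>q. 2 * (p0 \<bullet> q)) (\<kappa> v)"
  let ?J = "\<lambda>v. fs (\<lambda>q. (\<theta> \<bullet> q)\<^sup>2) (?S v) - fs (\<lambda>q. 1 - p0 \<bullet> q) (?M v)"
  let ?J' = "\<lambda>v. fs (\<lambda>q. (\<theta> \<bullet> q)\<^sup>2) (?S v) + fs (\<lambda>q. 1 + p0 \<bullet> q) (?M v)"
  note sm = smooth_coeffs and sd = sderiv_coeffs
  have e: "endo ?S" "endo ?M" "endo (\<lambda>v. fs (\<lambda>q. 2 * (p0 \<bullet> q)) (\<kappa> v))"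
    "endo (\<lambda>v. fs (\<lambda>q. (\<theta> \<bullet> q)\<^sup>2) (?S v))" "endo (\<lambda>v. fs (\<lambda>q. 1 - p0 \<bullet> q) (?M v))"
    "endo (\<lambda>v. fs (\<lambda>q. 1 + p0 \<bullet> q) (?M v))"
    by (intro endo_plus endo_fs sm endos)+
  have covM: "cov N ?M v i (\<gamma> t) = 0" if v: "v \<in> Sec" and t: "0 < t" "t < pi" for v i t
    using cov_plus[OF vfield_N endos(3) e(3) v, of i "\<gamma> t"] cov_N_M'[OF v t, of i]
      cov_fs[OF vfield_N sm(1) endos(2) v, of i "\<gamma> t"] nullD[OF null_cov_kappa v t, of i]
    by (simp add: sd)
  have covS: "cov N ?S v i (\<gamma> t) = cov N R0 v i (\<gamma> t)" if v: "v \<in> Sec" and t: "0 < t" "t < pi" for v i t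
    using cov_plus[OF vfield_N endos(1,2) v, of i "\<gamma> t"] nullD[OF null_cov_kappa v t, of i] by simp
  have "null (cov N ?J)"
  proof (rule nullI)
    fix v i t assume v: "v \<in> Sec" and t: "0 < t" "t < pi"
    show "cov N ?J v i (\<gamma> t) = 0"
      unfolding cov_minus[OF vfield_N e(4,5) v] cov_fs[OF vfield_N sm(3) e(1) v]
        cov_fs[OF vfield_N sm(4) e(2) v] covM[OF v t] covS[OF v t] sd
      by (simp add: circle_inner power2_eq_square algebra_simps)
  qed
  then have J: "null ?J"
    by (rule parallel_null[rotated]) (use endo_minus[OF e(4,5)] inners in auto)
  have "null (cov N ?J')"
  proof (rule nullI)
    fix v i t assume v: "v \<in> Sec" and t: "0 < t" "t < pi"
    show "cov N ?J' v i (\<gamma> t) = 0"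
      unfolding cov_plus[OF vfield_N e(4,6) v] cov_fs[OF vfield_N sm(3) e(1) v]
        cov_fs[OF vfield_N sm(5) e(2) v] covM[OF v t] covS[OF v t] sd
      by (simp add: circle_inner power2_eq_square algebra_simps)
  qed
  then have J': "null ?J'"
    by (rule parallel_null[rotated]) (use endo_plus[OF e(4,6)] inners in auto)
  show ?thesis
  proof (rule nullI)
    fix v i t assume v: "v \<in> Sec" and t: "0 < t" "t < pi"
    define x y where "x = ?S v i (\<gamma> t)" and "y = ?M v i (\<gamma> t)"
    have 1: "(sin t)\<^sup>2 * x = (1 - cos t) * y"
      using nullD[OF J v t, of i] unfolding x_def y_def by (simp add: circle_inner)
    have 2: "(sin t)\<^sup>2 * x = - (1 + cos t) * y"
      using nullD[OF J' v t, of i] unfolding x_def y_def by (simp add: circle_inner eq_neg_iff_add_eq_0 algebra_simps)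
    \<comment> \<open>Subtracting the two relations leaves \<open>2 * y = 0\<close>.\<close>
    have "y = 0" using 1 2 by (simp add: algebra_simps)
    then have "x = 0" using 1 sin_pos[OF t] by simp
    then show "?S v i (\<gamma> t) = 0" unfolding x_def .
  qed
qed

text \<open>The sum with the parallel \<open>\<kappa>\<close> vanishes, so \<open>R0\<close> is
  itself parallel.\<close>

lemma null_cov_N_Rm: "null (cov N R0)"
proof (rule nullI)
  fix v i t assume v: "v \<in> Sec" and t: "0 < t" "t < pi"
  show "cov N R0 v i (\<gamma> t) = 0"
    using cov_plus[OF vfield_N endos(1,2) v, of i "\<gamma> t"] nullD[OF null_cov_kappa v t, of i]
      nullD[OF null_cov[OF endo_plus[OF endos(1,2)] null_curvature_identity] v t, of i] by simp
qed

lemma DR_N_tfield: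
  assumes v: "v \<in> Sec" and t: "0 < t" "t < pi"
  shows "DR N (tfield \<xi>) (tfield \<eta>) v i (\<gamma> t) = 0"
proof -
  have "Rm (sconn N (tfield \<xi>)) (tfield \<eta>) v i (\<gamma> t) = 0"
    by (rule tens_pt0[OF tens_Rm1]) (simp_all add: v vfield_sconn sconn_N_tfield xi)
  moreover have "Rm (tfield \<xi>) (sconn N (tfield \<eta>)) v i (\<gamma> t) = 0"
    by (rule tens_pt0[OF tens_Rm2]) (simp_all add: v vfield_sconn sconn_N_tfield et)
  ultimately show ?thesis using nullD[OF null_cov_N_Rm v t, of i] by (simp add: DR_def)
qed

end

text \<open>The factor 1 in front of the second summand gives the decomposition the shape expected
  by \<open>tens_pt\<close>.\<close>

lemma tangent_decomp:
  assumes "y \<in> tangent (\<gamma> t)"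
  obtains a \<xi> where "perp \<xi>" "y = a *\<^sub>R N (\<gamma> t) + 1 *\<^sub>R tfield \<xi> (\<gamma> t)"
proof -
  define a where "a = y \<bullet> N (\<gamma> t)"
  define \<xi> where "\<xi> = y - a *\<^sub>R N (\<gamma> t)"
  have N0: "N (\<gamma> t) \<bullet> \<gamma> t = 0" using tangentD[OF vfield_tangent[OF vfield_N circle]] .
  have 1: "\<xi> \<bullet> \<gamma> t = 0" "\<xi> \<bullet> N (\<gamma> t) = 0"
    using tangentD[OF assms] N_norm[of t] N0 by (simp_all add: \<xi>_def a_def inner_simps)
  have sc: "cos t * cos t + sin t * sin t = 1" by simp
  have "cos t *\<^sub>R \<gamma> t - sin t *\<^sub>R N (\<gamma> t) = (cos t * cos t + sin t * sin t) *\<^sub>R p0"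
    unfolding N_circle unfolding great_circle_def by (simp add: algebra_simps del: sin_cos_squared_add3)
  then have p: "p0 = cos t *\<^sub>R \<gamma> t - sin t *\<^sub>R N (\<gamma> t)" by (simp add: sc)
  have "sin t *\<^sub>R \<gamma> t + cos t *\<^sub>R N (\<gamma> t) = (cos t * cos t + sin t * sin t) *\<^sub>R \<theta>"
    unfolding N_circle unfolding great_circle_def by (simp add: algebra_simps del: sin_cos_squared_add3)
  then have q: "\<theta> = sin t *\<^sub>R \<gamma> t + cos t *\<^sub>R N (\<gamma> t)" by (simp add: sc)
  \<comment> \<open>\<open>p0\<close> and \<open>\<theta>\<close> span the same plane as
    \<open>\<gamma> t\<close> and \<open>N (\<gamma> t)\<close>, to which \<open>\<xi>\<close> is
    orthogonal.\<close>
  have xi: "perp \<xi>"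
    unfolding perp_def by (subst p, subst (3) q) (use 1 in \<open>simp add: inner_simps\<close>)
  show thesis
    by (rule that[OF xi, of a]) (simp only: fields_circle(1)[OF xi], simp add: \<xi>_def)
qed

lemma DR_N_zero:
  assumes Y: "vfield Y" and W: "vfield W" and v: "v \<in> Sec" and t: "0 < t" "t < pi"
  shows "DR N Y W v i (\<gamma> t) = 0"
proof -
  obtain a \<xi> where xi: "perp \<xi>" "Y (\<gamma> t) = a *\<^sub>R N (\<gamma> t) + 1 *\<^sub>R tfield \<xi> (\<gamma> t)"
    by (rule tangent_decomp[OF vfield_tangent[OF Y circle]])
  obtain b \<eta> where et: "perp \<eta>" "W (\<gamma> t) = b *\<^sub>R N (\<gamma> t) + 1 *\<^sub>R tfield \<eta> (\<gamma> t)"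
    by (rule tangent_decomp[OF vfield_tangent[OF W circle]])
  have "DR N Y W v i (\<gamma> t) = a * DR N N W v i (\<gamma> t) + 1 * DR N (tfield \<xi>) W v i (\<gamma> t)"
    by (rule tens_pt[OF tens_DR2[OF vfield_N W v] Y vfield_N vfield_t circle xi(2)])
  also have "DR N (tfield \<xi>) W v i (\<gamma> t) = b * DR N (tfield \<xi>) N v i (\<gamma> t) + 1 * DR N (tfield \<xi>) (tfield \<eta>) v i (\<gamma> t)"
    by (rule tens_pt[OF tens_DR3[OF vfield_N vfield_t v] W vfield_N vfield_t circle et(2)])
  also have "DR N (tfield \<xi>) N v i (\<gamma> t) = 0"
    using DR_skew[OF vfield_N vfield_N vfield_t v, of \<xi>] DR_N_N[OF vfield_t v t, of \<xi> i] by simp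
  finally show ?thesis using DR_N_N[OF W v t] DR_N_tfield[OF xi(1) et(1) v t] by simp
qed

end

section \<open>Bracket relations of the curvature at the pole\<close>

context coord_connection
begin

lemma comm_jacobi:
  assumes A: "endo A" and B: "endo B" and C: "endo C" and v: "v \<in> Sec"
  shows "comm A (comm B C) v i p = comm (comm A B) C v i p + comm B (comm A C) v i p"
  unfolding comm_def using A B C v by (simp add: endo_diff[OF A] endo_diff[OF B] endo_diff[OF C])

lemma comm_lincomb_right:
  assumes A: "endo A" and B: "endo B" "endo B1" "endo B2" "endo B3" and v: "v \<in> Sec"
    and eq: "\<And>v i. v \<in> Sec \<Longrightarrow> B v i p = a * B1 v i p + b * B2 v i p + c * B3 v i p"
  shows "comm A B v i p = a * comm A B1 v i p + b * comm A B2 v i p + c * comm A B3 v i p"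
proof -
  let ?w = "fs (\<lambda>_. b) (B2 v) + fs (\<lambda>_. c) (B3 v)"
  have sec: "B v \<in> Sec" "B1 v \<in> Sec" "B2 v \<in> Sec" "B3 v \<in> Sec" "?w \<in> Sec"
    using B v by (simp_all add: smooth_fun_const)
  have "A (B v) i p = a * A (B1 v) i p + 1 * A ?w i p"
    by (rule endo_pointwise_lincomb[OF A sec(1,2,5)]) (simp add: eq[OF v])
  also have "A ?w i p = b * A (B2 v) i p + c * A (B3 v) i p"
    by (rule endo_pointwise_lincomb[OF A sec(5,3,4)]) simp
  finally have "A (B v) i p = a * A (B1 v) i p + b * A (B2 v) i p + c * A (B3 v) i p"
    by simp
  then show ?thesis using eq[OF endo_sec[OF A v], of i] by (simp add: comm_def algebra_simps)
qed

end

lemma polar_coordinates: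
  fixes p p0 :: "'a::euclidean_space"
  assumes p0: "p0 \<in> usphere" and p: "p \<in> usphere" and ne: "p \<noteq> p0" "p \<noteq> - p0"
  obtains \<theta> t where "\<theta> \<in> usphere" "\<theta> \<in> tangent p0" "0 < t" "t < pi" "p = great_circle p0 \<theta> t"
proof -
  have n: "p0 \<bullet> p0 = 1" "p \<bullet> p = 1" using p0 p by (simp_all add: norm_eq_1)
  define c where "c = p0 \<bullet> p"
  have "(p - p0) \<bullet> (p - p0) > 0" "(p + p0) \<bullet> (p + p0) > 0"
    using ne by (auto simp: eq_neg_iff_add_eq_0)
  then have c: "- 1 < c" "c < 1" using n by (simp_all add: c_def inner_simps inner_commute)
  define t where "t = arccos c"
  have t: "cos t = c" "0 < t" "t < pi"
    using c arccos_lt_bounded[of c] by (simp_all add: t_def cos_arccos)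
  have s: "sin t > 0" using t sin_gt_zero by blast
  define \<theta> where "\<theta> = (1 / sin t) *\<^sub>R (p - c *\<^sub>R p0)"
  have "(p - c *\<^sub>R p0) \<bullet> (p - c *\<^sub>R p0) = 1 - c * c"
    using n by (simp add: inner_simps c_def inner_commute)
  also have "\<dots> = sin t * sin t" using sin_cos_squared_add3[of t] t(1) by simp
  finally have "\<theta> \<bullet> \<theta> = 1" using s by (simp add: \<theta>_def)
  then have "\<theta> \<in> usphere" by (simp add: norm_eq_1)
  moreover have "\<theta> \<in> tangent p0" using n by (simp add: \<theta>_def tangent_def inner_simps c_def inner_commute)
  moreover have "p = great_circle p0 \<theta> t" using s t by (simp add: great_circle_def \<theta>_def)
  ultimately show thesis using that t by blast
qed

context radial_connection
begin

lemma radial_circleI: "\<theta> \<in> usphere \<Longrightarrow> \<theta> \<in> tangent p0 \<Longrightarrow> radial_circle Sec nab I s p0 \<theta>"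
  by unfold_locales auto

lemma radial_poles: "radial p0 p0 = 0" "radial p0 (- p0) = 0"
  using usphere_inner[OF p0] by (simp_all add: radial_def)

lemma DR_radial_zero:
  assumes Y: "vfield Y" and W: "vfield W" and v: "v \<in> Sec" and p: "p \<in> usphere"
  shows "DR \<beta> Y W v i p = 0"
proof (cases "p = p0 \<or> p = - p0")
  case True
  then show ?thesis
    by (intro tens_pt0[OF tens_DR1[OF Y W v] vfield_radial p]) (auto simp: radial_poles)
next
  case False
  then obtain \<theta> t where th: "\<theta> \<in> usphere" "\<theta> \<in> tangent p0" and t: "0 < t" "t < pi" and pt: "p = great_circle p0 \<theta> t"
    using polar_coordinates[OF p0 p] by blast
  interpret radial_circle Sec nab I s p0 \<theta> by (rule radial_circleI[OF th])
  have "DR \<beta> Y W v i p = sin t * DR N Y W v i p"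
    unfolding pt by (rule tens_pt1[OF tens_DR1[OF Y W v]]) (simp_all add: radial_circle)
  then show ?thesis using DR_N_zero[OF Y W v t] pt by simp
qed

abbreviation (input) Q where "Q a b \<equiv> Rm (tfield a) (tfield b)"

lemma Q_endo [simp]: "endo (Q a b)"
  by (simp add: vfield_tfield)

lemma Q_skew: "v \<in> Sec \<Longrightarrow> Q b a v i p = - Q a b v i p"
  using Rm_skew[OF vfield_tfield vfield_tfield, of v a b] by simp

lemma Q_self: "v \<in> Sec \<Longrightarrow> Q a a v i p = 0"
  using Q_skew[of v a a i p] by simp

lemma tfield_pole: "a \<bullet> p0 = 0 \<Longrightarrow> tfield a p0 = a"
  by (simp add: tfield_def)

lemma Q_pole_lincomb:
  assumes v: "v \<in> Sec" and perp: "a1 \<bullet> p0 = 0" "a2 \<bullet> p0 = 0"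
  shows "Q (x *\<^sub>R a1 + y *\<^sub>R a2) b v i p0 = x * Q a1 b v i p0 + y * Q a2 b v i p0"
    "Q b (x *\<^sub>R a1 + y *\<^sub>R a2) v i p0 = x * Q b a1 v i p0 + y * Q b a2 v i p0"
proof -
  have eq: "tfield (x *\<^sub>R a1 + y *\<^sub>R a2) p0 = x *\<^sub>R tfield a1 p0 + y *\<^sub>R tfield a2 p0"
    using perp by (simp add: tfield_pole inner_simps)
  show "Q (x *\<^sub>R a1 + y *\<^sub>R a2) b v i p0 = x * Q a1 b v i p0 + y * Q a2 b v i p0"
    by (rule tens_pt[OF tens_Rm1]) (use p0 eq v in \<open>simp_all add: vfield_tfield\<close>)
  show "Q b (x *\<^sub>R a1 + y *\<^sub>R a2) v i p0 = x * Q b a1 v i p0 + y * Q b a2 v i p0"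
    by (rule tens_pt[OF tens_Rm2]) (use p0 eq v in \<open>simp_all add: vfield_tfield\<close>)
qed

text \<open>The curvature identity along the circle with initial velocity \<open>\<theta>\<close>,
  in the limit at \<open>p0\<close>, where \<open>N\<close> equals \<open>\<theta>\<close>. The
  circle disappears from the statement, so the pivot \<open>\<theta>\<close> can be varied
  afterwards.\<close>

lemma Q_pivot:
  assumes th: "\<theta> \<bullet> \<theta> = 1" "\<theta> \<bullet> p0 = 0" and xi: "\<xi> \<bullet> p0 = 0" "\<xi> \<bullet> \<theta> = 0" and et: "\<eta> \<bullet> p0 = 0" "\<eta> \<bullet> \<theta> = 0"
    and v: "v \<in> Sec"
  shows "comm (Q \<theta> \<xi>) (Q \<theta> \<eta>) v i p0 = - Q \<xi> \<eta> v i p0"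
proof -
  have th': "\<theta> \<in> usphere" "\<theta> \<in> tangent p0" using th by (auto simp: norm_eq_1 tangent_def)
  have pole: "tfield \<theta> p0 = \<theta>" by (rule tfield_pole[OF th(2)])
  interpret radial_circle Sec nab I s p0 \<theta> by (rule radial_circleI[OF th'])
  have pp: "perp \<xi>" "perp \<eta>" using xi et by (auto simp: perp_def)
  have "Rm N (tfield \<zeta>) v i p0 = 1 * Q \<theta> \<zeta> v i p0" if "v \<in> Sec" for v i \<zeta>
    by (rule tens_pt1[OF tens_Rm1]) (use that N_circle[of 0] p0 in \<open>simp_all add: circle_ends pole\<close>)
  then have "comm (Rm N (tfield \<xi>)) (Rm N (tfield \<eta>)) v i p0 = 1 * 1 * comm (Q \<theta> \<xi>) (Q \<theta> \<eta>) v i p0"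
    by (intro comm_pt_scale) (simp_all add: v)
  moreover have "Q \<xi> \<eta> v i p0 + comm (Rm N (tfield \<xi>)) (Rm N (tfield \<eta>)) v i p0 = 0"
    using null_ends(1)[OF _ null_curvature_identity[OF pp] v, of i] by simp
  ultimately show ?thesis by simp
qed

text \<open>Expanding the second entry of the commutator with either of the two pivots gives opposite
  results.\<close>

lemma Q_comm_orthogonal:
  assumes th: "\<theta> \<bullet> \<theta> = 1" "\<theta> \<bullet> p0 = 0" and xi: "\<xi> \<bullet> \<xi> = 1" "\<xi> \<bullet> p0 = 0" and orth: "\<xi> \<bullet> \<theta> = 0"
    and et: "\<eta> \<bullet> p0 = 0" "\<eta> \<bullet> \<theta> = 0" "\<eta> \<bullet> \<xi> = 0" and ze: "\<zeta> \<bullet> p0 = 0" "\<zeta> \<bullet> \<theta> = 0" "\<zeta> \<bullet> \<xi> = 0"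
    and v: "v \<in> Sec"
  shows "comm (Q \<theta> \<xi>) (Q \<eta> \<zeta>) v i p0 = 0"
proof -
  \<comment> \<open>\<open>Q \<eta> \<zeta>\<close> is replaced by
    \<open>- comm (Q \<theta> \<eta>) (Q \<theta> \<zeta>)\<close>; after the Jacobi identity each
    inner commutator is again a pivot relation. The right side is symmetric in
    \<open>\<theta>\<close> and \<open>\<xi>\<close>, the left side skew.\<close>
  have half: "comm (Q \<theta> \<xi>) (Q \<eta> \<zeta>) v i p0 = comm (Q \<xi> \<eta>) (Q \<theta> \<zeta>) v i p0 + comm (Q \<theta> \<eta>) (Q \<xi> \<zeta>) v i p0"
    if th: "\<theta> \<bullet> \<theta> = 1" "\<theta> \<bullet> p0 = 0" and xi: "\<xi> \<bullet> p0 = 0" "\<xi> \<bullet> \<theta> = 0"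
      and et: "\<eta> \<bullet> p0 = 0" "\<eta> \<bullet> \<theta> = 0" and ze: "\<zeta> \<bullet> p0 = 0" "\<zeta> \<bullet> \<theta> = 0" for \<theta> \<xi>
  proof -
    have "comm (Q \<theta> \<xi>) (Q \<eta> \<zeta>) v i p0 = 1 * (-1) * comm (Q \<theta> \<xi>) (comm (Q \<theta> \<eta>) (Q \<theta> \<zeta>)) v i p0"
      by (rule comm_pt_scale) (simp_all add: v Q_pivot[OF th et ze])
    also have "comm (Q \<theta> \<xi>) (comm (Q \<theta> \<eta>) (Q \<theta> \<zeta>)) v i p0
      = comm (comm (Q \<theta> \<xi>) (Q \<theta> \<eta>)) (Q \<theta> \<zeta>) v i p0 + comm (Q \<theta> \<eta>) (comm (Q \<theta> \<xi>) (Q \<theta> \<zeta>)) v i p0"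
      by (rule comm_jacobi) (simp_all add: v)
    also have "comm (comm (Q \<theta> \<xi>) (Q \<theta> \<eta>)) (Q \<theta> \<zeta>) v i p0 = (-1) * 1 * comm (Q \<xi> \<eta>) (Q \<theta> \<zeta>) v i p0"
      by (rule comm_pt_scale) (simp_all add: v Q_pivot[OF th xi et])
    also have "comm (Q \<theta> \<eta>) (comm (Q \<theta> \<xi>) (Q \<theta> \<zeta>)) v i p0 = 1 * (-1) * comm (Q \<theta> \<eta>) (Q \<xi> \<zeta>) v i p0"
      by (rule comm_pt_scale) (simp_all add: v Q_pivot[OF th xi ze])
    finally show ?thesis by simp
  qed
  have "comm (Q \<xi> \<theta>) (Q \<eta> \<zeta>) v i p0 = (-1) * 1 * comm (Q \<theta> \<xi>) (Q \<eta> \<zeta>) v i p0"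
    by (rule comm_pt_scale) (simp_all add: v Q_skew[of _ \<xi> \<theta>])
  moreover have "comm (Q \<xi> \<theta>) (Q \<eta> \<zeta>) v i p0 = comm (Q \<theta> \<eta>) (Q \<xi> \<zeta>) v i p0 + comm (Q \<xi> \<eta>) (Q \<theta> \<zeta>) v i p0"
    by (rule half) (use assms in \<open>simp_all add: inner_commute\<close>)
  ultimately show ?thesis using half[OF th xi(2) orth et(1,2) ze(1,2)] by simp
qed

text \<open>\<open>\<eta>\<close> and \<open>\<zeta>\<close> are split along \<open>\<xi>\<close>.
  The parts orthogonal to \<open>\<xi>\<close> contribute nothing by
  \<open>Q_comm_orthogonal\<close>, the mixed parts are relations with \<open>\<xi>\<close> as
  pivot, and \<open>Q \<xi> \<xi>\<close> vanishes.\<close>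

lemma Q_comm_unit:
  assumes th: "\<theta> \<bullet> \<theta> = 1" "\<theta> \<bullet> p0 = 0" and xi: "\<xi> \<bullet> \<xi> = 1" "\<xi> \<bullet> p0 = 0" and orth: "\<xi> \<bullet> \<theta> = 0"
    and et: "\<eta> \<bullet> p0 = 0" "\<eta> \<bullet> \<theta> = 0" and ze: "\<zeta> \<bullet> p0 = 0" "\<zeta> \<bullet> \<theta> = 0"
    and v: "v \<in> Sec"
  shows "comm (Q \<theta> \<xi>) (Q \<eta> \<zeta>) v i p0 = (\<xi> \<bullet> \<eta>) * Q \<theta> \<zeta> v i p0 - (\<xi> \<bullet> \<zeta>) * Q \<theta> \<eta> v i p0"
proof -
  define x y where "x = \<xi> \<bullet> \<eta>" and "y = \<xi> \<bullet> \<zeta>"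
  define e z where "e = \<eta> - x *\<^sub>R \<xi>" and "z = \<zeta> - y *\<^sub>R \<xi>"
  have e: "e \<bullet> p0 = 0" "e \<bullet> \<theta> = 0" "e \<bullet> \<xi> = 0" and z: "z \<bullet> p0 = 0" "z \<bullet> \<theta> = 0" "z \<bullet> \<xi> = 0"
    using assms by (simp_all add: e_def z_def x_def y_def inner_simps inner_commute)
  have eta: "\<eta> = 1 *\<^sub>R e + x *\<^sub>R \<xi>" and zeta: "\<zeta> = 1 *\<^sub>R z + y *\<^sub>R \<xi>" by (simp_all add: e_def z_def)
  have orth': "\<theta> \<bullet> \<xi> = 0" using orth by (simp add: inner_commute)
  have "Q \<eta> \<zeta> v i p0 = 1 * Q e z v i p0 + y * Q e \<xi> v i p0 + x * Q \<xi> z v i p0" if v: "v \<in> Sec" for v i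
    unfolding eta zeta Q_pole_lincomb(1)[OF v e(1) xi(2)] Q_pole_lincomb(2)[OF v z(1) xi(2)] Q_self[OF v]
    by (simp add: algebra_simps)
  from comm_lincomb_right[OF Q_endo Q_endo Q_endo Q_endo Q_endo v this]
  have "comm (Q \<theta> \<xi>) (Q \<eta> \<zeta>) v i p0
    = comm (Q \<theta> \<xi>) (Q e z) v i p0 + y * comm (Q \<theta> \<xi>) (Q e \<xi>) v i p0 + x * comm (Q \<theta> \<xi>) (Q \<xi> z) v i p0"
    by simp
  also have "comm (Q \<theta> \<xi>) (Q e z) v i p0 = 0"
    by (rule Q_comm_orthogonal[OF th xi orth e z v])
  also have "comm (Q \<theta> \<xi>) (Q e \<xi>) v i p0 = (-1) * (-1) * comm (Q \<xi> \<theta>) (Q \<xi> e) v i p0"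
    by (rule comm_pt_scale) (simp_all add: v Q_skew[of _ \<xi> \<theta>] Q_skew[of _ e \<xi>])
  also have "comm (Q \<xi> \<theta>) (Q \<xi> e) v i p0 = - Q \<theta> e v i p0"
    by (rule Q_pivot[OF xi th(2) orth' e(1,3) v])
  also have "comm (Q \<theta> \<xi>) (Q \<xi> z) v i p0 = (-1) * 1 * comm (Q \<xi> \<theta>) (Q \<xi> z) v i p0"
    by (rule comm_pt_scale) (simp_all add: v Q_skew[of _ \<xi> \<theta>])
  also have "comm (Q \<xi> \<theta>) (Q \<xi> z) v i p0 = - Q \<theta> z v i p0"
    by (rule Q_pivot[OF xi th(2) orth' z(1,3) v])
  finally have "comm (Q \<theta> \<xi>) (Q \<eta> \<zeta>) v i p0 = x * Q \<theta> z v i p0 - y * Q \<theta> e v i p0" by simp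
  moreover have "Q \<theta> \<zeta> v i p0 = Q \<theta> z v i p0 + y * Q \<theta> \<xi> v i p0"
    unfolding zeta by (simp only: Q_pole_lincomb(2)[OF v z(1) xi(2)] mult_1_left)
  moreover have "Q \<theta> \<eta> v i p0 = Q \<theta> e v i p0 + x * Q \<theta> \<xi> v i p0"
    unfolding eta by (simp only: Q_pole_lincomb(2)[OF v e(1) xi(2)] mult_1_left)
  ultimately show ?thesis unfolding x_def[symmetric] y_def[symmetric] by (simp add: algebra_simps)
qed

lemma Q_comm:
  assumes th: "\<theta> \<bullet> \<theta> = 1" "\<theta> \<bullet> p0 = 0" and xi: "\<xi> \<bullet> p0 = 0" "\<xi> \<bullet> \<theta> = 0"
    and et: "\<eta> \<bullet> p0 = 0" "\<eta> \<bullet> \<theta> = 0" and ze: "\<zeta> \<bullet> p0 = 0" "\<zeta> \<bullet> \<theta> = 0"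
    and v: "v \<in> Sec"
  shows "comm (Q \<theta> \<xi>) (Q \<eta> \<zeta>) v i p0 = (\<xi> \<bullet> \<eta>) * Q \<theta> \<zeta> v i p0 - (\<xi> \<bullet> \<zeta>) * Q \<theta> \<eta> v i p0"
proof -
  \<comment> \<open>For \<open>\<xi> = 0\<close> the choice is \<open>u = 0\<close>, and unit length
    is claimed only otherwise.\<close>
  obtain u where u: "u \<bullet> p0 = 0" "u \<bullet> \<theta> = 0" "\<xi> = norm \<xi> *\<^sub>R u" "norm \<xi> = 0 \<or> u \<bullet> u = 1"
  proof (cases "\<xi> = 0")
    case True
    then show ?thesis using that[of 0] by simp
  next
    case False
    then show ?thesis using that[of "\<xi> /\<^sub>R norm \<xi>"] xi by (simp add: dot_square_norm power2_eq_square)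
  qed
  have "Q \<theta> \<xi> v i p0 = norm \<xi> * Q \<theta> u v i p0" if "v \<in> Sec" for v i
    using Q_pole_lincomb(2)[OF that u(1,1), of \<theta> "norm \<xi>" 0] u(3) by simp
  then have eq: "comm (Q \<theta> \<xi>) (Q \<eta> \<zeta>) v i p0 = norm \<xi> * 1 * comm (Q \<theta> u) (Q \<eta> \<zeta>) v i p0"
    by (intro comm_pt_scale) (simp_all add: v)
  have inner: "\<xi> \<bullet> w = norm \<xi> * (u \<bullet> w)" for w using u(3) by (metis inner_scaleR_left)
  show ?thesis
  proof (cases "norm \<xi> = 0")
    case True
    then show ?thesis using eq by simp
  next
    case False
    then have "u \<bullet> u = 1" using u(4) by simp
    from Q_comm_unit[OF th this u(1,2) et ze v, of i] show ?thesis
      unfolding eq inner by (simp only: right_diff_distrib mult.assoc mult_1_right mult_1_left)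
  qed
qed

lemma cov_radial_Rm_general:
  assumes Y: "vfield Y" and W: "vfield W" and v: "v \<in> Sec"
  shows "cov \<beta> (Rm Y W) v = Rm (sconn \<beta> Y) W v + Rm Y (sconn \<beta> W) v"
proof (rule sec_eqI)
  note B = vfield_radial[of p0]
  show "cov \<beta> (Rm Y W) v \<in> Sec" by (rule endo_sec[OF endo_cov[OF B endo_Rm[OF Y W]] v])
  show "Rm (sconn \<beta> Y) W v + Rm Y (sconn \<beta> W) v \<in> Sec"
    by (intro sec_add endo_sec[OF endo_Rm v] vfield_sconn B Y W)
  fix i and p :: 'a assume "p \<in> usphere"
  from DR_radial_zero[OF Y W v this, of i]
  show "cov \<beta> (Rm Y W) v i p = (Rm (sconn \<beta> Y) W v + Rm Y (sconn \<beta> W) v) i p" by (simp add: DR_def)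
qed

text \<open>The curvature of the round sphere applied to \<open>\<beta>\<close>, \<open>X\<close>
  and \<open>Y\<close>, in the sign convention of \<open>sphere_curvature\<close>.\<close>

definition round_curv :: "('a \<Rightarrow> 'a) \<Rightarrow> ('a \<Rightarrow> 'a) \<Rightarrow> 'a \<Rightarrow> 'a"
  where "round_curv X Y q = (X q \<bullet> Y q) *\<^sub>R \<beta> q - (\<beta> q \<bullet> Y q) *\<^sub>R X q"

lemma vfield_round_curv: "vfield X \<Longrightarrow> vfield Y \<Longrightarrow> vfield (round_curv X Y)"
  unfolding round_curv_def[abs_def]
  by (intro vfield_diff vfield_scale smooth_fun_inner vfield_smooth vfield_radial)

text \<open>Exchanging the derivatives along \<open>\<beta>\<close> and \<open>X\<close> produces
  the curvature of the bundle, acting by commutator, and that of the sphere, acting on the slots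
  \<open>Y\<close> and \<open>W\<close>. The first three terms are the obstruction to
  \<open>DR X Y W\<close> being parallel; the last two vanish where \<open>Y\<close> and
  \<open>W\<close> are parallel in the direction \<open>\<beta>\<close>.\<close>

lemma cov_radial_DR:
  assumes X: "vfield X" and Y: "vfield Y" and W: "vfield W" and v: "v \<in> Sec" and p: "p \<in> usphere"
    and BX: "\<And>p. p \<in> usphere \<Longrightarrow> sbracket \<beta> X p = 0"
  shows "cov \<beta> (DR X Y W) v i p = comm (Rm \<beta> X) (Rm Y W) v i p
    - Rm (round_curv X Y) W v i p - Rm Y (round_curv X W) v i p
    + DR X (sconn \<beta> Y) W v i p + DR X Y (sconn \<beta> W) v i p"
proof -
  note B = vfield_radial[of p0]
  note vf = B X Y W vfield_sconn
  have K: "sconn \<beta> (sconn X Y) p = 1 *\<^sub>R sconn X (sconn \<beta> Y) p + 1 *\<^sub>R round_curv X Y p" if Y: "vfield Y" for Y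
  proof -
    have "sconn (sbracket \<beta> X) Y p = 0"
      using sconn_scale_left[OF p Y, of "sbracket \<beta> X" 0 X] BX[OF p] by simp
    then show ?thesis using sphere_curvature[OF p B X Y] by (simp add: round_curv_def algebra_simps)
  qed
  have R1: "Rm (sconn \<beta> (sconn X Y)) W v i p = 1 * Rm (sconn X (sconn \<beta> Y)) W v i p + 1 * Rm (round_curv X Y) W v i p"
    by (rule tens_pt[OF tens_Rm1[OF W v]]) (use p in \<open>simp_all add: K[OF Y] vf vfield_round_curv\<close>)
  have R2: "Rm Y (sconn \<beta> (sconn X W)) v i p = 1 * Rm Y (sconn X (sconn \<beta> W)) v i p + 1 * Rm Y (round_curv X W) v i p"
    by (rule tens_pt[OF tens_Rm2[OF Y v]]) (use p in \<open>simp_all add: K[OF W] vf vfield_round_curv\<close>)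
  have "cov X (cov \<beta> (Rm Y W)) v = cov X (\<lambda>v. Rm (sconn \<beta> Y) W v + Rm Y (sconn \<beta> W) v) v"
    by (rule cov_cong[OF X v cov_radial_Rm_general[OF Y W]])
  then have 1: "cov X (cov \<beta> (Rm Y W)) v i p
    = cov X (Rm (sconn \<beta> Y) W) v i p + cov X (Rm Y (sconn \<beta> W)) v i p"
    using cov_plus[OF X, of "Rm (sconn \<beta> Y) W" "Rm Y (sconn \<beta> W)" v i p] v by (simp add: vf)
  have e: "endo (cov X (Rm Y W))" "endo (Rm (sconn X Y) W)" "endo (Rm Y (sconn X W))"
    by (simp_all add: vf)
  have "cov \<beta> (DR X Y W) v i p = cov \<beta> (cov X (Rm Y W)) v i p - cov \<beta> (Rm (sconn X Y) W) v i p
      - cov \<beta> (Rm Y (sconn X W)) v i p"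
    unfolding DR_def cov_minus[OF B endo_minus[OF e(1,2)] e(3) v] cov_minus[OF B e(1,2) v] ..
  also have "\<dots> = cov X (Rm (sconn \<beta> Y) W) v i p + cov X (Rm Y (sconn \<beta> W)) v i p
      + comm (Rm \<beta> X) (Rm Y W) v i p
      - (Rm (sconn \<beta> (sconn X Y)) W v i p + Rm (sconn X Y) (sconn \<beta> W) v i p)
      - (Rm (sconn \<beta> Y) (sconn X W) v i p + Rm Y (sconn \<beta> (sconn X W)) v i p)"
    using cov_cov_commuting[OF B X v endo_Rm[OF Y W] BX, of i p] 1
      cov_radial_Rm_general[OF vfield_sconn[OF X Y] W v] cov_radial_Rm_general[OF Y vfield_sconn[OF X W] v]
    by simp
  finally show ?thesis unfolding R1 R2 DR_def by simp
qed

end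

section \<open>The remaining components of the derivative of the curvature\<close>

context radial_circle
begin

text \<open>All operators involved are parallel along the circle and the coefficients are constant;
  at \<open>p0\<close> the expression vanishes by \<open>Q_comm\<close>, so the bracket relation is
  transported from the pole.\<close>

lemma comm_rho_null:
  assumes xi: "perp \<xi>" and et: "perp \<eta>" and ze: "perp \<zeta>"
  shows "null (\<lambda>v. comm (Rm N (tfield \<xi>)) (Q \<eta> \<zeta>) v - fs (\<lambda>_. \<xi> \<bullet> \<eta>) (Rm N (tfield \<zeta>) v)
    + fs (\<lambda>_. \<xi> \<bullet> \<zeta>) (Rm N (tfield \<eta>) v))" (is "null ?C")
proof (rule parallel_null)
  let ?A = "comm (Rm N (tfield \<xi>)) (Q \<eta> \<zeta>)" and ?B = "\<lambda>v. fs (\<lambda>_. \<xi> \<bullet> \<eta>) (Rm N (tfield \<zeta>) v)"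
    and ?D = "\<lambda>v. fs (\<lambda>_. \<xi> \<bullet> \<zeta>) (Rm N (tfield \<eta>) v)"
  have e: "endo ?A" "endo ?B" "endo ?D" by (simp_all add: smooth_fun_const)
  show "endo ?C" by (intro endo_plus endo_minus e)
  show "null (cov N ?C)"
  proof (rule nullI)
    fix v i t assume v: "v \<in> Sec" and t: "0 < t" "t < pi"
    have "comm (cov N (Rm N (tfield \<xi>))) (Q \<eta> \<zeta>) v i (\<gamma> t) = 0"
      by (rule comm_pt0(1)) (simp_all add: v nullD[OF cov_N_rho[OF xi] _ t])
    moreover have "comm (Rm N (tfield \<xi>)) (cov N (Q \<eta> \<zeta>)) v i (\<gamma> t) = 0"
      by (rule comm_pt0(2)) (simp_all add: v nullD[OF null_cov_N_Rm[OF et ze] _ t])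
    ultimately have "cov N ?A v i (\<gamma> t) = 0" using v by (simp add: cov_comm)
    moreover have "cov N ?B v i (\<gamma> t) = 0" "cov N ?D v i (\<gamma> t) = 0"
      using v nullD[OF cov_N_rho[OF ze] v t] nullD[OF cov_N_rho[OF et] v t]
      by (simp_all add: cov_fs smooth_fun_const sderiv_const vfield_tangent)
    ultimately show "cov N ?C v i (\<gamma> t) = 0"
      using cov_plus[OF vfield_N endo_minus[OF e(1,2)] e(3) v] cov_minus[OF vfield_N e(1,2) v] by simp
  qed
  have "?C v i p0 = 0" if v: "v \<in> Sec" for v i
  proof -
    have r: "Rm N (tfield \<zeta>) v i p0 = 1 * Q \<theta> \<zeta> v i p0" if "v \<in> Sec" for v i \<zeta>
      by (rule tens_pt1[OF tens_Rm1])
        (use that N_circle[of 0] p0 inners in \<open>simp_all add: circle_ends tfield_pole\<close>)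
    have "comm (Rm N (tfield \<xi>)) (Q \<eta> \<zeta>) v i p0 = 1 * 1 * comm (Q \<theta> \<xi>) (Q \<eta> \<zeta>) v i p0"
      by (rule comm_pt_scale) (simp_all add: v r)
    then show ?thesis
      using Q_comm[OF inners(2,3) perpD(1,2)[OF xi] perpD(1,2)[OF et] perpD(1,2)[OF ze] v, of i] r[OF v] by simp
  qed
  then show "(\<forall>v\<in>Sec. \<forall>i. ?C v i p0 = 0) \<or> (\<forall>v\<in>Sec. \<forall>i. ?C v i (- p0) = 0)" by blast
qed

text \<open>The field \<open>kfield \<theta> \<xi>\<close> commutes with \<open>\<beta>\<close>,
  which makes \<open>cov_radial_DR\<close> applicable, and vanishes at \<open>p0\<close>, which
  supplies the initial value; \<open>alg\<close> says that the obstruction is zero. Division by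
  \<open>sin t\<close> then passes to \<open>tfield \<xi>\<close>.\<close>

lemma DR_perp_null:
  assumes xi: "perp \<xi>" and Y: "vfield Y" and W: "vfield W"
    and Y0: "\<And>t. sconn N Y (\<gamma> t) = 0" and W0: "\<And>t. sconn N W (\<gamma> t) = 0"
    and alg: "\<And>v i t. v \<in> Sec \<Longrightarrow> 0 < t \<Longrightarrow> t < pi \<Longrightarrow> comm (Rm \<beta> (kfield \<theta> \<xi>)) (Rm Y W) v i (\<gamma> t)
      = Rm (round_curv (kfield \<theta> \<xi>) Y) W v i (\<gamma> t) + Rm Y (round_curv (kfield \<theta> \<xi>) W) v i (\<gamma> t)"
    and v: "v \<in> Sec" and t: "0 < t" "t < pi"
  shows "DR (tfield \<xi>) Y W v i (\<gamma> t) = 0"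
proof -
  let ?X = "kfield \<theta> \<xi>"
  have br: "sbracket \<beta> ?X p = 0" if "p \<in> usphere" for p
    using sbracket_radial_kfield[of \<theta> \<xi> p] perpD[OF xi] inners that by simp
  have z: "sconn \<beta> Z (\<gamma> t) = 0" if "vfield Z" "sconn N Z (\<gamma> t) = 0" for Z t
    using sconn_scale_left[OF circle that(1), of \<beta> t "sin t" N] radial_circle[of t] that(2) by simp
  have "null (DR ?X Y W)"
  proof (rule parallel_null)
    show "endo (DR ?X Y W)" using Y W by simp
    show "null (cov N (DR ?X Y W))"
    proof (rule nullI)
      fix v i t assume v: "v \<in> Sec" and t: "0 < t" "t < pi"
      have "DR ?X (sconn \<beta> Y) W v i (\<gamma> t) = 0"
        by (rule tens_pt0[OF tens_DR2]) (simp_all add: v Y W z Y0 vfield_sconn)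
      moreover have "DR ?X Y (sconn \<beta> W) v i (\<gamma> t) = 0"
        by (rule tens_pt0[OF tens_DR3]) (simp_all add: v Y W z W0 vfield_sconn)
      ultimately have "cov \<beta> (DR ?X Y W) v i (\<gamma> t) = 0"
        using cov_radial_DR[OF vfield_k Y W v circle br, of i t] alg[OF v t, of i] by simp
      moreover have "cov \<beta> (DR ?X Y W) v i (\<gamma> t) = sin t * cov N (DR ?X Y W) v i (\<gamma> t)"
        by (rule tens_pt1[OF tens_cov]) (simp_all add: v Y W radial_circle)
      ultimately show "cov N (DR ?X Y W) v i (\<gamma> t) = 0" using sin_pos[OF t] by simp
    qed
    have "?X p0 = 0" using fields_circle(2)[OF xi, of 0] by (simp add: circle_ends)
    then have "DR ?X Y W v i p0 = 0" if "v \<in> Sec" for v i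
      by (intro tens_pt0[OF tens_DR1]) (use that Y W p0 in simp_all)
    then show "(\<forall>v\<in>Sec. \<forall>i. DR ?X Y W v i p0 = 0) \<or> (\<forall>v\<in>Sec. \<forall>i. DR ?X Y W v i (- p0) = 0)" by blast
  qed
  then have "DR ?X Y W v i (\<gamma> t) = 0" by (rule nullD[OF _ v t])
  moreover have "DR ?X Y W v i (\<gamma> t) = sin t * DR (tfield \<xi>) Y W v i (\<gamma> t)"
    by (rule tens_pt1[OF tens_DR1]) (simp_all add: v Y W fields_circle xi)
  ultimately show ?thesis using sin_pos[OF t] by simp
qed

lemma round_curv_circle:
  assumes xi: "perp \<xi>"
  shows "round_curv (kfield \<theta> \<xi>) N (\<gamma> t) = (- (sin t)\<^sup>2) *\<^sub>R tfield \<xi> (\<gamma> t)"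
    "perp \<eta> \<Longrightarrow> round_curv (kfield \<theta> \<xi>) (tfield \<eta>) (\<gamma> t) = ((sin t)\<^sup>2 * (\<xi> \<bullet> \<eta>)) *\<^sub>R N (\<gamma> t)"
proof -
  show "round_curv (kfield \<theta> \<xi>) N (\<gamma> t) = (- (sin t)\<^sup>2) *\<^sub>R tfield \<xi> (\<gamma> t)"
    unfolding round_curv_def fields_circle[OF xi] radial_circle
    using perpD[OF xi] N_norm[of t] by (simp add: power2_eq_square)
  assume et: "perp \<eta>"
  then show "round_curv (kfield \<theta> \<xi>) (tfield \<eta>) (\<gamma> t) = ((sin t)\<^sup>2 * (\<xi> \<bullet> \<eta>)) *\<^sub>R N (\<gamma> t)"
    unfolding round_curv_def fields_circle[OF xi] fields_circle[OF et] radial_circle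
    using perpD(6)[OF et, of t] by (simp add: power2_eq_square inner_commute)
qed

lemma comm_radial_kfield:
  assumes xi: "perp \<xi>" and A: "endo A" and v: "v \<in> Sec"
  shows "comm (Rm \<beta> (kfield \<theta> \<xi>)) A v i (\<gamma> t) = (sin t)\<^sup>2 * comm (Rm N (tfield \<xi>)) A v i (\<gamma> t)"
proof -
  have "comm (Rm \<beta> (kfield \<theta> \<xi>)) A v i (\<gamma> t) = (sin t)\<^sup>2 * 1 * comm (Rm N (tfield \<xi>)) A v i (\<gamma> t)"
    by (rule comm_pt_scale) (simp_all add: A v Rm_radial_kfield xi)
  then show ?thesis by simp
qed

text \<open>Up to the factor \<open>(sin t)\<^sup>2\<close> the obstruction is
  \<open>null_curvature_identity\<close>; the other curvature term is a multiple of
  \<open>Rm N N\<close>, which is zero.\<close>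

lemma DR_perp_N:
  assumes xi: "perp \<xi>" and et: "perp \<eta>" and v: "v \<in> Sec" and t: "0 < t" "t < pi"
  shows "DR (tfield \<xi>) N (tfield \<eta>) v i (\<gamma> t) = 0"
proof (rule DR_perp_null[OF xi vfield_N vfield_t sconn_N_N sconn_N_tfield[OF et] _ v t])
  fix v i t assume v: "v \<in> Sec" and t: "0 < t" "t < pi"
  have "Rm (round_curv (kfield \<theta> \<xi>) N) (tfield \<eta>) v i (\<gamma> t) = - (sin t)\<^sup>2 * Q \<xi> \<eta> v i (\<gamma> t)"
    by (rule tens_pt1[OF tens_Rm1]) (simp_all add: v round_curv_circle xi vfield_round_curv)
  moreover have "Rm N (round_curv (kfield \<theta> \<xi>) (tfield \<eta>)) v i (\<gamma> t) = (sin t)\<^sup>2 * (\<xi> \<bullet> \<eta>) * Rm N N v i (\<gamma> t)"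
    by (rule tens_pt1[OF tens_Rm2]) (simp_all add: v round_curv_circle xi et vfield_round_curv)
  moreover have "Rm N N v i (\<gamma> t) = 0"
    using Rm_skew[OF vfield_N vfield_N v] by (simp add: fun_eq_iff)
  ultimately show "comm (Rm \<beta> (kfield \<theta> \<xi>)) (Rm N (tfield \<eta>)) v i (\<gamma> t)
      = Rm (round_curv (kfield \<theta> \<xi>) N) (tfield \<eta>) v i (\<gamma> t) + Rm N (round_curv (kfield \<theta> \<xi>) (tfield \<eta>)) v i (\<gamma> t)"
    using nullD[OF null_curvature_identity[OF xi et] v t, of i]
      comm_radial_kfield[OF xi endo_Rm[OF vfield_N vfield_t] v, of \<eta> i t]
    by (simp add: add_eq_0_iff)
qed

text \<open>Here the obstruction is \<open>(sin t)\<^sup>2\<close> times the transported bracket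
  relation \<open>comm_rho_null\<close>.\<close>

lemma DR_perp_perp:
  assumes xi: "perp \<xi>" and et: "perp \<eta>" and ze: "perp \<zeta>" and v: "v \<in> Sec" and t: "0 < t" "t < pi"
  shows "DR (tfield \<xi>) (tfield \<eta>) (tfield \<zeta>) v i (\<gamma> t) = 0"
proof (rule DR_perp_null[OF xi vfield_t vfield_t sconn_N_tfield[OF et] sconn_N_tfield[OF ze] _ v t])
  fix v i t assume v: "v \<in> Sec" and t: "0 < t" "t < pi"
  have 1: "Rm (round_curv (kfield \<theta> \<xi>) (tfield \<eta>)) (tfield \<zeta>) v i (\<gamma> t) = (sin t)\<^sup>2 * (\<xi> \<bullet> \<eta>) * Rm N (tfield \<zeta>) v i (\<gamma> t)"
    by (rule tens_pt1[OF tens_Rm1]) (simp_all add: v round_curv_circle xi et vfield_round_curv)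
  have 2: "Rm (tfield \<eta>) (round_curv (kfield \<theta> \<xi>) (tfield \<zeta>)) v i (\<gamma> t) = (sin t)\<^sup>2 * (\<xi> \<bullet> \<zeta>) * Rm (tfield \<eta>) N v i (\<gamma> t)"
    by (rule tens_pt1[OF tens_Rm2]) (simp_all add: v round_curv_circle xi ze vfield_round_curv)
  have 3: "Rm (tfield \<eta>) N v i (\<gamma> t) = - Rm N (tfield \<eta>) v i (\<gamma> t)"
    using Rm_skew[OF vfield_N vfield_t v, of \<eta>] by simp
  have 4: "comm (Rm N (tfield \<xi>)) (Q \<eta> \<zeta>) v i (\<gamma> t)
      = (\<xi> \<bullet> \<eta>) * Rm N (tfield \<zeta>) v i (\<gamma> t) - (\<xi> \<bullet> \<zeta>) * Rm N (tfield \<eta>) v i (\<gamma> t)"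
    using nullD[OF comm_rho_null[OF xi et ze] v t, of i] by simp
  show "comm (Rm \<beta> (kfield \<theta> \<xi>)) (Q \<eta> \<zeta>) v i (\<gamma> t)
      = Rm (round_curv (kfield \<theta> \<xi>) (tfield \<eta>)) (tfield \<zeta>) v i (\<gamma> t)
        + Rm (tfield \<eta>) (round_curv (kfield \<theta> \<xi>) (tfield \<zeta>)) v i (\<gamma> t)"
    unfolding comm_radial_kfield[OF xi endo_Rm[OF vfield_t vfield_t] v] 1 2 3 4 by (simp add: algebra_simps)
qed

lemma DR_zero_circle:
  assumes Z: "vfield Z" and Y: "vfield Y" and W: "vfield W" and v: "v \<in> Sec" and t: "0 < t" "t < pi"
  shows "DR Z Y W v i (\<gamma> t) = 0"
proof -
  obtain c \<xi> where xi: "perp \<xi>" "Z (\<gamma> t) = c *\<^sub>R N (\<gamma> t) + 1 *\<^sub>R tfield \<xi> (\<gamma> t)"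
    by (rule tangent_decomp[OF vfield_tangent[OF Z circle]])
  obtain a \<eta> where et: "perp \<eta>" "Y (\<gamma> t) = a *\<^sub>R N (\<gamma> t) + 1 *\<^sub>R tfield \<eta> (\<gamma> t)"
    by (rule tangent_decomp[OF vfield_tangent[OF Y circle]])
  obtain b \<zeta> where ze: "perp \<zeta>" "W (\<gamma> t) = b *\<^sub>R N (\<gamma> t) + 1 *\<^sub>R tfield \<zeta> (\<gamma> t)"
    by (rule tangent_decomp[OF vfield_tangent[OF W circle]])
  have sk: "DR (tfield \<xi>) Y' W' v i p = - DR (tfield \<xi>) W' Y' v i p" if "vfield Y'" "vfield W'" for Y' W' p
    using DR_skew[OF vfield_t that(2,1) v, of \<xi>] by simp
  have "DR Z Y W v i (\<gamma> t) = c * DR N Y W v i (\<gamma> t) + 1 * DR (tfield \<xi>) Y W v i (\<gamma> t)"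
    by (rule tens_pt[OF tens_DR1[OF Y W v] Z vfield_N vfield_t circle xi(2)])
  also have "DR (tfield \<xi>) Y W v i (\<gamma> t) = a * DR (tfield \<xi>) N W v i (\<gamma> t) + 1 * DR (tfield \<xi>) (tfield \<eta>) W v i (\<gamma> t)"
    by (rule tens_pt[OF tens_DR2[OF vfield_t W v] Y vfield_N vfield_t circle et(2)])
  also have "DR (tfield \<xi>) N W v i (\<gamma> t) = b * DR (tfield \<xi>) N N v i (\<gamma> t) + 1 * DR (tfield \<xi>) N (tfield \<zeta>) v i (\<gamma> t)"
    by (rule tens_pt[OF tens_DR3[OF vfield_t vfield_N v] W vfield_N vfield_t circle ze(2)])
  also have "DR (tfield \<xi>) (tfield \<eta>) W v i (\<gamma> t)
      = b * DR (tfield \<xi>) (tfield \<eta>) N v i (\<gamma> t) + 1 * DR (tfield \<xi>) (tfield \<eta>) (tfield \<zeta>) v i (\<gamma> t)"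
    by (rule tens_pt[OF tens_DR3[OF vfield_t vfield_t v] W vfield_N vfield_t circle ze(2)])
  finally show ?thesis
    using DR_N_zero[OF Y W v t, of i] DR_perp_N[OF xi(1) ze(1) v t, of i] DR_perp_N[OF xi(1) et(1) v t, of i]
      DR_perp_perp[OF xi(1) et(1) ze(1) v t, of i] sk[OF vfield_N vfield_N, of "\<gamma> t"] sk[OF vfield_t vfield_N, of \<eta> "\<gamma> t"]
    by simp
qed

end

context radial_connection
begin

theorem DR_zero:
  assumes Z: "vfield Z" and Y: "vfield Y" and W: "vfield W" and v: "v \<in> Sec" and p: "p \<in> usphere"
  shows "DR Z Y W v i p = 0"
proof (cases "p = p0 \<or> p = - p0")
  case False
  then obtain \<theta> t where th: "\<theta> \<in> usphere" "\<theta> \<in> tangent p0" and t: "0 < t" "t < pi" and pt: "p = great_circle p0 \<theta> t"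
    using polar_coordinates[OF p0 p] by blast
  interpret radial_circle Sec nab I s p0 \<theta> by (rule radial_circleI[OF th])
  show ?thesis using DR_zero_circle[OF Z Y W v t] pt by simp
next
  case True
  show ?thesis
  \<comment> \<open>A pole is reached by continuity along a half circle, whose direction is taken
    from \<open>Z p\<close>. If \<open>Z p = 0\<close>, as always on the sphere of dimension 0,
    tensoriality suffices.\<close>
  proof (cases "Z p = 0")
    case True
    then show ?thesis by (intro tens_pt0[OF tens_DR1[OF Y W v] Z p])
  next
    case False
    define \<theta> where "\<theta> = Z p /\<^sub>R norm (Z p)"
    have th: "\<theta> \<in> usphere" "\<theta> \<in> tangent p0"
      using False True vfield_tangent[OF Z p] by (auto simp: \<theta>_def tangent_def)
    interpret radial_circle Sec nab I s p0 \<theta> by (rule radial_circleI[OF th])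
    have "DR Z Y W v \<in> Sec" by (rule endo_sec[OF endo_DR[OF Z Y W] v])
    from sec_zero_ends[OF this DR_zero_circle[OF Z Y W v]] True show ?thesis by auto
  qed
qed

end

section \<open>Global coordinates on a vector bundle\<close>

lemma orthonormal_basis_expansion:
  fixes S :: "'f::euclidean_space set"
  assumes "subspace S"
  obtains B where "B \<subseteq> S" "finite B" "\<And>x. x \<in> S \<Longrightarrow> x = (\<Sum>e\<in>B. (x \<bullet> e) *\<^sub>R e)"
proof -
  obtain B where B: "B \<subseteq> S" "pairwise orthogonal B" "\<And>x. x \<in> B \<Longrightarrow> norm x = 1"
    "independent B" "card B = dim S" "span B = S"
    using orthonormal_basis_subspace[OF assms] by metis
  have fin: "finite B" using B(4) by (rule independent_imp_finite)
  have "x = (\<Sum>e\<in>B. (x \<bullet> e) *\<^sub>R e)" if "x \<in> S" for x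
  proof -
    have "x \<in> span B" using that B(6) by simp
    then obtain u where x: "x = (\<Sum>v\<in>B. u v *\<^sub>R v)" using span_finite[OF fin] by auto
    have "x \<bullet> e = u e" if e: "e \<in> B" for e
    proof -
      have "x \<bullet> e = (\<Sum>v\<in>B. if v = e then u e else 0)"
        unfolding x inner_sum_left
      proof (rule sum.cong[OF refl])
        fix v assume "v \<in> B"
        then show "u v *\<^sub>R v \<bullet> e = (if v = e then u e else 0)"
          using B(2,3) e by (auto simp: pairwise_def orthogonal_def norm_eq_1)
      qed
      then show ?thesis using fin e by simp
    qed
    then have "(\<Sum>e\<in>B. (x \<bullet> e) *\<^sub>R e) = (\<Sum>e\<in>B. u e *\<^sub>R e)" by (intro sum.cong) auto
    then show ?thesis using x by simp
  qed
  then show thesis using that B(1) fin by blast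
qed

locale vbundle_sphere =
  fixes E :: "('a::euclidean_space, 'e, 'f::euclidean_space) vbundle"
  assumes vb: "vector_bundle E"
begin

section \<open>Charts and smooth sections\<close>

lemma model_subspace: "subspace (model E)"
  using vb unfolding vector_bundle_def by simp

lemma fzero_fibre [simp]: "p \<in> usphere \<Longrightarrow> fzero E p \<in> fibre E p"
  and fplus_fibre [simp]: "p \<in> usphere \<Longrightarrow> a \<in> fibre E p \<Longrightarrow> b \<in> fibre E p \<Longrightarrow> fplus E a b \<in> fibre E p"
  and fscale_fibre [simp]: "p \<in> usphere \<Longrightarrow> a \<in> fibre E p \<Longrightarrow> fscale E r a \<in> fibre E p"
  using vb unfolding vector_bundle_def by auto

lemma chart_exists: "p \<in> usphere \<Longrightarrow> \<exists>U \<phi>. (U, \<phi>) \<in> trivs E \<and> p \<in> U"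
proof -
  assume "p \<in> usphere"
  moreover have "(\<Union>(U, \<phi>)\<in>trivs E. U) = usphere" using vb unfolding vector_bundle_def by simp
  ultimately show ?thesis by blast
qed

lemma chart_properties:
  assumes "(U, \<phi>) \<in> trivs E"
  shows "openin (top_of_set usphere) U \<and>
       (\<forall>p\<in>U. bij_betw \<phi> (fibre E p) (model E) \<and> \<phi> (fzero E p) = 0 \<and>
          (\<forall>a\<in>fibre E p. \<forall>b\<in>fibre E p. \<phi> (fplus E a b) = \<phi> a + \<phi> b) \<and>
          (\<forall>r. \<forall>a\<in>fibre E p. \<phi> (fscale E r a) = r *\<^sub>R \<phi> a))"
proof -
  have "\<forall>(U, \<phi>)\<in>trivs E. openin (top_of_set usphere) U \<and>
       (\<forall>p\<in>U. bij_betw \<phi> (fibre E p) (model E) \<and> \<phi> (fzero E p) = 0 \<and>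
          (\<forall>a\<in>fibre E p. \<forall>b\<in>fibre E p. \<phi> (fplus E a b) = \<phi> a + \<phi> b) \<and>
          (\<forall>r. \<forall>a\<in>fibre E p. \<phi> (fscale E r a) = r *\<^sub>R \<phi> a))"
    using vb unfolding vector_bundle_def by (elim conjE)
  from bspec[OF this assms] show ?thesis by (unfold prod.case)
qed

lemma chart_open:
  assumes "(U, \<phi>) \<in> trivs E" obtains T where "open T" "U = usphere \<inter> T"
  using chart_properties[OF assms] unfolding openin_open by metis

lemma chart_sphere: "(U, \<phi>) \<in> trivs E \<Longrightarrow> p \<in> U \<Longrightarrow> p \<in> usphere"
  using chart_open by blast

context
  fixes U \<phi> p assumes chart: "(U, \<phi>) \<in> trivs E" and p: "p \<in> U"
begin

lemma chart_bij: "bij_betw \<phi> (fibre E p) (model E)"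
  and chart_zero: "\<phi> (fzero E p) = 0"
  and chart_add: "a \<in> fibre E p \<Longrightarrow> b \<in> fibre E p \<Longrightarrow> \<phi> (fplus E a b) = \<phi> a + \<phi> b"
  and chart_scale: "a \<in> fibre E p \<Longrightarrow> \<phi> (fscale E r a) = r *\<^sub>R \<phi> a"
  using chart_properties[OF chart] p by simp_all

lemma chart_model: "a \<in> fibre E p \<Longrightarrow> \<phi> a \<in> model E"
  using chart_bij by (auto simp: bij_betw_def)

lemma chart_inj: "a \<in> fibre E p \<Longrightarrow> b \<in> fibre E p \<Longrightarrow> \<phi> a = \<phi> b \<Longrightarrow> a = b"
  using chart_bij by (auto simp: bij_betw_def inj_on_def)

lemma chart_inv: "w \<in> model E \<Longrightarrow> inv_into (fibre E p) \<phi> w \<in> fibre E p"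
  "w \<in> model E \<Longrightarrow> \<phi> (inv_into (fibre E p) \<phi> w) = w"
  "a \<in> fibre E p \<Longrightarrow> inv_into (fibre E p) \<phi> (\<phi> a) = a"
  using chart_bij by (auto simp: bij_betw_def inv_into_into f_inv_into_f)

text \<open>Transition maps are linear on the model fibre, since \<open>\<phi>\<close> is bijective
  and both charts respect the operations.\<close>

lemma chart_inv_sum:
  assumes "(W, \<psi>) \<in> trivs E" "p \<in> W" "finite B" "B \<subseteq> model E"
  shows "\<psi> (inv_into (fibre E p) \<phi> (\<Sum>e\<in>B. c e *\<^sub>R e)) = (\<Sum>e\<in>B. c e *\<^sub>R \<psi> (inv_into (fibre E p) \<phi> e))"
proof -
  define L where "L = (\<lambda>w. \<psi> (inv_into (fibre E p) \<phi> w))"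
  note ps = chart_sphere[OF chart p]
  have bij: "bij_betw \<psi> (fibre E p) (model E)" and zero: "\<psi> (fzero E p) = 0"
    and add: "\<And>a b. a \<in> fibre E p \<Longrightarrow> b \<in> fibre E p \<Longrightarrow> \<psi> (fplus E a b) = \<psi> a + \<psi> b"
    and scale: "\<And>r a. a \<in> fibre E p \<Longrightarrow> \<psi> (fscale E r a) = r *\<^sub>R \<psi> a"
    using chart_properties[OF assms(1)] assms(2) by simp_all
  have L_add: "L (x + y) = L x + L y" if "x \<in> model E" "y \<in> model E" for x y
  proof -
    have "\<phi> (fplus E (inv_into (fibre E p) \<phi> x) (inv_into (fibre E p) \<phi> y)) = x + y"
      using that by (simp add: chart_add chart_inv)
    then have "inv_into (fibre E p) \<phi> (x + y) = fplus E (inv_into (fibre E p) \<phi> x) (inv_into (fibre E p) \<phi> y)"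
      using chart_inv(3)[of "fplus E (inv_into (fibre E p) \<phi> x) (inv_into (fibre E p) \<phi> y)"] that ps chart_inv(1)
      by simp
    then show ?thesis using that by (simp add: L_def add chart_inv(1))
  qed
  have L_scale: "L (r *\<^sub>R x) = r *\<^sub>R L x" if "x \<in> model E" for r x
  proof -
    have "\<phi> (fscale E r (inv_into (fibre E p) \<phi> x)) = r *\<^sub>R x"
      using that by (simp add: chart_scale chart_inv)
    then have "inv_into (fibre E p) \<phi> (r *\<^sub>R x) = fscale E r (inv_into (fibre E p) \<phi> x)"
      using chart_inv(3)[of "fscale E r (inv_into (fibre E p) \<phi> x)"] that ps chart_inv(1) by simp
    then show ?thesis using that by (simp add: L_def scale chart_inv(1))
  qed
  have L0: "L 0 = 0" using L_scale[of 0 0] subspace_0[OF model_subspace] by simp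
  have "L (\<Sum>e\<in>B. c e *\<^sub>R e) = (\<Sum>e\<in>B. c e *\<^sub>R L e)"
    using assms(3,4)
  proof (induction B)
    case (insert e B)
    then have "(\<Sum>e\<in>B. c e *\<^sub>R e) \<in> model E" "c e *\<^sub>R e \<in> model E"
      using model_subspace by (auto intro!: subspace_sum subspace_scale)
    then show ?case using insert by (simp add: L_add L_scale)
  qed (simp add: L0)
  then show ?thesis unfolding L_def .
qed

end

lemma transition_smooth:
  assumes "(U, \<phi>) \<in> trivs E" "(W, \<psi>) \<in> trivs E" "w \<in> model E"
  shows "smooth_fun (U \<inter> W) (\<lambda>p. \<psi> (inv_into (fibre E p) \<phi> w))"
proof -
  have "\<forall>(U, \<phi>)\<in>trivs E. \<forall>(W, \<psi>)\<in>trivs E. \<forall>v\<in>model E.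
       smooth_fun (U \<inter> W) (\<lambda>p. \<psi> (inv_into (fibre E p) \<phi> v))"
    using vb unfolding vector_bundle_def by (elim conjE)
  from bspec[OF this assms(1)] have "\<forall>(W, \<psi>)\<in>trivs E. \<forall>v\<in>model E.
       smooth_fun (U \<inter> W) (\<lambda>p. \<psi> (inv_into (fibre E p) \<phi> v))" by (unfold prod.case)
  from bspec[OF this assms(2)] have "\<forall>v\<in>model E. smooth_fun (U \<inter> W) (\<lambda>p. \<psi> (inv_into (fibre E p) \<phi> v))"
    by (unfold prod.case)
  from bspec[OF this assms(3)] show ?thesis .
qed

lemma sectionI:
  "(\<And>p. p \<in> usphere \<Longrightarrow> V p \<in> fibre E p) \<Longrightarrow>
   (\<And>U \<phi>. (U, \<phi>) \<in> trivs E \<Longrightarrow> smooth_fun U (\<lambda>p. \<phi> (V p))) \<Longrightarrow> smooth_section E V"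
  and section_fibre: "smooth_section E V \<Longrightarrow> p \<in> usphere \<Longrightarrow> V p \<in> fibre E p"
  and section_chart: "smooth_section E V \<Longrightarrow> (U, \<phi>) \<in> trivs E \<Longrightarrow> smooth_fun U (\<lambda>p. \<phi> (V p))"
  unfolding smooth_section_def by auto

lemma section_zero: "smooth_section E (fzero E)"
  by (rule sectionI) (auto intro!: smooth_fun_cong[OF smooth_fun_const[where c=0]] simp: chart_zero)

lemma section_plus:
  assumes V: "smooth_section E V" and W: "smooth_section E W"
  shows "smooth_section E (\<lambda>p. fplus E (V p) (W p))"
proof (rule sectionI)
  fix U \<phi> assume ch: "(U, \<phi>) \<in> trivs E"
  show "smooth_fun U (\<lambda>p. \<phi> (fplus E (V p) (W p)))"
    by (rule smooth_fun_cong[OF smooth_fun_add[OF section_chart[OF V ch] section_chart[OF W ch]]],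
        rule chart_add[OF ch _ section_fibre[OF V chart_sphere[OF ch]] section_fibre[OF W chart_sphere[OF ch]], symmetric])
qed (use section_fibre[OF V] section_fibre[OF W] in simp)

lemma section_scale:
  assumes f: "smooth_fun usphere f" and V: "smooth_section E V"
  shows "smooth_section E (\<lambda>p. fscale E (f p) (V p))"
proof (rule sectionI)
  fix U \<phi> assume ch: "(U, \<phi>) \<in> trivs E"
  have "smooth_fun U f" by (rule smooth_fun_subset[OF f]) (use chart_sphere[OF ch] in blast)
  then show "smooth_fun U (\<lambda>p. \<phi> (fscale E (f p) (V p)))"
    by (rule smooth_fun_cong[OF smooth_fun_scaleR[OF _ section_chart[OF V ch]]])
      (rule chart_scale[OF ch _ section_fibre[OF V chart_sphere[OF ch]], symmetric])
qed (use section_fibre[OF V] in simp)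

lemma section_minus:
  "smooth_section E V \<Longrightarrow> smooth_section E W \<Longrightarrow> smooth_section E (\<lambda>p. fminus E (V p) (W p))"
  unfolding fminus_def using section_plus[OF _ section_scale[OF smooth_fun_const]] by simp

end

text \<open>The closed balls lie in chart domains while the open balls cover. The gap matters: off a
  closed ball the cutoff vanishes on an open set, which makes extension by zero smooth.\<close>

locale vbundle_cover = vbundle_sphere E for E :: "('a::euclidean_space, 'e, 'f::euclidean_space) vbundle" +
  fixes K :: "'a set" and \<rho> :: "'a \<Rightarrow> real" and U :: "'a \<Rightarrow> 'a set" and \<phi> :: "'a \<Rightarrow> 'e \<Rightarrow> 'f" and B :: "'f set"
  assumes K: "finite K" and \<rho>: "k \<in> K \<Longrightarrow> \<rho> k > 0" and chart: "k \<in> K \<Longrightarrow> (U k, \<phi> k) \<in> trivs E"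
    and ball_U: "k \<in> K \<Longrightarrow> q \<in> usphere \<Longrightarrow> dist k q \<le> \<rho> k \<Longrightarrow> q \<in> U k"
    and cover: "p \<in> usphere \<Longrightarrow> \<exists>k\<in>K. dist k p < \<rho> k"
    and B: "B \<subseteq> model E" "finite B" "\<And>x. x \<in> model E \<Longrightarrow> x = (\<Sum>e\<in>B. (x \<bullet> e) *\<^sub>R e)"

lemma (in vbundle_sphere) cover_exists: "\<exists>K \<rho> U \<phi> B. vbundle_cover E K \<rho> U \<phi> B"
proof -
  have "\<exists>\<rho>. \<exists>U \<phi>. \<rho> > 0 \<and> (U, \<phi>) \<in> trivs E \<and> (\<forall>q\<in>usphere. dist k q \<le> \<rho> \<longrightarrow> q \<in> U)"
    if k: "k \<in> usphere" for k
  proof -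
    obtain U \<phi> where U: "(U, \<phi>) \<in> trivs E" "k \<in> U" using chart_exists[OF k] by blast
    obtain T where T: "open T" "U = usphere \<inter> T" by (rule chart_open[OF U(1)])
    obtain \<rho> where "\<rho> > 0" "cball k \<rho> \<subseteq> T" using T U(2) open_contains_cball by blast
    then show ?thesis using U(1) T(2) by (intro exI[of _ \<rho>] exI[of _ U] exI[of _ \<phi>]) auto
  qed
  then obtain \<rho> U \<phi> where ch: "\<And>k. k \<in> usphere \<Longrightarrow> \<rho> k > 0 \<and> (U k, \<phi> k) \<in> trivs E \<and>
      (\<forall>q\<in>usphere. dist k q \<le> \<rho> k \<longrightarrow> q \<in> U k)"
    by metis
  have "compact (usphere :: 'a set)" by simp
  moreover have "usphere \<subseteq> (\<Union>k\<in>usphere. ball k (\<rho> k))" using ch by force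
  ultimately obtain K where K: "K \<subseteq> usphere" "finite K" "usphere \<subseteq> (\<Union>k\<in>K. ball k (\<rho> k))"
    using compactE_image[of usphere usphere "\<lambda>k. ball k (\<rho> k)"] by (metis open_ball)
  obtain B where "B \<subseteq> model E" "finite B" "\<And>x. x \<in> model E \<Longrightarrow> x = (\<Sum>e\<in>B. (x \<bullet> e) *\<^sub>R e)"
    by (rule orthonormal_basis_expansion[OF model_subspace]) blast
  moreover have "\<exists>k\<in>K. dist k p < \<rho> k" if "p \<in> usphere" for p
    using subsetD[OF K(3) that] by auto
  ultimately have "vbundle_cover E K \<rho> U \<phi> B"
    using K ch by unfold_locales auto
  then show ?thesis by blast
qed

section \<open>Cutoff functions and a finite generating family of sections\<close>

context vbundle_cover
begin

definition bump :: "'a \<Rightarrow> 'a \<Rightarrow> real"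
  where "bump k q = flat 0 ((\<rho> k)\<^sup>2 - (q - k) \<bullet> (q - k))"

text \<open>Squares, because every bump is used twice: once to extend a local section by zero in
  \<open>gsec\<close>, and once to extend its coefficient in \<open>co\<close>.\<close>

definition bumps :: "'a \<Rightarrow> real" where "bumps q = (\<Sum>k\<in>K. bump k q * bump k q)"

lemma smooth_bump: "smooth_fun A (bump k)"
  unfolding bump_def[abs_def] by (rule smooth_fun_bump)

lemma bump_pos_iff: "k \<in> K \<Longrightarrow> 0 < bump k q \<longleftrightarrow> dist k q < \<rho> k"
proof -
  assume k: "k \<in> K"
  have "0 < bump k q \<longleftrightarrow> norm (q - k) ^ 2 < (\<rho> k)\<^sup>2"
    by (simp add: bump_def flat_pos_iff power2_norm_eq_inner)
  also have "\<dots> \<longleftrightarrow> norm (q - k) < \<rho> k" using \<rho>[OF k] power2_less_imp_less[of "norm (q - k)" "\<rho> k"] power_strict_mono[of "norm (q - k)" "\<rho> k" 2] by auto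
  finally show ?thesis by (simp add: dist_norm norm_minus_commute)
qed

lemma bump_zero: "k \<in> K \<Longrightarrow> \<rho> k \<le> dist k q \<Longrightarrow> bump k q = 0"
  using bump_pos_iff[of k q] flat_nonneg[of 0 "(\<rho> k)\<^sup>2 - (q - k) \<bullet> (q - k)"]
  by (force simp: bump_def)

lemma bump_outside: "k \<in> K \<Longrightarrow> q \<in> usphere \<Longrightarrow> q \<notin> U k \<Longrightarrow> bump k q = 0"
  using ball_U[of k q] bump_zero[of k q] by (metis linear)

lemma bumps_pos: "p \<in> usphere \<Longrightarrow> bumps p > 0"
proof -
  assume "p \<in> usphere"
  then obtain k where k: "k \<in> K" "0 < bump k p" using cover bump_pos_iff by blast
  then have "0 < bump k p * bump k p" by simp
  also have "\<dots> \<le> bumps p" unfolding bumps_def using K k(1) by (intro member_le_sum) auto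
  finally show ?thesis .
qed

text \<open>Near a point of \<open>U k\<close> the function is given by the smooth \<open>f\<close>;
  a point outside has a neighbourhood off the closed ball, where the bump and hence \<open>F\<close>
  vanish.\<close>

lemma smooth_cutoff:
  assumes k: "k \<in> K" and A: "A \<subseteq> usphere" and f: "smooth_fun (U k \<inter> A) f"
    and eq: "\<And>q. q \<in> A \<Longrightarrow> q \<in> U k \<Longrightarrow> F q = f q"
    and z: "\<And>q. q \<in> A \<Longrightarrow> bump k q = 0 \<Longrightarrow> F q = 0"
  shows "smooth_fun A F"
proof (rule smooth_fun_local)
  fix p assume p: "p \<in> A"
  obtain T where T: "open T" "U k = usphere \<inter> T" by (rule chart_open[OF chart[OF k]])
  show "\<exists>W f'. open W \<and> p \<in> W \<and> smooth_fun (W \<inter> A) f' \<and> (\<forall>q\<in>W \<inter> A. f' q = F q)"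
  proof (cases "p \<in> U k")
    case True
    have "T \<inter> A = U k \<inter> A" using T A by auto
    then show ?thesis using T True f eq A by (intro exI[of _ T] exI[of _ f]) auto
  next
    case False
    then have "p \<in> - cball k (\<rho> k)" using ball_U[OF k, of p] p A by auto
    moreover have "F q = 0" if "q \<in> - cball k (\<rho> k) \<inter> A" for q
      using that z[of q] bump_zero[OF k, of q] by auto
    ultimately show ?thesis
      by (intro exI[of _ "- cball k (\<rho> k)"] exI[of _ "\<lambda>_. 0"]) (auto simp: smooth_fun_const)
  qed
qed

definition gsec :: "'a \<Rightarrow> 'f \<Rightarrow> 'a \<Rightarrow> 'e"
  where "gsec k w q = (if q \<in> U k then fscale E (bump k q) (inv_into (fibre E q) (\<phi> k) w) else fzero E q)"

lemma section_gsec: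
  assumes k: "k \<in> K" and w: "w \<in> model E"
  shows "smooth_section E (gsec k w)"
proof (rule sectionI)
  show "gsec k w p \<in> fibre E p" if "p \<in> usphere" for p
    using that chart_inv(1)[OF chart[OF k] _ w] by (auto simp: gsec_def)
  fix W \<psi> assume ch: "(W, \<psi>) \<in> trivs E"
  show "smooth_fun W (\<lambda>p. \<psi> (gsec k w p))"
  proof (rule smooth_cutoff[OF k])
    show "W \<subseteq> usphere" using chart_sphere[OF ch] by blast
    show "smooth_fun (U k \<inter> W) (\<lambda>q. bump k q *\<^sub>R \<psi> (inv_into (fibre E q) (\<phi> k) w))"
      by (intro smooth_fun_scaleR smooth_bump transition_smooth[OF chart[OF k] ch w])
    show "\<psi> (gsec k w q) = bump k q *\<^sub>R \<psi> (inv_into (fibre E q) (\<phi> k) w)" if "q \<in> W" "q \<in> U k" for q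
      using that by (simp add: gsec_def chart_scale[OF ch] chart_inv(1)[OF chart[OF k] _ w])
    show "\<psi> (gsec k w q) = 0" if "q \<in> W" "bump k q = 0" for q
      using that chart_inv(1)[OF chart[OF k] _ w, of q]
      by (auto simp: gsec_def chart_scale[OF ch] chart_zero[OF ch])
  qed
qed

lemma section_through:
  assumes p: "p \<in> usphere" and a: "a \<in> fibre E p"
  obtains V where "smooth_section E V" "V p = a"
proof -
  obtain k where k: "k \<in> K" "dist k p < \<rho> k" using cover[OF p] by blast
  have pU: "p \<in> U k" using ball_U[OF k(1) p] k by simp
  have b: "bump k p > 0" using bump_pos_iff[OF k(1)] k(2) by blast
  \<comment> \<open>The factor undoes the bump in \<open>gsec\<close>, so that the section takes the
    value \<open>a\<close> at \<open>p\<close>.\<close>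
  define w where "w = (1 / bump k p) *\<^sub>R \<phi> k a"
  have w: "w \<in> model E"
    unfolding w_def by (intro subspace_scale[OF model_subspace] chart_model[OF chart[OF k(1)] pU a])
  have "\<phi> k (gsec k w p) = \<phi> k a"
    using b pU by (simp add: gsec_def chart_scale[OF chart[OF k(1)] pU] chart_inv(1,2)[OF chart[OF k(1)] pU w] w_def[symmetric])
      (simp add: w_def)
  then have "gsec k w p = a"
    by (rule chart_inj[OF chart[OF k(1)] pU section_fibre[OF section_gsec[OF k(1) w] p] a])
  then show thesis using that[OF section_gsec[OF k(1) w]] by blast
qed

definition I :: "('a \<times> 'f) set" where "I = K \<times> B"

text \<open>The weights are such that, for fixed \<open>k\<close>, coefficients times generators sum
  to \<open>bump k p * bump k p / bumps p\<close> times the section, and these fractions have sum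
  1.\<close>

definition co :: "('a \<Rightarrow> 'e) \<Rightarrow> 'a \<times> 'f \<Rightarrow> 'a \<Rightarrow> real"
  where "co V i p = (if i \<in> I \<and> p \<in> usphere \<and> p \<in> U (fst i)
    then bump (fst i) p / bumps p * (\<phi> (fst i) (V p) \<bullet> snd i) else 0)"

lemma co_cong: "(\<And>p. p \<in> usphere \<Longrightarrow> V p = W p) \<Longrightarrow> co V = co W"
  by (simp add: co_def fun_eq_iff)

lemma co_smooth:
  assumes V: "smooth_section E V" shows "smooth_fun usphere (co V i)"
proof (cases "i \<in> I")
  case False
  then have "co V i = (\<lambda>_. 0)" by (simp add: co_def fun_eq_iff)
  then show ?thesis by (simp add: smooth_fun_const)
next
  case True
  then have k: "fst i \<in> K" by (auto simp: I_def)
  have Us: "U (fst i) \<subseteq> usphere" using chart_sphere[OF chart[OF k]] by blast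
  have bs: "smooth_fun usphere bumps"
    unfolding bumps_def[abs_def] by (intro smooth_fun_sum smooth_fun_mult smooth_bump)
  have inv: "smooth_fun (U (fst i) \<inter> usphere) (\<lambda>q. inverse (bumps q))"
    by (rule smooth_fun_subset[OF smooth_fun_inverse[OF bs bumps_pos]]) auto
  have ch: "smooth_fun (U (fst i) \<inter> usphere) (\<lambda>q. \<phi> (fst i) (V q))"
    by (rule smooth_fun_subset[OF section_chart[OF V chart[OF k]]]) auto
  show ?thesis
  proof (rule smooth_cutoff[OF k order_refl])
    show "smooth_fun (U (fst i) \<inter> usphere) (\<lambda>q. bump (fst i) q * inverse (bumps q) * (\<phi> (fst i) (V q) \<bullet> snd i))"
      by (intro smooth_fun_mult smooth_bump inv smooth_fun_inner ch smooth_fun_const)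
  qed (use True in \<open>auto simp: co_def divide_inverse\<close>)
qed

lemma co_zero: "co (fzero E) = 0"
proof (intro ext)
  fix i p show "co (fzero E) i p = 0 i p"
    using chart_zero[OF chart, of "fst i" p] by (auto simp: co_def I_def)
qed

lemma co_plus:
  assumes V: "smooth_section E V" and W: "smooth_section E W"
  shows "co (\<lambda>p. fplus E (V p) (W p)) = co V + co W"
proof (intro ext)
  fix i p show "co (\<lambda>p. fplus E (V p) (W p)) i p = (co V + co W) i p"
    using chart_add[OF chart, of "fst i" p "V p" "W p"] section_fibre[OF V] section_fibre[OF W]
    by (auto simp: co_def I_def inner_simps algebra_simps add_divide_distrib)
qed

lemma co_scale:
  assumes V: "smooth_section E V"
  shows "co (\<lambda>p. fscale E (f p) (V p)) = fs f (co V)"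
proof (intro ext)
  fix i p show "co (\<lambda>p. fscale E (f p) (V p)) i p = fs f (co V) i p"
    using chart_scale[OF chart, of "fst i" p "V p" "f p"] section_fibre[OF V]
    by (auto simp: co_def I_def)
qed

lemma co_minus:
  assumes V: "smooth_section E V" and W: "smooth_section E W"
  shows "co (\<lambda>p. fminus E (V p) (W p)) = co V - co W"
proof -
  have "co (\<lambda>p. fminus E (V p) (W p)) = co V + fs (\<lambda>_. -1) (co W)"
    unfolding fminus_def using co_plus[OF V section_scale[OF smooth_fun_const W, of "-1"]] co_scale[OF W, of "\<lambda>_. -1"] by simp
  then show ?thesis by (simp add: fun_eq_iff)
qed

lemma chart_reconstruct:
  assumes V: "smooth_section E V" and ch: "(W, \<psi>) \<in> trivs E" and p: "p \<in> W"
  shows "\<psi> (V p) = (\<Sum>(k, e)\<in>I. co V (k, e) p *\<^sub>R \<psi> (gsec k e p))"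
proof -
  note ps = chart_sphere[OF ch p]
  note Vp = section_fibre[OF V ps]
  have one: "(\<Sum>e\<in>B. co V (k, e) p *\<^sub>R \<psi> (gsec k e p)) = (bump k p * bump k p / bumps p) *\<^sub>R \<psi> (V p)"
    if k: "k \<in> K" for k
  proof (cases "p \<in> U k")
    case False
    then show ?thesis using bump_outside[OF k ps] by (simp add: co_def)
  next
    case True
    note c = chart[OF k]
    have "(\<Sum>e\<in>B. co V (k, e) p *\<^sub>R \<psi> (gsec k e p))
      = (\<Sum>e\<in>B. (bump k p * bump k p / bumps p) *\<^sub>R ((\<phi> k (V p) \<bullet> e) *\<^sub>R \<psi> (inv_into (fibre E p) (\<phi> k) e)))"
    proof (rule sum.cong[OF refl])
      fix e assume e: "e \<in> B"
      then have em: "e \<in> model E" using B(1) by blast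
      show "co V (k, e) p *\<^sub>R \<psi> (gsec k e p) = (bump k p * bump k p / bumps p) *\<^sub>R
          ((\<phi> k (V p) \<bullet> e) *\<^sub>R \<psi> (inv_into (fibre E p) (\<phi> k) e))"
        using True ps k e by (simp add: co_def I_def gsec_def chart_scale[OF ch p chart_inv(1)[OF c True em]])
    qed
    also have "\<dots> = (bump k p * bump k p / bumps p) *\<^sub>R (\<Sum>e\<in>B. (\<phi> k (V p) \<bullet> e) *\<^sub>R \<psi> (inv_into (fibre E p) (\<phi> k) e))"
      by (simp add: scaleR_sum_right)
    also have "(\<Sum>e\<in>B. (\<phi> k (V p) \<bullet> e) *\<^sub>R \<psi> (inv_into (fibre E p) (\<phi> k) e))
      = \<psi> (inv_into (fibre E p) (\<phi> k) (\<Sum>e\<in>B. (\<phi> k (V p) \<bullet> e) *\<^sub>R e))"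
      by (rule chart_inv_sum[OF c True ch p B(2,1), symmetric])
    also have "\<dots> = \<psi> (V p)"
      using B(3)[OF chart_model[OF c True Vp]] chart_inv(3)[OF c True Vp] by simp
    finally show ?thesis .
  qed
  have "(\<Sum>(k, e)\<in>I. co V (k, e) p *\<^sub>R \<psi> (gsec k e p)) = (\<Sum>k\<in>K. \<Sum>e\<in>B. co V (k, e) p *\<^sub>R \<psi> (gsec k e p))"
    unfolding I_def by (rule sum.cartesian_product[symmetric])
  also have "\<dots> = (\<Sum>k\<in>K. (bump k p * bump k p / bumps p) *\<^sub>R \<psi> (V p))"
    by (intro sum.cong refl one)
  also have "\<dots> = (bumps p / bumps p) *\<^sub>R \<psi> (V p)"
    unfolding scaleR_sum_left[symmetric] bumps_def sum_divide_distrib ..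
  finally show ?thesis using bumps_pos[OF ps] by simp
qed

lemma co_inj:
  assumes V: "smooth_section E V" and W: "smooth_section E W" and p: "p \<in> usphere"
    and eq: "\<And>i. co V i p = co W i p"
  shows "V p = W p"
proof -
  obtain A \<psi> where ch: "(A, \<psi>) \<in> trivs E" "p \<in> A" using chart_exists[OF p] by blast
  have "\<psi> (V p) = \<psi> (W p)"
    unfolding chart_reconstruct[OF V ch] chart_reconstruct[OF W ch] eq ..
  then show ?thesis by (rule chart_inj[OF ch section_fibre[OF V p] section_fibre[OF W p]])
qed

lemma co_expand:
  assumes V: "smooth_section E V"
  shows "co V = (\<Sum>i\<in>I. fs (co V i) (co (gsec (fst i) (snd i))))"
proof (intro ext)
  fix j p
  show "co V j p = (\<Sum>i\<in>I. fs (co V i) (co (gsec (fst i) (snd i)))) j p"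
  proof (cases "j \<in> I \<and> p \<in> usphere \<and> p \<in> U (fst j)")
    case True
    then have k: "fst j \<in> K" "p \<in> U (fst j)" by (auto simp: I_def)
    have "\<phi> (fst j) (V p) = (\<Sum>i\<in>I. co V i p *\<^sub>R \<phi> (fst j) (gsec (fst i) (snd i) p))"
      using chart_reconstruct[OF V chart[OF k(1)] k(2)] by (simp add: case_prod_beta')
    then have "\<phi> (fst j) (V p) \<bullet> snd j = (\<Sum>i\<in>I. co V i p * (\<phi> (fst j) (gsec (fst i) (snd i) p) \<bullet> snd j))"
      by (simp add: inner_sum_left)
    then show ?thesis
      using True by (simp add: co_def[of _ j] sum_fun_apply2 sum_distrib_left mult_ac)
  next
    case False
    then show ?thesis by (auto simp: co_def[of _ j] sum_fun_apply2)
  qed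
qed

end

locale vbundle_connection = vbundle_cover E K \<rho> U \<phi> B
  for E :: "('a::euclidean_space, 'e, 'f::euclidean_space) vbundle" and K \<rho> U \<phi> B +
  fixes nabla :: "('a \<Rightarrow> 'a) \<Rightarrow> ('a \<Rightarrow> 'e) \<Rightarrow> 'a \<Rightarrow> 'e"
  assumes conn: "connection E nabla"
begin

lemmas conn_conjuncts = conn[unfolded connection_def]

lemma nabla_section: "vfield X \<Longrightarrow> smooth_section E V \<Longrightarrow> smooth_section E (nabla X V)"
  using conn_conjuncts[THEN conjunct1] by simp

lemma nabla_cong:
  assumes "vfield X" "vfield X'" "smooth_section E V" "smooth_section E V'"
    and "\<And>p. p \<in> usphere \<Longrightarrow> X p = X' p" "\<And>p. p \<in> usphere \<Longrightarrow> V p = V' p" "p \<in> usphere"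
  shows "nabla X V p = nabla X' V' p"
  using conn_conjuncts[THEN conjunct2, THEN conjunct1, rule_format, OF assms(1-4) _ assms(7)] assms(5,6) by blast

lemma nabla_lin:
  assumes "smooth_fun usphere f" "smooth_fun usphere h" "vfield X" "vfield X'" "smooth_section E V" "p \<in> usphere"
  shows "nabla (\<lambda>q. f q *\<^sub>R X q + h q *\<^sub>R X' q) V p
    = fplus E (fscale E (f p) (nabla X V p)) (fscale E (h p) (nabla X' V p))"
  by (rule conn_conjuncts[THEN conjunct2, THEN conjunct2, THEN conjunct1, rule_format, OF assms])

lemma nabla_plus:
  assumes "vfield X" "smooth_section E V" "smooth_section E W" "p \<in> usphere"
  shows "nabla X (\<lambda>q. fplus E (V q) (W q)) p = fplus E (nabla X V p) (nabla X W p)"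
  by (rule conn_conjuncts[THEN conjunct2, THEN conjunct2, THEN conjunct2, THEN conjunct1, rule_format, OF assms])

lemma nabla_scale:
  assumes "smooth_fun usphere f" "vfield X" "smooth_section E V" "p \<in> usphere"
  shows "nabla X (\<lambda>q. fscale E (f q) (V q)) p
    = fplus E (fscale E (sderiv f p (X p)) (V p)) (fscale E (f p) (nabla X V p))"
  by (rule conn_conjuncts[THEN conjunct2, THEN conjunct2, THEN conjunct2, THEN conjunct2, rule_format, OF assms])

section \<open>Transfer of the connection to coefficient functions\<close>

definition Sec :: "('a \<times> 'f \<Rightarrow> 'a \<Rightarrow> real) set"
  where "Sec = {co V | V. smooth_section E V}"

text \<open>By \<open>co_inj\<close> the coefficients determine a section on the sphere, so the
  choice affects only values off the sphere, and \<open>nab_co\<close> holds for every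
  representative.\<close>

definition nab :: "('a \<Rightarrow> 'a) \<Rightarrow> ('a \<times> 'f \<Rightarrow> 'a \<Rightarrow> real) \<Rightarrow> 'a \<times> 'f \<Rightarrow> 'a \<Rightarrow> real"
  where "nab X v = co (nabla X (SOME V. smooth_section E V \<and> co V = v))"

lemma SecI: "smooth_section E V \<Longrightarrow> co V \<in> Sec"
  by (auto simp: Sec_def)

lemma SecE: assumes "v \<in> Sec" obtains V where "smooth_section E V" "v = co V"
  using assms by (auto simp: Sec_def)

lemma nab_co:
  assumes X: "vfield X" and V: "smooth_section E V" shows "nab X (co V) = co (nabla X V)"
proof -
  define V' where "V' = (SOME V'. smooth_section E V' \<and> co V' = co V)"
  have V': "smooth_section E V'" "co V' = co V"
    using someI[of "\<lambda>V'. smooth_section E V' \<and> co V' = co V" V] V unfolding V'_def by auto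
  have "V' p = V p" if "p \<in> usphere" for p
    by (rule co_inj[OF V'(1) V that]) (simp add: V'(2))
  then have "co (nabla X V') = co (nabla X V)"
    by (intro co_cong nabla_cong X V V' refl)
  then show ?thesis by (simp add: nab_def V'_def)
qed

lemma coord: "coord_connection Sec nab I (\<lambda>i. co (gsec (fst i) (snd i)))"
proof
  show "finite I" using K B(2) by (simp add: I_def)
  show "0 \<in> Sec" using SecI[OF section_zero] by (simp add: co_zero)
  show "co (gsec (fst i) (snd i)) \<in> Sec" if "i \<in> I" for i
    using that B(1) by (intro SecI section_gsec) (auto simp: I_def)
next
  fix v assume "v \<in> Sec"
  then obtain V where V: "smooth_section E V" "v = co V" by (rule SecE)
  show "smooth_fun usphere (v i)" for i using co_smooth[OF V(1)] V(2) by simp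
  show "v i p = 0" if "p \<notin> usphere" for i p using that V(2) by (simp add: co_def)
  show "v = (\<Sum>i\<in>I. fs (v i) (co (gsec (fst i) (snd i))))" using co_expand[OF V(1)] V(2) by simp
  show "fs f v \<in> Sec" if "smooth_fun usphere f" for f
    using SecI[OF section_scale[OF that V(1)]] V by (simp add: co_scale)
  fix X :: "'a \<Rightarrow> 'a" assume X: "vfield X"
  show "nab X v \<in> Sec" using SecI[OF nabla_section[OF X V(1)]] V(2) nab_co[OF X V(1)] by simp
  show "nab X v = nab X' v" if "vfield X'" "\<And>p. p \<in> usphere \<Longrightarrow> X p = X' p" for X'
    unfolding V(2) nab_co[OF X V(1)] nab_co[OF that(1) V(1)]
    by (intro co_cong nabla_cong X V that refl)
  show "nab X (fs f v) = fs (fdiff f X) v + fs f (nab X v)" if f: "smooth_fun usphere f" for f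
  proof -
    have df: "smooth_fun usphere (fdiff f X)" by (rule smooth_fun_sderiv[OF f X])
    have "nab X (fs f v) = co (nabla X (\<lambda>q. fscale E (f q) (V q)))"
      using nab_co[OF X section_scale[OF f V(1)]] V by (simp add: co_scale)
    also have "\<dots> = co (\<lambda>p. fplus E (fscale E (fdiff f X p) (V p)) (fscale E (f p) (nabla X V p)))"
      by (intro co_cong nabla_scale f X V)
    also have "\<dots> = fs (fdiff f X) (co V) + fs f (co (nabla X V))"
      using co_plus[OF section_scale[OF df V(1)] section_scale[OF f nabla_section[OF X V(1)]]]
        co_scale[OF V(1)] co_scale[OF nabla_section[OF X V(1)]] by simp
    finally show ?thesis using nab_co[OF X V(1)] V(2) by simp
  qed
  show "nab (\<lambda>q. f q *\<^sub>R X q + h q *\<^sub>R X' q) v = fs f (nab X v) + fs h (nab X' v)"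
    if f: "smooth_fun usphere f" and h: "smooth_fun usphere h" and X': "vfield X'" for f h X'
  proof -
    have fX: "vfield (\<lambda>q. f q *\<^sub>R X q + h q *\<^sub>R X' q)" by (intro vfield_add vfield_scale f h X X')
    have "nab (\<lambda>q. f q *\<^sub>R X q + h q *\<^sub>R X' q) v
      = co (\<lambda>p. fplus E (fscale E (f p) (nabla X V p)) (fscale E (h p) (nabla X' V p)))"
      unfolding V(2) nab_co[OF fX V(1)] by (intro co_cong nabla_lin f h X X' V)
    also have "\<dots> = fs f (co (nabla X V)) + fs h (co (nabla X' V))"
      using co_plus[OF section_scale[OF f nabla_section[OF X V(1)]] section_scale[OF h nabla_section[OF X' V(1)]]]
        co_scale[OF nabla_section[OF X V(1)]] co_scale[OF nabla_section[OF X' V(1)]] by simp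
    finally show ?thesis using nab_co[OF X V(1)] nab_co[OF X' V(1)] V(2) by simp
  qed
next
  fix v w assume "v \<in> Sec" "w \<in> Sec"
  then obtain V W where V: "smooth_section E V" "v = co V" and W: "smooth_section E W" "w = co W"
    by (auto elim!: SecE)
  have vw: "v + w = co (\<lambda>p. fplus E (V p) (W p))" using co_plus[OF V(1) W(1)] V W by simp
  show "v + w \<in> Sec" unfolding vw by (intro SecI section_plus V W)
  fix X :: "'a \<Rightarrow> 'a" assume X: "vfield X"
  have "nab X (v + w) = co (\<lambda>p. fplus E (nabla X V p) (nabla X W p))"
    unfolding vw nab_co[OF X section_plus[OF V(1) W(1)]] by (intro co_cong nabla_plus X V W)
  then show "nab X (v + w) = nab X v + nab X w"
    using co_plus[OF nabla_section[OF X V(1)] nabla_section[OF X W(1)]] nab_co[OF X V(1)] nab_co[OF X W(1)] V W by simp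
qed

sublocale coord_connection Sec nab I "\<lambda>i. co (gsec (fst i) (snd i))"
  by (rule coord)

lemma vfield_lie_bracket:
  assumes X: "vfield X" and Y: "vfield Y" shows "vfield (lie_bracket X Y)"
proof (rule vfieldI)
  show "lie_bracket X Y p \<in> tangent p" if "p \<in> usphere" for p
    using lie_bracket_eq[OF X Y that] vfield_tangent[OF vfield_sbracket[OF X Y] that] by simp
  show "smooth_fun usphere (lie_bracket X Y)"
    by (rule smooth_fun_cong[OF vfield_smooth[OF vfield_sbracket[OF X Y]]])
      (simp only: lie_bracket_eq[OF X Y])
qed

lemma section_curv:
  assumes X: "vfield X" and Y: "vfield Y" and V: "smooth_section E V"
  shows "smooth_section E (curv E nabla X Y V)"
  unfolding curv_def[abs_def]
  by (intro section_minus nabla_section X Y V vfield_lie_bracket)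

lemma co_curv:
  assumes X: "vfield X" and Y: "vfield Y" and V: "smooth_section E V"
  shows "co (curv E nabla X Y V) = Rm X Y (co V)"
proof -
  have "co (nabla (lie_bracket X Y) V) = co (nabla (sbracket X Y) V)"
    by (intro co_cong nabla_cong vfield_lie_bracket vfield_sbracket X Y V refl lie_bracket_eq)
  then show ?thesis
    unfolding curv_def[abs_def] Rm_def
    by (simp add: co_minus section_minus nabla_section X Y V vfield_lie_bracket vfield_sbracket nab_co)
qed

section \<open>The tensor \<open>Dcurv\<close> in terms of coefficients\<close>

context
  fixes nb :: "('a \<Rightarrow> 'a) \<Rightarrow> ('a \<Rightarrow> 'a) \<Rightarrow> 'a \<Rightarrow> 'a"
  assumes nb: "levi_civita nb"
begin

lemma vfield_nb:
  assumes "vfield X" "vfield Y" shows "vfield (nb X Y)"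
  using nb[unfolded levi_civita_def, THEN conjunct1] assms by simp

lemma section_Dcurv_fields:
  assumes "vfield Z" "vfield X" "vfield Y" "smooth_section E V"
  shows "smooth_section E (Dcurv_fields E nabla nb Z X Y V)"
  unfolding Dcurv_fields_def[abs_def]
  by (intro section_minus nabla_section section_curv vfield_nb assms)

lemma co_Dcurv_fields:
  assumes Z: "vfield Z" and X: "vfield X" and Y: "vfield Y" and V: "smooth_section E V"
  shows "co (Dcurv_fields E nabla nb Z X Y V) = DR Z X Y (co V)"
proof -
  have 1: "Rm (nb Z X) Y (co V) = Rm (sconn Z X) Y (co V)"
    by (intro tens_cong[OF tens_Rm1] vfield_nb vfield_sconn Z X Y SecI V levi_civita_eq_sconn[OF nb])
  have 2: "Rm X (nb Z Y) (co V) = Rm X (sconn Z Y) (co V)"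
    by (intro tens_cong[OF tens_Rm2] vfield_nb vfield_sconn Z X Y SecI V levi_civita_eq_sconn[OF nb])
  show ?thesis
    unfolding Dcurv_fields_def[abs_def] DR_def cov_def 1[symmetric] 2[symmetric]
    by (simp add: co_minus section_minus nabla_section section_curv vfield_nb Z X Y V co_curv nab_co[symmetric])
qed

lemma co_at: "V p = W p \<Longrightarrow> co V i p = co W i p"
  by (simp add: co_def)

text \<open>The definite description is resolved by exchanging one argument after the other for a
  different extension of the same vector, each exchange being tensorial; \<open>co_inj\<close> leads
  back from coefficients to the fibre.\<close>

lemma Dcurv_eq:
  assumes Z: "vfield Z" and X: "vfield X" and Y: "vfield Y" and V: "smooth_section E V" and p: "p \<in> usphere"
  shows "Dcurv E nabla nb p (Z p) (X p) (Y p) (V p) = Dcurv_fields E nabla nb Z X Y V p"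
  unfolding Dcurv_def
proof (rule the_equality)
  show "\<forall>Z' X' Y' V'. vfield Z' \<longrightarrow> vfield X' \<longrightarrow> vfield Y' \<longrightarrow> smooth_section E V' \<longrightarrow>
       Z' p = Z p \<longrightarrow> X' p = X p \<longrightarrow> Y' p = Y p \<longrightarrow> V' p = V p \<longrightarrow>
       Dcurv_fields E nabla nb Z' X' Y' V' p = Dcurv_fields E nabla nb Z X Y V p"
  proof (intro allI impI)
    fix Z' X' Y' V'
    assume Z': "vfield Z'" and X': "vfield X'" and Y': "vfield Y'" and V': "smooth_section E V'"
      and eq: "Z' p = Z p" "X' p = X p" "Y' p = Y p" "V' p = V p"
    show "Dcurv_fields E nabla nb Z' X' Y' V' p = Dcurv_fields E nabla nb Z X Y V p"
    proof (rule co_inj[OF section_Dcurv_fields[OF Z' X' Y' V'] section_Dcurv_fields[OF Z X Y V] p])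
      fix i
      have "DR Z' X' Y' (co V') i p = 1 * DR Z X' Y' (co V') i p"
        by (rule tens_pt1[OF tens_DR1[OF X' Y' SecI[OF V']] Z' Z p]) (simp add: eq)
      also have "DR Z X' Y' (co V') i p = 1 * DR Z X Y' (co V') i p"
        by (rule tens_pt1[OF tens_DR2[OF Z Y' SecI[OF V']] X' X p]) (simp add: eq)
      also have "DR Z X Y' (co V') i p = 1 * DR Z X Y (co V') i p"
        by (rule tens_pt1[OF tens_DR3[OF Z X SecI[OF V']] Y' Y p]) (simp add: eq)
      also have "DR Z X Y (co V') i p = DR Z X Y (co V) i p"
        by (rule endo_pointwise[OF endo_DR[OF Z X Y] SecI[OF V'] SecI[OF V]]) (rule co_at[where V=V' and W=V and p=p, OF eq(4)])
      finally show "co (Dcurv_fields E nabla nb Z' X' Y' V') i p = co (Dcurv_fields E nabla nb Z X Y V) i p"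
        by (simp add: co_Dcurv_fields Z' X' Y' V' Z X Y V)
    qed
  qed
next
  fix e assume "\<forall>Z' X' Y' V'. vfield Z' \<longrightarrow> vfield X' \<longrightarrow> vfield Y' \<longrightarrow> smooth_section E V' \<longrightarrow>
       Z' p = Z p \<longrightarrow> X' p = X p \<longrightarrow> Y' p = Y p \<longrightarrow> V' p = V p \<longrightarrow>
       Dcurv_fields E nabla nb Z' X' Y' V' p = e"
  from this[rule_format, OF Z X Y V refl refl refl refl]
  show "e = Dcurv_fields E nabla nb Z X Y V p" by (rule sym)
qed

lemma Dcurv_parallel:
  assumes p0: "p0 \<in> usphere"
    and grad: "\<And>p. p \<in> usphere - {p0, - p0} \<Longrightarrow> \<exists>c. c \<noteq> 0 \<and> G p = c *\<^sub>R radial p0 p"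
    and hyp: "\<And>p x v. p \<in> usphere - {p0, - p0} \<Longrightarrow> x \<in> tangent p \<Longrightarrow> v \<in> fibre E p \<Longrightarrow>
       Dcurv E nabla nb p (G p) (G p) x v = fzero E p"
    and p: "p \<in> usphere" and xyz: "x \<in> tangent p" "y \<in> tangent p" "z \<in> tangent p" and v: "v \<in> fibre E p"
  shows "Dcurv E nabla nb p z x y v = fzero E p"
proof -
  have "DR (radial p0) (radial p0) X w i p = 0"
    if X: "vfield X" and w: "w \<in> Sec" and p: "p \<in> usphere" for X w i p
  proof (cases "p \<in> {p0, - p0}")
    case True
    then have "radial p0 p = 0" using usphere_inner[OF p0] by (auto simp: radial_def)
    then show ?thesis by (intro tens_pt0[OF tens_DR1] X w p vfield_radial)
  next
    case False
    then have pU: "p \<in> usphere - {p0, - p0}" using p by simp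
    obtain c where c: "c \<noteq> 0" "G p = c *\<^sub>R radial p0 p" using grad[OF pU] by blast
    \<comment> \<open>The factor \<open>c\<close> belongs to the one point \<open>p\<close>; kept
      constant, it makes \<open>?Z\<close> a global smooth field with value \<open>G p\<close> at
      \<open>p\<close>.\<close>
    let ?Z = "\<lambda>q. c *\<^sub>R radial p0 q"
    have Z: "vfield ?Z" by (intro vfield_scale smooth_fun_const vfield_radial)
    obtain V where V: "smooth_section E V" "w = co V" using w by (rule SecE)
    have "Dcurv_fields E nabla nb ?Z ?Z X V p = fzero E p"
      using Dcurv_eq[OF Z Z X V(1) p] hyp[OF pU vfield_tangent[OF X p] section_fibre[OF V(1) p]] c(2) by simp
    then have "co (Dcurv_fields E nabla nb ?Z ?Z X V) i p = co (fzero E) i p" by (rule co_at)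
    then have "0 = DR ?Z ?Z X w i p" using co_Dcurv_fields[OF Z Z X V(1)] V(2) by (simp add: co_zero)
    also have "\<dots> = c * DR (radial p0) ?Z X w i p"
      by (rule tens_pt1[OF tens_DR1[OF Z X w] Z vfield_radial p refl])
    also have "DR (radial p0) ?Z X w i p = c * DR (radial p0) (radial p0) X w i p"
      by (rule tens_pt1[OF tens_DR2[OF vfield_radial X w] Z vfield_radial p refl])
    finally show ?thesis using c(1) by simp
  qed
  then interpret radial_connection Sec nab I "\<lambda>i. co (gsec (fst i) (snd i))" p0
    by unfold_locales (rule p0)
  have t: "tfield a p = a" if "a \<in> tangent p" for a
    using tangentD[OF that] by (simp add: tfield_def)
  obtain V where V: "smooth_section E V" "V p = v" by (rule section_through[OF p v])
  have "Dcurv_fields E nabla nb (tfield z) (tfield x) (tfield y) V p = fzero E p"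
  proof (rule co_inj[OF section_Dcurv_fields[OF vfield_tfield vfield_tfield vfield_tfield V(1)] section_zero p])
    show "co (Dcurv_fields E nabla nb (tfield z) (tfield x) (tfield y) V) i p = co (fzero E) i p" for i
      using DR_zero[OF vfield_tfield vfield_tfield vfield_tfield SecI[OF V(1)] p]
      by (simp add: co_Dcurv_fields vfield_tfield V co_zero)
  qed
  then show ?thesis
    using Dcurv_eq[OF vfield_tfield vfield_tfield vfield_tfield V(1) p, of z x y] t xyz V(2) by simp
qed

end

end

section \<open>The distance function of the sphere\<close>

text \<open>The angle to the starting point grows at most with the speed of the curve. As
  \<open>arccos\<close> is not differentiable at 1 and -1, and the value 1 occurs at the start, the
  argument is first scaled by a factor \<open>k < 1\<close>, which then tends to 1.\<close>

lemma arccos_le_length: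
  fixes c :: "real \<Rightarrow> 'a::euclidean_space"
  assumes c: "c C1_differentiable_on {0..1}" and sph: "path_image c \<subseteq> usphere"
  shows "arccos (c 0 \<bullet> c 1) \<le> integral {0..1} (\<lambda>t. norm (vector_derivative c (at t)))"
proof -
  obtain D where D: "\<And>t. t \<in> {0..1} \<Longrightarrow> (c has_vector_derivative D t) (at t)" "continuous_on {0..1} D"
    using c unfolding C1_differentiable_on_def by blast
  define L where "L = integral {0..1} (\<lambda>t. norm (vector_derivative c (at t)))"
  have L: "((\<lambda>t. norm (D t)) has_integral L) {0..1}"
  proof -
    have "L = integral {0..1} (\<lambda>t. norm (D t))"
      unfolding L_def by (intro Henstock_Kurzweil_Integration.integral_cong) (simp only: vector_derivative_at[OF D(1)])
    moreover have "(\<lambda>t. norm (D t)) integrable_on {0..1}"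
      by (intro integrable_continuous_real continuous_on_norm D(2))
    ultimately show ?thesis by (simp add: integrable_integral)
  qed
  define p where "p = c 0"
  define f where "f = (\<lambda>t. p \<bullet> c t)"
  have ct: "c t \<bullet> c t = 1" if "t \<in> {0..1}" for t
    using sph that by (auto simp: path_image_def norm_eq_1 image_subset_iff)
  have pp: "p \<bullet> p = 1" using ct[of 0] by (simp add: p_def)
  have f1: "\<bar>f t\<bar> \<le> 1" if "t \<in> {0..1}" for t
    using Cauchy_Schwarz_ineq2[of p "c t"] pp ct[OF that] by (simp add: f_def norm_eq_sqrt_inner)
  have fc: "continuous_on {0..1} f"
    unfolding f_def
    by (intro continuous_on_inner continuous_on_const continuous_at_imp_continuous_on ballI
        has_vector_derivative_continuous[OF D(1)])
  have step: "arccos (k * f 1) - arccos (k * f 0) \<le> L" if k: "0 < k" "k < 1" for k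
  proof -
    have kf: "\<bar>k * f t\<bar> < 1" if "t \<in> {0..1}" for t
    proof -
      have "\<bar>k * f t\<bar> \<le> k * 1" using f1[OF that] k by (simp add: abs_mult)
      then show ?thesis using k by simp
    qed
    \<comment> \<open>The fundamental theorem is applied with derivatives at interior points; the
      value 0 at the ends satisfies the bound by \<open>norm (D t)\<close> trivially.\<close>
    define g' where "g' = (\<lambda>t. if t \<in> {0<..<1} then - (k * (p \<bullet> D t)) / sqrt (1 - (k * f t)\<^sup>2) else 0)"
    have "(g' has_integral (arccos (k * f 1) - arccos (k * f 0))) {0..1}"
    proof (rule fundamental_theorem_of_calculus_interior)
      show "continuous_on {0..1} (\<lambda>t. arccos (k * f t))"
        using kf by (intro continuous_on_arccos continuous_intros fc) (auto simp: abs_less_iff less_imp_le)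
      fix t :: real assume t: "t \<in> {0<..<1}"
      have "(f has_real_derivative p \<bullet> D t) (at t)"
        unfolding f_def has_real_derivative_iff_has_vector_derivative
        using D(1)[of t] t by (auto intro!: bounded_linear.has_vector_derivative[OF bounded_linear_inner_right])
      then have "((\<lambda>t. arccos (k * f t)) has_real_derivative inverse (- sqrt (1 - (k * f t)\<^sup>2)) * (k * (p \<bullet> D t))) (at t)"
        using kf[of t] t by (intro DERIV_chain2[OF DERIV_arccos] DERIV_cmult) (auto simp: abs_less_iff)
      then show "((\<lambda>t. arccos (k * f t)) has_vector_derivative g' t) (at t)"
        using t by (simp add: g'_def has_real_derivative_iff_has_vector_derivative divide_inverse mult.commute)
    qed simp
    moreover have "g' t \<le> norm (D t)" if t: "t \<in> {0..1}" for t
    proof (cases "t \<in> {0<..<1}")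
      case True
      have "((\<lambda>s. c s \<bullet> c s) has_real_derivative c t \<bullet> D t + D t \<bullet> c t) (at t)"
        using D(1)[OF t] unfolding has_real_derivative_iff_has_vector_derivative has_vector_derivative_def
        by (auto intro!: derivative_eq_intros simp: algebra_simps inner_simps)
      moreover have "((\<lambda>s. c s \<bullet> c s) has_real_derivative 0) (at t)"
        by (rule has_field_derivative_transform_within_open[of "\<lambda>_. 1" _ _ "{0<..<1}"]) (use True ct in auto)
      ultimately have "c t \<bullet> D t + D t \<bullet> c t = 0" by (rule DERIV_unique)
      then have orth: "c t \<bullet> D t = 0" by (simp add: inner_commute)
      \<comment> \<open>The velocity is orthogonal to \<open>c t\<close>, so only the part of
        \<open>p\<close> orthogonal to \<open>c t\<close> matters. Its norm
        \<open>sqrt (1 - (f t)\<^sup>2)\<close>, multiplied by \<open>k\<close>, is at most the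
        denominator in \<open>g'\<close>.\<close>
      define w where "w = p - f t *\<^sub>R c t"
      have "p \<bullet> D t = w \<bullet> D t" by (simp add: w_def inner_simps orth)
      then have "\<bar>p \<bullet> D t\<bar> \<le> norm w * norm (D t)" using Cauchy_Schwarz_ineq2 by simp
      moreover have "norm w = sqrt (1 - (f t)\<^sup>2)"
        unfolding norm_eq_sqrt_inner w_def using pp ct[OF t]
        by (simp add: inner_simps f_def inner_commute power2_eq_square)
      ultimately have "\<bar>k * (p \<bullet> D t)\<bar> \<le> k * sqrt (1 - (f t)\<^sup>2) * norm (D t)"
        using k by (simp add: abs_mult)
      also have "k * sqrt (1 - (f t)\<^sup>2) = sqrt (k\<^sup>2 * (1 - (f t)\<^sup>2))"
        using k by (simp add: real_sqrt_mult)
      also have "\<dots> * norm (D t) \<le> sqrt (1 - (k * f t)\<^sup>2) * norm (D t)"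
        using k by (intro mult_right_mono real_sqrt_le_mono) (auto simp: power_mult_distrib algebra_simps power_le_one)
      finally have "\<bar>k * (p \<bullet> D t)\<bar> \<le> norm (D t) * sqrt (1 - (k * f t)\<^sup>2)" by (simp add: mult.commute)
      moreover have "0 < sqrt (1 - (k * f t)\<^sup>2)" using kf[OF t] by (simp add: abs_square_less_1)
      ultimately have "- (k * (p \<bullet> D t)) / sqrt (1 - (k * f t)\<^sup>2) \<le> norm (D t)"
        by (subst pos_divide_le_eq) linarith+
      then show ?thesis using True by (simp add: g'_def)
    qed (auto simp: g'_def)
    ultimately show ?thesis by (rule has_integral_le[OF _ L])
  qed
  define k where "k = (\<lambda>n. real (Suc n) / real (Suc (Suc n)))"
  have k: "0 < k n" "k n < 1" for n by (simp_all add: k_def)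
  have klim: "k \<longlonglongrightarrow> 1" unfolding k_def using LIMSEQ_Suc[OF LIMSEQ_n_over_Suc_n] by simp
  have lim: "(\<lambda>n. arccos (k n * x)) \<longlonglongrightarrow> arccos x" if x: "\<bar>x\<bar> \<le> 1" for x
  proof (rule continuous_on_tendsto_compose[OF continuous_on_arccos'])
    show "(\<lambda>n. k n * x) \<longlonglongrightarrow> x" using tendsto_mult_right[OF klim, of x] by simp
    have "\<bar>k n * x\<bar> \<le> 1" for n
      using mult_mono[of "k n" 1 "\<bar>x\<bar>" 1] k[of n] x by (simp add: abs_mult)
    then show "\<forall>\<^sub>F n in sequentially. k n * x \<in> {-1..1}" by (simp add: abs_le_iff minus_le_iff)
    show "x \<in> {-1..1}" using x by auto
  qed
  have "arccos (f 1) - arccos (f 0) \<le> L"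
    by (rule LIMSEQ_le_const2[OF tendsto_diff[OF lim[OF f1] lim[OF f1]]]) (use step k in auto)
  moreover have "f 0 = 1" using pp by (simp add: f_def p_def)
  ultimately show ?thesis by (simp add: f_def p_def L_def)
qed

text \<open>The great circle arc, parametrized on the unit interval with constant speed
  \<open>r\<close>, attains the lower bound of \<open>arccos_le_length\<close>.\<close>

lemma sphere_dist_eq:
  fixes p0 q :: "'a::euclidean_space"
  assumes p0: "p0 \<in> usphere" and q: "q \<in> usphere - {p0, - p0}"
  shows "sphere_dist p0 q = arccos (p0 \<bullet> q)"
  unfolding sphere_dist_def
proof (rule cInf_eq_minimum)
  obtain \<theta> r where th: "\<theta> \<in> usphere" "\<theta> \<in> tangent p0" and r: "0 < r" "r < pi" and qr: "q = great_circle p0 \<theta> r"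
    using polar_coordinates[OF p0, of q] q by blast
  have in1: "p0 \<bullet> p0 = 1" "\<theta> \<bullet> \<theta> = 1" "p0 \<bullet> \<theta> = 0" "\<theta> \<bullet> p0 = 0"
    using p0 th tangentD[OF th(2)] by (simp_all add: norm_eq_1 inner_commute)
  have "p0 \<bullet> q = cos r" unfolding qr great_circle_def by (simp add: inner_simps in1)
  then have ar: "arccos (p0 \<bullet> q) = r" using r by (simp add: arccos_cos)
  define c where "c = (\<lambda>t. great_circle p0 \<theta> (r * t))"
  have d: "(c has_vector_derivative r *\<^sub>R (cos (r * t) *\<^sub>R \<theta> - sin (r * t) *\<^sub>R p0)) (at t)" for t
    unfolding c_def great_circle_def has_vector_derivative_def
    by (auto intro!: derivative_eq_intros simp: algebra_simps)
  have n: "norm (vector_derivative c (at t)) = r" for t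
  proof -
    have "(cos (r * t) *\<^sub>R \<theta> - sin (r * t) *\<^sub>R p0) \<bullet> (cos (r * t) *\<^sub>R \<theta> - sin (r * t) *\<^sub>R p0) = 1"
      using sin_cos_squared_add3[of "r * t"] by (simp add: inner_simps in1)
    then have "norm (cos (r * t) *\<^sub>R \<theta> - sin (r * t) *\<^sub>R p0) = 1" by (simp add: norm_eq_1)
    then show ?thesis using r unfolding vector_derivative_at[OF d] by simp
  qed
  have "c C1_differentiable_on {0..1}"
    unfolding C1_differentiable_on_def using d
    by (intro exI[of _ "\<lambda>t. r *\<^sub>R (cos (r * t) *\<^sub>R \<theta> - sin (r * t) *\<^sub>R p0)"]) (auto intro!: continuous_intros)
  moreover have "path_image c \<subseteq> usphere"
    using great_circle_usphere[OF p0 th] by (auto simp: path_image_def c_def)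
  moreover have "pathstart c = p0" "pathfinish c = q"
    by (simp_all add: pathstart_def pathfinish_def c_def qr) (simp add: great_circle_def)
  moreover have "arccos (p0 \<bullet> q) = integral {0..1} (\<lambda>t. norm (vector_derivative c (at t)))"
    by (simp add: n ar)
  ultimately show "arccos (p0 \<bullet> q) \<in> {integral {0..1} (\<lambda>t. norm (vector_derivative c (at t))) | c.
      c C1_differentiable_on {0..1} \<and> path_image c \<subseteq> usphere \<and> pathstart c = p0 \<and> pathfinish c = q}"
    by blast
next
  fix l assume "l \<in> {integral {0..1} (\<lambda>t. norm (vector_derivative c (at t))) | c.
      c C1_differentiable_on {0..1} \<and> path_image c \<subseteq> usphere \<and> pathstart c = p0 \<and> pathfinish c = q}"
  then show "arccos (p0 \<bullet> q) \<le> l" using arccos_le_length by (auto simp: pathstart_def pathfinish_def)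
qed

text \<open>The constant \<open>c\<close> is the reciprocal of the sine of the distance; the minus
  sign in the derivative of \<open>arccos\<close> is absorbed by the sign of
  \<open>radial\<close>.\<close>

lemma gradient_sphere_dist:
  fixes p0 p :: "'a::euclidean_space"
  assumes p0: "p0 \<in> usphere" and p: "p \<in> usphere - {p0, - p0}"
  shows "\<exists>c. c \<noteq> 0 \<and> gradient (sphere_dist p0) p = c *\<^sub>R radial p0 p"
proof -
  have ps: "p \<in> usphere" using p by simp
  obtain \<theta> r where th: "\<theta> \<in> usphere" "\<theta> \<in> tangent p0" and r: "0 < r" "r < pi" and pr: "p = great_circle p0 \<theta> r"
    using polar_coordinates[OF p0 ps] p by blast
  have "p0 \<bullet> p = cos r"
    unfolding pr great_circle_def using p0 tangentD'[OF th(2)] by (simp add: inner_simps norm_eq_1)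
  then have s: "(p0 \<bullet> p)\<^sup>2 < 1"
    using sin_gt_zero[OF r] by (simp add: cos_squared_eq)
  then have bd: "- 1 < p0 \<bullet> p" "p0 \<bullet> p < 1" by (simp_all add: abs_square_less_1 abs_less_iff)
  define c where "c = inverse (sqrt (1 - (p0 \<bullet> p)\<^sup>2))"
  have c: "c \<noteq> 0" using s by (simp add: c_def)
  have "((\<lambda>q. arccos (p0 \<bullet> q)) has_derivative (\<lambda>x. - c * (p0 \<bullet> x))) (at p within usphere)"
  proof -
    have "((\<lambda>q. p0 \<bullet> q) has_derivative (\<lambda>x. p0 \<bullet> x)) (at p within usphere)"
      by (auto intro!: derivative_eq_intros)
    from has_derivative_compose[OF this DERIV_arccos[OF bd, unfolded has_field_derivative_def]]
    show ?thesis by (simp add: c_def inverse_minus_eq)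
  qed
  then have "(sphere_dist p0 has_derivative (\<lambda>x. - c * (p0 \<bullet> x))) (at p within usphere)"
  proof (rule has_derivative_transform_within[OF _ _ ps])
    \<comment> \<open>The formula \<open>sphere_dist_eq\<close> is stated off the poles, so the
      neighbourhood is chosen to avoid both.\<close>
    show "0 < min (dist p0 p) (dist (- p0) p)" using p by auto
    show "arccos (p0 \<bullet> q) = sphere_dist p0 q" if "q \<in> usphere" "dist q p < min (dist p0 p) (dist (- p0) p)" for q
      using that by (intro sphere_dist_eq[OF p0, symmetric]) auto
  qed
  from sderiv_eqI[OF this ps]
  have sd: "sderiv (sphere_dist p0) p x = - c * (p0 \<bullet> x)" if "x \<in> tangent p" for x using that .
  have w: "c *\<^sub>R radial p0 p \<bullet> x = sderiv (sphere_dist p0) p x" if "x \<in> tangent p" for x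
    using sd[OF that] tangentD'[OF that] by (simp add: radial_def inner_simps)
  have wt: "c *\<^sub>R radial p0 p \<in> tangent p"
    using vfield_tangent[OF vfield_radial ps] by simp
  have "gradient (sphere_dist p0) p = c *\<^sub>R radial p0 p"
    unfolding gradient_def
  proof (rule the_equality)
    show "c *\<^sub>R radial p0 p \<in> tangent p \<and> (\<forall>x\<in>tangent p. c *\<^sub>R radial p0 p \<bullet> x = sderiv (sphere_dist p0) p x)"
      using w wt by blast
    fix u assume u: "u \<in> tangent p \<and> (\<forall>x\<in>tangent p. u \<bullet> x = sderiv (sphere_dist p0) p x)"
    have t: "u - c *\<^sub>R radial p0 p \<in> tangent p" using u wt by simp
    have "(u - c *\<^sub>R radial p0 p) \<bullet> (u - c *\<^sub>R radial p0 p) = 0"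
      using conjunct2[OF u] w t by (simp add: inner_diff_left)
    then show "u = c *\<^sub>R radial p0 p" by simp
  qed
  then show ?thesis using c by blast
qed

theorem theorem1p1:
  fixes E :: "('a::euclidean_space, 'e, 'f::euclidean_space) vbundle"
    and g :: "'e \<Rightarrow> 'e \<Rightarrow> real"
    and nabla :: "('a \<Rightarrow> 'a) \<Rightarrow> ('a \<Rightarrow> 'e) \<Rightarrow> 'a \<Rightarrow> 'e"
    and nb :: "('a \<Rightarrow> 'a) \<Rightarrow> ('a \<Rightarrow> 'a) \<Rightarrow> 'a \<Rightarrow> 'a"
    and p0 :: 'a
  assumes "vector_bundle E"
    and "euclidean_structure E g"
    and "connection E nabla"
    and "compatible E g nabla"
    and "levi_civita nb"
    and "p0 \<in> usphere"
    and "\<forall>p\<in>usphere - {p0, - p0}. \<forall>x\<in>tangent p. \<forall>v\<in>fibre E p.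
           Dcurv E nabla nb p (gradient (sphere_dist p0) p) (gradient (sphere_dist p0) p) x v
             = fzero E p"
  shows "\<forall>p\<in>usphere. \<forall>x\<in>tangent p. \<forall>y\<in>tangent p. \<forall>z\<in>tangent p. \<forall>v\<in>fibre E p.
           Dcurv E nabla nb p z x y v = fzero E p"
proof -
  interpret vbundle_sphere E by unfold_locales (rule assms(1))
  obtain K \<rho> U \<phi> B where "vbundle_cover E K \<rho> U \<phi> B" using cover_exists by blast
  then interpret vbundle_cover E K \<rho> U \<phi> B .
  interpret vbundle_connection E K \<rho> U \<phi> B nabla by unfold_locales (rule assms(3))
  show ?thesis
    using Dcurv_parallel[OF assms(5,6) gradient_sphere_dist[OF assms(6)]] assms(7) by blast
qed

end
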